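(* Let $E_*=(E_1,\dots,E_n)$ be a complete exceptional sequence for the linear quiver of type $A_n$, let $F$ be its rooted labeled forest (vertices $v_i$), and let $\delta^nF$ (vertices $v_i'$) be the rooted labeled forest of $\delta^nE_*=(\tau^*E_1,\dots,\tau^*E_n)$. Let $v_{j_1},\dots,v_{j_p}$ be the projective vertices of $F$. Then $\delta^nF_+\cong F_+$ (as unlabeled, unrooted trees) with the projective vertices together with the master root $v_0$ cyclically permuted and all other vertices remaining the same; namely, under this identification of underlying trees, $v_{j_p}'=v_0$, $v_0'=v_{j_1}$, $v_{j_i}'=v_{j_{i+1}}$ for $1\le i<p$, and $v_k'=v_k$ for all other values of $k$. In particular, $v_{j_1}',\dots,v_{j_p}'$ are the injective vertices of $\delta^nF$, and the roots of $\delta^nF$ consist of $v_{j_1}'$ and the children of $v_{j_1}$ in $F$ (i.e. the vertices of $\delta^nF$ with the same labels as those children).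
   Context: Let $K$ be a field, $Q: 1\to 2\to\cdots\to n$, $\Lambda=KQ$; modules are finite-dimensional representations of $Q$ over $K$. A complete exceptional sequence is a sequence $E_*=(E_1,\dots,E_n)$ of rigid indecomposable modules (up to isomorphism) with $\mathrm{Hom}(E_j,E_i)=0=\mathrm{Ext}^1(E_j,E_i)$ for $i<j$. For an indecomposable module $X$, $\tau^*X=\tau X$ (Auslander–Reiten translate) if $X$ is not projective, and $\tau^*P_i=I_i$, where $P_i$ is the projective cover and $I_i$ the injective envelope of the simple module $S_i$ at vertex $i$. A rooted labeled forest with $n$ vertices is a forest with vertices $v_1,\dots,v_n$ and a chosen root in each component. The forest of $E_*$ is the Hasse diagram (roots = maximal elements) of the order $v_i\le v_j$ iff $\mathrm{supp}\,E_i\subseteq \mathrm{supp}\,E_j$; this is a bijection between complete exceptional sequences and rooted labeled forests with $n$ vertices. For a forest $F$, $F_+$ is the tree obtained by adding a vertex $v_0$ (the master root) adjacent to all the roots of $F$. Conversely, a tree with vertices labeled $0,\dots,n$ determines the forest obtained by deleting the vertex labeled $0$, its neighbours being the roots. The braid group $B_n$ acts on complete exceptional sequences by $\sigma_i(E_* )=(E_1,\dots,E_{i-1},E_i',E_i,E_{i+2},\dots,E_n)$ with $E_i'$ the unique module making this a complete exceptional sequence, and $\delta=\sigma_1\sigma_2\cdots\sigma_{n-1}$ (rightmost factor acts first), which acts by $\delta E_*=(\tau^*E_n,E_1,\dots,E_{n-1})$; it acts on forests through the bijection. The projective vertices $v_{j_1},\dots,v_{j_p}$, $j_1<\cdots<j_p$,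 of $F$ are given by: $v_{j_p}$ is the root of $F$ with the largest label; $v_{j_i}$ is the child of $v_{j_{i+1}}$ with largest label among those children whose label is less than $j_{i+1}$; the process stops at $v_{j_1}$, which has no child with smaller label. The injective vertices $v_{k_1},\dots,v_{k_q}$ are given by: $v_{k_1}$ is the root with the smallest label; $v_{k_{i+1}}$ is the child of $v_{k_i}$ with smallest label among those children whose label is greater than $k_i$; the process stops when there is no such child. *)

theory Defs
  imports "Jordan_Normal_Form.Matrix_Kernel"
begin

section \<open>Finite-dimensional representations of the quiver 1 \<rightarrow> 2 \<rightarrow> ... \<rightarrow> n\<close>

text \<open>
  The space at vertex \<open>i\<close> is \<open>K\<^sup>d\<close> with \<open>d = dimv M i\<close>, and \<open>arr M i\<close> is the matrix of the linear
  map attached to the arrow from \<open>i\<close> to \<open>i + 1\<close>.  Up to isomorphism every finite-dimensional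
  representation has this form.  Only the values of \<open>dimv\<close> on \<open>{1..n}\<close> and of \<open>arr\<close> on \<open>{1..<n}\<close>
  carry information; all notions below depend on these values only.
\<close>

record 'k qrep =
  dimv :: "nat \<Rightarrow> nat"
  arr :: "nat \<Rightarrow> 'k mat"

definition is_rep :: "nat \<Rightarrow> 'k::field qrep \<Rightarrow> bool" where
  "is_rep n M \<longleftrightarrow> (\<forall>i\<in>{1..<n}. arr M i \<in> carrier_mat (dimv M (Suc i)) (dimv M i))"

definition is_zero :: "nat \<Rightarrow> 'k::field qrep \<Rightarrow> bool" where
  "is_zero n M \<longleftrightarrow> (\<forall>i\<in>{1..n}. dimv M i = 0)"

definition supp :: "nat \<Rightarrow> 'k::field qrep \<Rightarrow> nat set" where
  "supp n M = {i\<in>{1..n}. dimv M i \<noteq> 0}"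

definition rep_hom :: "nat \<Rightarrow> 'k::field qrep \<Rightarrow> 'k qrep \<Rightarrow> (nat \<Rightarrow> 'k mat) set" where
  "rep_hom n M N = {f. (\<forall>i\<in>{1..n}. f i \<in> carrier_mat (dimv N i) (dimv M i)) \<and>
                   (\<forall>i\<in>{1..<n}. f (Suc i) * arr M i = arr N i * f i)}"

text \<open>Equality of morphisms: the components off \<open>{1..n}\<close> are irrelevant.\<close>

definition eq_mor :: "nat \<Rightarrow> (nat \<Rightarrow> 'k::field mat) \<Rightarrow> (nat \<Rightarrow> 'k mat) \<Rightarrow> bool" where
  "eq_mor n f g \<longleftrightarrow> (\<forall>i\<in>{1..n}. f i = g i)"

definition comp_mor :: "(nat \<Rightarrow> 'k::field mat) \<Rightarrow> (nat \<Rightarrow> 'k mat) \<Rightarrow> nat \<Rightarrow> 'k mat" where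
  "comp_mor g f = (\<lambda>i. g i * f i)"

definition id_mor :: "'k::field qrep \<Rightarrow> nat \<Rightarrow> 'k mat" where
  "id_mor M = (\<lambda>i. 1\<^sub>m (dimv M i))"

definition zero_mor :: "'k::field qrep \<Rightarrow> 'k qrep \<Rightarrow> nat \<Rightarrow> 'k mat" where
  "zero_mor M N = (\<lambda>i. 0\<^sub>m (dimv N i) (dimv M i))"

definition rep_iso :: "nat \<Rightarrow> 'k::field qrep \<Rightarrow> 'k qrep \<Rightarrow> bool" where
  "rep_iso n M N \<longleftrightarrow> (\<exists>f\<in>rep_hom n M N. \<exists>g\<in>rep_hom n N M.
     eq_mor n (comp_mor g f) (id_mor M) \<and> eq_mor n (comp_mor f g) (id_mor N))"

definition mono_mor :: "nat \<Rightarrow> 'k::field qrep \<Rightarrow> (nat \<Rightarrow> 'k mat) \<Rightarrow> bool" where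
  "mono_mor n M f \<longleftrightarrow> (\<forall>i\<in>{1..n}. inj_on (\<lambda>v. f i *\<^sub>v v) (carrier_vec (dimv M i)))"

definition epi_mor :: "nat \<Rightarrow> 'k::field qrep \<Rightarrow> 'k qrep \<Rightarrow> (nat \<Rightarrow> 'k mat) \<Rightarrow> bool" where
  "epi_mor n M N f \<longleftrightarrow>
     (\<forall>i\<in>{1..n}. (\<lambda>v. f i *\<^sub>v v) ` carrier_vec (dimv M i) = carrier_vec (dimv N i))"

definition direct_sum :: "'k::field qrep \<Rightarrow> 'k qrep \<Rightarrow> 'k qrep" where
  "direct_sum M N = \<lparr> dimv = (\<lambda>i. dimv M i + dimv N i),
     arr = (\<lambda>i. four_block_mat (arr M i) (0\<^sub>m (dimv M (Suc i)) (dimv N i))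
                               (0\<^sub>m (dimv N (Suc i)) (dimv M i)) (arr N i)) \<rparr>"

definition indecomposable :: "nat \<Rightarrow> 'k::field qrep \<Rightarrow> bool" where
  "indecomposable n M \<longleftrightarrow> is_rep n M \<and> \<not> is_zero n M \<and>
     (\<forall>A B. is_rep n A \<longrightarrow> is_rep n B \<longrightarrow> rep_iso n M (direct_sum A B) \<longrightarrow> is_zero n A \<or> is_zero n B)"


section \<open>Vanishing of Hom and Ext\<close>

definition hom_zero :: "nat \<Rightarrow> 'k::field qrep \<Rightarrow> 'k qrep \<Rightarrow> bool" where
  "hom_zero n M N \<longleftrightarrow> (\<forall>f\<in>rep_hom n M N. eq_mor n f (zero_mor M N))"

text \<open>Exactness of \<open>0 \<rightarrow> N \<rightarrow> E \<rightarrow> M \<rightarrow> 0\<close> with maps \<open>f\<close> and \<open>g\<close>.\<close>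

definition short_exact :: "nat \<Rightarrow> 'k::field qrep \<Rightarrow> (nat \<Rightarrow> 'k mat) \<Rightarrow> 'k qrep \<Rightarrow>
    (nat \<Rightarrow> 'k mat) \<Rightarrow> 'k qrep \<Rightarrow> bool" where
  "short_exact n N f E g M \<longleftrightarrow> is_rep n N \<and> is_rep n E \<and> is_rep n M \<and>
     f \<in> rep_hom n N E \<and> g \<in> rep_hom n E M \<and> mono_mor n N f \<and> epi_mor n E M g \<and>
     (\<forall>i\<in>{1..n}. (\<lambda>v. f i *\<^sub>v v) ` carrier_vec (dimv N i) = mat_kernel (g i))"

definition split_epi :: "nat \<Rightarrow> 'k::field qrep \<Rightarrow> 'k qrep \<Rightarrow> (nat \<Rightarrow> 'k mat) \<Rightarrow> bool" where
  "split_epi n M N f \<longleftrightarrow> (\<exists>s\<in>rep_hom n N M. eq_mor n (comp_mor f s) (id_mor N))"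

definition split_mono :: "nat \<Rightarrow> 'k::field qrep \<Rightarrow> 'k qrep \<Rightarrow> (nat \<Rightarrow> 'k mat) \<Rightarrow> bool" where
  "split_mono n M N f \<longleftrightarrow> (\<exists>r\<in>rep_hom n N M. eq_mor n (comp_mor r f) (id_mor M))"

text \<open>\<open>Ext\<^sup>1(M,N) = 0\<close>, with \<open>Ext\<^sup>1\<close> understood as equivalence classes of extensions (Yoneda).\<close>

definition ext_zero :: "nat \<Rightarrow> 'k::field qrep \<Rightarrow> 'k qrep \<Rightarrow> bool" where
  "ext_zero n M N \<longleftrightarrow> (\<forall>E f g. short_exact n N f E g M \<longrightarrow> split_epi n E M g)"

definition rigid :: "nat \<Rightarrow> 'k::field qrep \<Rightarrow> bool" where
  "rigid n M \<longleftrightarrow> ext_zero n M M"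


section \<open>Projectives, injectives and the map \<open>\<tau>\<^sup>*\<close>\<close>

definition simple_rep :: "nat \<Rightarrow> 'k::field qrep" where
  "simple_rep i = \<lparr> dimv = (\<lambda>j. if j = i then 1 else 0),
     arr = (\<lambda>j. 0\<^sub>m (if Suc j = i then 1 else 0) (if j = i then 1 else 0)) \<rparr>"

definition projective_rep :: "nat \<Rightarrow> 'k::field qrep \<Rightarrow> bool" where
  "projective_rep n P \<longleftrightarrow> is_rep n P \<and>
     (\<forall>A B g h. is_rep n A \<longrightarrow> is_rep n B \<longrightarrow> g \<in> rep_hom n A B \<longrightarrow> epi_mor n A B g \<longrightarrow>
        h \<in> rep_hom n P B \<longrightarrow> (\<exists>k\<in>rep_hom n P A. eq_mor n (comp_mor g k) h))"

definition injective_rep :: "nat \<Rightarrow> 'k::field qrep \<Rightarrow> bool" where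
  "injective_rep n I \<longleftrightarrow> is_rep n I \<and>
     (\<forall>A B g h. is_rep n A \<longrightarrow> is_rep n B \<longrightarrow> g \<in> rep_hom n A B \<longrightarrow> mono_mor n A g \<longrightarrow>
        h \<in> rep_hom n A I \<longrightarrow> (\<exists>k\<in>rep_hom n B I. eq_mor n (comp_mor k g) h))"

definition projective_cover :: "nat \<Rightarrow> 'k::field qrep \<Rightarrow> 'k qrep \<Rightarrow> bool" where
  "projective_cover n P M \<longleftrightarrow> projective_rep n P \<and>
     (\<exists>p\<in>rep_hom n P M. epi_mor n P M p \<and>
        (\<forall>Z. is_rep n Z \<longrightarrow> (\<forall>h\<in>rep_hom n Z P. epi_mor n Z M (comp_mor p h) \<longrightarrow> epi_mor n Z P h)))"

definition injective_envelope :: "nat \<Rightarrow> 'k::field qrep \<Rightarrow> 'k qrep \<Rightarrow> bool" where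
  "injective_envelope n I M \<longleftrightarrow> injective_rep n I \<and>
     (\<exists>e\<in>rep_hom n M I. mono_mor n M e \<and>
        (\<forall>Z. is_rep n Z \<longrightarrow> (\<forall>h\<in>rep_hom n I Z. mono_mor n M (comp_mor h e) \<longrightarrow> mono_mor n I h)))"

definition right_almost_split :: "nat \<Rightarrow> 'k::field qrep \<Rightarrow> 'k qrep \<Rightarrow> (nat \<Rightarrow> 'k mat) \<Rightarrow> bool" where
  "right_almost_split n E X g \<longleftrightarrow> \<not> split_epi n E X g \<and>
     (\<forall>Z. is_rep n Z \<longrightarrow> (\<forall>h\<in>rep_hom n Z X. \<not> split_epi n Z X h \<longrightarrow>
        (\<exists>k\<in>rep_hom n Z E. eq_mor n (comp_mor g k) h)))"

definition left_almost_split :: "nat \<Rightarrow> 'k::field qrep \<Rightarrow> 'k qrep \<Rightarrow> (nat \<Rightarrow> 'k mat) \<Rightarrow> bool" where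
  "left_almost_split n Y E f \<longleftrightarrow> \<not> split_mono n Y E f \<and>
     (\<forall>Z. is_rep n Z \<longrightarrow> (\<forall>h\<in>rep_hom n Y Z. \<not> split_mono n Y Z h \<longrightarrow>
        (\<exists>k\<in>rep_hom n E Z. eq_mor n (comp_mor k f) h)))"

text \<open>
  The Auslander--Reiten translate of a non-projective indecomposable \<open>X\<close> is the left-hand term of
  the almost split sequence ending in \<open>X\<close>; it is determined up to isomorphism.
\<close>

definition is_AR_translate :: "nat \<Rightarrow> 'k::field qrep \<Rightarrow> 'k qrep \<Rightarrow> bool" where
  "is_AR_translate n X Y \<longleftrightarrow> (\<exists>E f g. short_exact n Y f E g X \<and>
     left_almost_split n Y E f \<and> right_almost_split n E X g)"

text \<open>\<open>Y \<cong> \<tau>\<^sup>* X\<close>, for \<open>X\<close> indecomposable.\<close>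

definition is_tau_star :: "nat \<Rightarrow> 'k::field qrep \<Rightarrow> 'k qrep \<Rightarrow> bool" where
  "is_tau_star n X Y \<longleftrightarrow>
     (if projective_rep n X
      then \<exists>i\<in>{1..n}. projective_cover n X (simple_rep i) \<and> injective_envelope n Y (simple_rep i)
      else is_AR_translate n X Y)"


section \<open>Complete exceptional sequences and the braid action\<close>

definition complete_exceptional :: "nat \<Rightarrow> (nat \<Rightarrow> 'k::field qrep) \<Rightarrow> bool" where
  "complete_exceptional n E \<longleftrightarrow>
     (\<forall>i\<in>{1..n}. is_rep n (E i) \<and> rigid n (E i) \<and> indecomposable n (E i)) \<and>
     (\<forall>i\<in>{1..n}. \<forall>j\<in>{1..n}. i < j \<longrightarrow> hom_zero n (E j) (E i) \<and> ext_zero n (E j) (E i))"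

text \<open>
  The module chosen by \<open>SOME\<close> is unique up to isomorphism, so \<open>braid\<close> and \<open>delta\<close> are well defined on
  isomorphism classes of complete exceptional sequences.
\<close>

definition braid :: "nat \<Rightarrow> nat \<Rightarrow> (nat \<Rightarrow> 'k::field qrep) \<Rightarrow> nat \<Rightarrow> 'k qrep" where
  "braid n i E = E(i := (SOME X. complete_exceptional n (E(i := X, Suc i := E i))), Suc i := E i)"

text \<open>The product of the braids with indices \<open>1, 2, \<dots>, n - 1\<close>; the last of them acts first.\<close>

definition delta :: "nat \<Rightarrow> (nat \<Rightarrow> 'k::field qrep) \<Rightarrow> nat \<Rightarrow> 'k qrep" where
  "delta n E = foldr (braid n) [1..<n] E"


section \<open>Rooted labeled forests\<close>

text \<open>
  A rooted labeled forest on the vertices \<open>{1..n}\<close> is given by its set of pairs (child, parent).  In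
  the forest of an exceptional sequence these are the covering pairs of the order by inclusion of
  supports, so the vertices without parent are the maximal elements.
\<close>

type_synonym forest = "(nat \<times> nat) set"

definition forest_of :: "nat \<Rightarrow> (nat \<Rightarrow> 'k::field qrep) \<Rightarrow> forest" where
  "forest_of n E = {(i, j). i \<in> {1..n} \<and> j \<in> {1..n} \<and> supp n (E i) \<subset> supp n (E j) \<and>
     \<not> (\<exists>k\<in>{1..n}. supp n (E i) \<subset> supp n (E k) \<and> supp n (E k) \<subset> supp n (E j))}"

definition forest_roots :: "nat \<Rightarrow> forest \<Rightarrow> nat set" where
  "forest_roots n F = {v\<in>{1..n}. \<forall>w. (v, w) \<notin> F}"

definition children :: "forest \<Rightarrow> nat \<Rightarrow> nat set" where
  "children F v = {c. (c, v) \<in> F}"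

text \<open>Edges of the tree \<open>F\<^sub>+\<close> on the vertices \<open>{0..n}\<close>, with master root \<open>0\<close>.\<close>

definition plus_edges :: "nat \<Rightarrow> forest \<Rightarrow> nat set set" where
  "plus_edges n F = {{c, v} | c v. (c, v) \<in> F} \<union> {{0, r} | r. r \<in> forest_roots n F}"

definition graph_iso :: "nat set \<Rightarrow> nat set set \<Rightarrow> nat set \<Rightarrow> nat set set \<Rightarrow> (nat \<Rightarrow> nat) \<Rightarrow> bool" where
  "graph_iso V A W B \<phi> \<longleftrightarrow> bij_betw \<phi> V W \<and>
     (\<forall>x\<in>V. \<forall>y\<in>V. {x, y} \<in> A \<longleftrightarrow> {\<phi> x, \<phi> y} \<in> B)"

definition greatest_in :: "nat set \<Rightarrow> nat \<Rightarrow> bool" where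
  "greatest_in S m \<longleftrightarrow> m \<in> S \<and> (\<forall>x\<in>S. x \<le> m)"

definition least_in :: "nat set \<Rightarrow> nat \<Rightarrow> bool" where
  "least_in S m \<longleftrightarrow> m \<in> S \<and> (\<forall>x\<in>S. m \<le> x)"

text \<open>The projective vertices of \<open>F\<close> are labeled \<open>j 1 < \<dots> < j p\<close>.\<close>

definition projective_vertices :: "nat \<Rightarrow> forest \<Rightarrow> nat \<Rightarrow> (nat \<Rightarrow> nat) \<Rightarrow> bool" where
  "projective_vertices n F p j \<longleftrightarrow> p \<ge> 1 \<and> greatest_in (forest_roots n F) (j p) \<and>
     (\<forall>i\<in>{1..<p}. greatest_in {c \<in> children F (j (Suc i)). c < j (Suc i)} (j i)) \<and>
     {c \<in> children F (j 1). c < j 1} = {}"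

text \<open>The injective vertices of \<open>F\<close> are labeled \<open>k 1 < \<dots> < k q\<close>.\<close>

definition injective_vertices :: "nat \<Rightarrow> forest \<Rightarrow> nat \<Rightarrow> (nat \<Rightarrow> nat) \<Rightarrow> bool" where
  "injective_vertices n F q k \<longleftrightarrow> q \<ge> 1 \<and> least_in (forest_roots n F) (k 1) \<and>
     (\<forall>i\<in>{1..<q}. least_in {c \<in> children F (k i). k i < c} (k (Suc i))) \<and>
     {c \<in> children F (k q). k q < c} = {}"

end

theory Submission
  imports Defs
begin

text \<open>
  Every indecomposable representation is an interval module \<open>ivl a b\<close> (support \<open>{a..<b}\<close>), which is
  read as the chord from \<open>a\<close> to \<open>b\<close> of a polygon with vertices \<open>1, \<dots>, n + 1\<close>.  The vanishing of
  \<open>Hom\<close> and \<open>Ext\<close> between two intervals says that the chords do not cross and that their labels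
  decrease or increase in a prescribed way at a common endpoint (\<open>exc\<close>), so complete exceptional
  sequences become labeled noncrossing trees, and \<open>\<tau>\<^sup>*\<close> becomes the rotation of the polygon.
  Each chord covers exactly one elementary interval that is not covered by a smaller chord; a count
  of these shows that a sequence with one missing entry has only one completion, and hence
  \<open>\<delta>(t\<^sub>1, \<dots>, t\<^sub>n) = (\<tau>\<^sup>* t\<^sub>n, t\<^sub>1, \<dots>, t\<^sub>n\<^sub>-\<^sub>1)\<close> and \<open>\<delta>\<^sup>n = \<tau>\<^sup>*\<close>.  The tree \<open>F\<^sub>+\<close> is dual to the
  noncrossing tree; rotation only moves the region that serves as the master root, past the
  projective vertices, which are the chords ending at \<open>n + 1\<close>.
\<close>

text \<open>A vertex \<open>k\<close> of the tree stands for the region directly under chord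
  \<open>k\<close>, the master root for the region above all chords, and the edge from
  \<open>k\<close> to its parent for chord \<open>k\<close> itself. Rotation preserves the labels of
  the chords, hence of the edges; only vertex names change, because a vertex is named by the first
  edge on its path to the root. Seen in the unrotated polygon, the root moves from the region at the
  side joining 1 and n + 1 to the region at the side joining n and n + 1. The chords separating
  these regions are those ending at n + 1, nested in one another. Each region on this path is
  renamed after the next chord on the way to the new root, which is the cyclic permutation; the
  other regions keep their names. The algebraic obstacle is that \<open>braid\<close> picks a module
  by \<open>SOME\<close>. Uniqueness of the missing entry is therefore needed for chords, where it
  becomes a count: two different completions would allow n + 1 chords in one noncrossing tree on n +
  1 vertices. Uniqueness also spares computing products of mutations, since the first entry of
  \<open>delta n E\<close> is forced by the other n - 1.\<close>

section \<open>Noncrossing chords\<close>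

text \<open>With chords read as intervals, \<open>exc s t\<close> says that \<open>Hom\<close> and \<open>Ext\<^sup>1\<close> from \<open>t\<close> to \<open>s\<close> vanish.\<close>

definition exc :: "nat \<times> nat \<Rightarrow> nat \<times> nat \<Rightarrow> bool" where
  "exc s t \<longleftrightarrow> \<not> (fst s \<le> fst t \<and> fst t < snd s \<and> snd s \<le> snd t) \<and>
     \<not> (fst t < fst s \<and> fst s \<le> snd t \<and> snd t < snd s)"

lemma finite_ex_greatest:
  fixes f :: "'a \<Rightarrow> nat"
  assumes "finite S" "i \<in> S"
  obtains j where "j \<in> S" "\<And>k. k \<in> S \<Longrightarrow> f k \<le> f j"
proof -
  have "Max (f ` S) \<in> f ` S" using assms by (intro Max_in) auto
  then obtain j where "j \<in> S" "f j = Max (f ` S)" by auto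
  then show thesis using that[of j] assms by simp
qed

text \<open>The label set is arbitrary because \<open>no_insertion\<close> works with even labels
  and one odd label, in order to reach a family with one chord too many.\<close>

locale chord_family =
  fixes L :: "nat set" and N :: nat and t :: "nat \<Rightarrow> nat \<times> nat"
  assumes fin: "finite L"
    and chord: "i \<in> L \<Longrightarrow> 1 \<le> fst (t i) \<and> fst (t i) < snd (t i) \<and> snd (t i) \<le> N"
    and exc: "i \<in> L \<Longrightarrow> k \<in> L \<Longrightarrow> i < k \<Longrightarrow> exc (t i) (t k)"
begin

abbreviation lo :: "nat \<Rightarrow> nat" where "lo i \<equiv> fst (t i)"
abbreviation hi :: "nat \<Rightarrow> nat" where "hi i \<equiv> snd (t i)"

definition ins :: "nat \<Rightarrow> nat \<Rightarrow> bool" where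
  "ins i k \<longleftrightarrow> lo k \<le> lo i \<and> hi i \<le> hi k \<and> t i \<noteq> t k"

definition child :: "nat \<Rightarrow> nat \<Rightarrow> bool" where
  "child i k \<longleftrightarrow> i \<in> L \<and> k \<in> L \<and> ins i k \<and> \<not> (\<exists>l\<in>L. ins i l \<and> ins l k)"

definition root :: "nat \<Rightarrow> bool" where
  "root i \<longleftrightarrow> i \<in> L \<and> \<not> (\<exists>l\<in>L. ins i l)"

text \<open>The number \<open>m\<close> stands for the side of the polygon from \<open>m\<close> to
  \<open>m + 1\<close>.\<close>

definition covers :: "nat \<Rightarrow> nat \<Rightarrow> bool" where
  "covers i m \<longleftrightarrow> lo i \<le> m \<and> m < hi i"

text \<open>In the dual tree this says that side \<open>m\<close> bounds the region directly under
  chord \<open>k\<close>.\<close>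

definition own :: "nat \<Rightarrow> nat \<Rightarrow> bool" where
  "own k m \<longleftrightarrow> covers k m \<and> \<not> (\<exists>c\<in>L. ins c k \<and> covers c m)"

text \<open>For two crossing intervals there is a nonzero Hom from the right one to the left one and
  a nonzero Ext from the left one to the right one, so neither order of the labels is
  admissible.\<close>

lemma laminar:
  assumes "i \<in> L" "k \<in> L" "i \<noteq> k"
  shows "hi i \<le> lo k \<or> hi k \<le> lo i \<or> ins i k \<or> ins k i"
  using assms
proof (induction i k rule: linorder_wlog)
  case (le i k)
  then show ?case
    using exc[of i k] chord[of i] chord[of k] unfolding exc_def ins_def prod_eq_iff by linarith
qed auto

text \<open>At a common endpoint only one order satisfies \<open>exc\<close>. Around a polygon
  vertex the labels increase from the innermost chord on its left through the outermost chords to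
  the innermost chord on its right.\<close>

lemma label_order:
  assumes "i \<in> L" "k \<in> L" "i \<noteq> k"
  shows "hi i = lo k \<Longrightarrow> i < k"
    and "lo i = lo k \<Longrightarrow> ins i k \<Longrightarrow> k < i"
    and "hi i = hi k \<Longrightarrow> ins i k \<Longrightarrow> i < k"
    and "lo i \<noteq> lo k \<or> hi i \<noteq> hi k"
  using exc[of i k] exc[of k i] chord[of i] chord[of k] assms linorder_neqE_nat[OF assms(3)]
  unfolding exc_def ins_def prod_eq_iff by (linarith)+

lemma ins_trans: "ins i k \<Longrightarrow> ins k l \<Longrightarrow> ins i l"
  unfolding ins_def prod_eq_iff by linarith

lemma ins_irrefl [simp]: "\<not> ins i i"
  by (simp add: ins_def)

lemma ins_covers: "ins i k \<Longrightarrow> covers i m \<Longrightarrow> covers k m"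
  unfolding ins_def covers_def by linarith

lemma covers_laminar:
  assumes "i \<in> L" "k \<in> L" "i \<noteq> k" "covers i m" "covers k m"
  shows "ins i k \<or> ins k i"
  using laminar[OF assms(1-3)] assms(4,5) unfolding covers_def by linarith

lemma ex_maximal:
  assumes "i \<in> L" "P i"
  obtains j where "j \<in> L" "P j" "j = i \<or> ins i j" "\<forall>l\<in>L. P l \<longrightarrow> \<not> ins j l"
proof -
  let ?S = "{j \<in> L. P j \<and> (j = i \<or> ins i j)}"
  have "finite ?S" "i \<in> ?S" using fin assms by auto
  then obtain j where j: "j \<in> ?S" and mx: "\<And>k. k \<in> ?S \<Longrightarrow> hi k - lo k \<le> hi j - lo j"
    using finite_ex_greatest[of ?S i "\<lambda>j. hi j - lo j"] by blast
  show thesis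
  proof
    show "j \<in> L" "P j" "j = i \<or> ins i j" using j by auto
    show "\<forall>l\<in>L. P l \<longrightarrow> \<not> ins j l"
    proof (intro ballI impI notI)
      fix l assume l: "l \<in> L" "P l" and jl: "ins j l"
      then have "l \<in> ?S" using l j ins_trans by blast
      from mx[OF this] jl chord[OF l(1)] chord[of j] j show False
        unfolding ins_def prod_eq_iff by auto
    qed
  qed
qed

lemma ex_child:
  assumes "i \<in> L" "k \<in> L" "ins i k"
  obtains c where "child c k" "c = i \<or> ins i c"
proof -
  obtain j where "j \<in> L" "ins j k" "j = i \<or> ins i j" "\<forall>l\<in>L. ins l k \<longrightarrow> \<not> ins j l"
    by (rule ex_maximal[of i "\<lambda>j. ins j k", OF assms(1,3)]) blast
  then show thesis using that[of j] assms by (auto simp: child_def)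
qed

lemma ex_root:
  assumes "i \<in> L"
  obtains r where "root r" "r = i \<or> ins i r"
proof -
  obtain j where "j \<in> L" "j = i \<or> ins i j" "\<forall>l\<in>L. \<not> ins j l"
    by (rule ex_maximal[of i "\<lambda>_. True", OF assms TrueI]) blast
  then show thesis using that[of j] by (auto simp: root_def)
qed

lemma ex_parent:
  assumes "i \<in> L" "\<not> root i"
  obtains k where "child i k"
proof -
  let ?S = "{j \<in> L. ins i j}"
  have "finite ?S" "?S \<noteq> {}" using fin assms by (auto simp: root_def)
  then obtain j where j: "j \<in> ?S" and mn: "\<And>k. k \<in> ?S \<Longrightarrow> hi j - lo j \<le> hi k - lo k"
    using ex_min_if_finite[of "(\<lambda>j. hi j - lo j) ` ?S"] by (simp add: image_iff) (meson not_less)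
  have "child i j"
    unfolding child_def
  proof (intro conjI notI)
    assume "\<exists>l\<in>L. ins i l \<and> ins l j"
    then obtain l where l: "l \<in> L" "ins i l" "ins l j" by blast
    from mn[of l] l chord[of l] chord[of j] j show False
      unfolding ins_def prod_eq_iff by auto
  qed (use assms j in auto)
  then show thesis by (rule that)
qed

lemma parent_not_root: "child i k \<Longrightarrow> i \<in> L \<and> \<not> root i"
  by (auto simp: child_def root_def)

lemma child_disjoint:
  assumes "child c k" "child d k" "c \<noteq> d"
  shows "hi c \<le> lo d \<or> hi d \<le> lo c"
  using laminar[of c d] assms unfolding child_def by blast

lemma root_disjoint:
  assumes "root c" "root d" "c \<noteq> d"
  shows "hi c \<le> lo d \<or> hi d \<le> lo c"
  using laminar[of c d] assms unfolding root_def by blast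

text \<open>Both parents cover the side at \<open>lo i\<close>, so they are nested, and the outer
  one is not minimal above \<open>i\<close>.\<close>

lemma parent_unique:
  assumes "child i k" "child i l"
  shows "k = l"
proof (rule ccontr)
  assume "k \<noteq> l"
  have "covers i (lo i)" using chord[of i] assms(1) by (auto simp: covers_def child_def)
  then have "ins k l \<or> ins l k"
    using covers_laminar[OF _ _ \<open>k \<noteq> l\<close>] ins_covers assms unfolding child_def by blast
  then show False using assms unfolding child_def by blast
qed

lemma private_child:
  assumes "k \<in> L"
  shows "own k m \<longleftrightarrow> covers k m \<and> (\<forall>c. child c k \<longrightarrow> \<not> covers c m)"
proof -
  have "\<exists>d. child d k \<and> covers d m" if "c \<in> L" "ins c k" "covers c m" for c
    using ex_child[OF that(1) assms that(2)] ins_covers that(3) by metis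
  then show ?thesis unfolding own_def by (auto simp: child_def)
qed

text \<open>The points \<open>rgt k\<close> and \<open>lft k - 1\<close> are covered by no child; in a complete family they
  coincide and separate the children with label above \<open>k\<close> (left) from the others (right).\<close>

definition rgt :: "nat \<Rightarrow> nat" where
  "rgt k = Max (insert (lo k) (hi ` {c. child c k \<and> k < c}))"

definition lft :: "nat \<Rightarrow> nat" where
  "lft k = Min (insert (hi k) (lo ` {c. child c k \<and> c < k}))"

lemma finite_children: "finite {c. child c k \<and> Q c}"
  by (rule finite_subset[OF _ fin]) (auto simp: child_def)

text \<open>By maximality a child over the side \<open>rgt k\<close> has a label below
  \<open>k\<close>. It must start exactly there, so it shares its left end with \<open>k\<close> or
  continues a child with label above \<open>k\<close>, and either way \<open>label_order\<close>
  gives the opposite inequality.\<close>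

lemma private_rgt:
  assumes k: "k \<in> L"
  shows "own k (rgt k)"
proof -
  let ?S = "insert (lo k) (hi ` {c. child c k \<and> k < c})"
  have f: "finite ?S" using finite_children[of k "\<lambda>c. k < c"] by auto
  have mx: "hi c \<le> rgt k" if "child c k" "k < c" for c
    unfolding rgt_def by (rule Max_ge[OF f]) (use that in auto)
  have "rgt k \<in> ?S" unfolding rgt_def by (rule Max_in[OF f]) auto
  then consider "rgt k = lo k" | c where "child c k" "k < c" "rgt k = hi c" by auto
  note rg = this
  have lok: "lo k \<le> rgt k" unfolding rgt_def by (rule Max_ge[OF f]) auto
  have "covers k (rgt k)"
    using rg
  proof cases
    case 1 then show ?thesis using chord[OF k] by (auto simp: covers_def)
  next
    case (2 c)
    then have "hi c \<noteq> hi k" using label_order(3)[of c k] by (auto simp: child_def)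
    then show ?thesis using 2 lok by (auto simp: covers_def child_def ins_def)
  qed
  moreover have "\<not> covers d (rgt k)" if d: "child d k" for d
  proof
    assume cov: "covers d (rgt k)"
    have dk: "d \<in> L" "ins d k" "d \<noteq> k" using d unfolding child_def by auto
    have dlt: "d < k" using mx[OF d] cov dk(3) linorder_neqE_nat[OF dk(3)] by (fastforce simp: covers_def)
    have "lo d \<noteq> lo k" using label_order(2)[OF dk(1) k dk(3)] dk dlt by auto
    from rg show False
    proof cases
      case 1 then show False using \<open>lo d \<noteq> lo k\<close> dk(2) cov by (auto simp: covers_def ins_def)
    next
      case (2 c)
      then have "c \<noteq> d" using dlt by auto
      from child_disjoint[OF 2(1) d this] cov 2 chord[of c] have "hi c = lo d"
        by (auto simp: covers_def child_def)
      then show False using label_order(1)[of c d] 2 dlt \<open>c \<noteq> d\<close> dk by (auto simp: child_def)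
    qed
  qed
  ultimately show ?thesis using private_child[OF k] by blast
qed

lemma private_lft:
  assumes k: "k \<in> L"
  shows "own k (lft k - 1)" "lft k \<ge> 1"
proof -
  let ?S = "insert (hi k) (lo ` {c. child c k \<and> c < k})"
  have f: "finite ?S" using finite_children[of k "\<lambda>c. c < k"] by auto
  have mx: "lft k \<le> lo c" if "child c k" "c < k" for c
    unfolding lft_def by (rule Min_le[OF f]) (use that in auto)
  have "lft k \<in> ?S" unfolding lft_def by (rule Min_in[OF f]) auto
  then consider "lft k = hi k" | c where "child c k" "c < k" "lft k = lo c" by auto
  note rg = this
  have lok: "lft k \<le> hi k" unfolding lft_def by (rule Min_le[OF f]) auto
  \<comment> \<open>Ensures that the subtraction in \<open>lft k - 1\<close> is not
    truncated.\<close>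
  show pos: "lft k \<ge> 1" using rg chord[OF k] chord by (cases) (auto simp: child_def)
  have "covers k (lft k - 1)"
    using rg
  proof cases
    case 1 then show ?thesis using chord[OF k] by (auto simp: covers_def)
  next
    case (2 c)
    then have "lo c \<noteq> lo k" using label_order(2)[of c k] by (auto simp: child_def)
    then show ?thesis using 2 lok pos by (auto simp: covers_def child_def ins_def)
  qed
  moreover have "\<not> covers d (lft k - 1)" if d: "child d k" for d
  proof
    assume cov: "covers d (lft k - 1)"
    have dk: "d \<in> L" "ins d k" "d \<noteq> k" using d unfolding child_def by auto
    have dlt: "k < d" using mx[OF d] cov pos linorder_neqE_nat[OF dk(3)] by (fastforce simp: covers_def)
    have "hi d \<noteq> hi k" using label_order(3)[OF dk(1) k dk(3)] dk dlt by auto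
    from rg show False
    proof cases
      case 1 then show False using \<open>hi d \<noteq> hi k\<close> dk(2) cov pos by (auto simp: covers_def ins_def)
    next
      case (2 c)
      then have "c \<noteq> d" using dlt by auto
      from child_disjoint[OF 2(1) d this] cov 2 chord[of c] pos have "hi d = lo c"
        by (auto simp: covers_def child_def)
      then show False using label_order(1)[of d c] 2 dlt \<open>c \<noteq> d\<close> dk by (auto simp: child_def)
    qed
  qed
  ultimately show "own k (lft k - 1)" using private_child[OF k] by blast
qed

text \<open>Two chords over the same side are nested, and the inner one takes the side away from the
  outer one.\<close>

lemma private_inj:
  assumes "i \<in> L" "k \<in> L" "own i m" "own k m"
  shows "i = k"
  using covers_laminar[of i k m] assms unfolding own_def by blast

lemma inj_rgt: "inj_on rgt L"
  by (rule inj_onI) (metis private_inj private_rgt)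

lemma rgt_range: "rgt ` L \<subseteq> {1..<N}"
proof -
  have "rgt i \<in> {1..<N}" if "i \<in> L" for i
    using private_rgt[OF that] chord[OF that] by (auto simp: own_def covers_def)
  then show ?thesis by auto
qed

lemma card_le: "card L \<le> N - 1"
  using card_inj_on_le[OF inj_rgt rgt_range] by simp

end

section \<open>Families with the maximal number of chords\<close>

locale complete_family = chord_family +
  assumes card_L: "card L = N - 1"
begin

text \<open>An injective map between sets of \<open>N - 1\<close> elements: every side has an owner,
  so the regions are in bijection with the chords.\<close>

lemma rgt_onto: "rgt ` L = {1..<N}"
  by (rule card_subset_eq) (use rgt_range card_image[OF inj_rgt] card_L in auto)

lemma private_unique:
  assumes "k \<in> L" "own k m"
  shows "m = rgt k"
proof -
  have "m \<in> {1..<N}" using assms chord[OF assms(1)] by (auto simp: own_def covers_def)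
  then have "m \<in> rgt ` L" by (simp only: rgt_onto)
  then obtain l where l: "l \<in> L" "m = rgt l" by blast
  then show ?thesis using private_inj[OF assms(1) l(1) assms(2)] private_rgt by auto
qed

text \<open>Both \<open>rgt k\<close> and \<open>lft k - 1\<close> are owned by \<open>k\<close>,
  which owns a single side. Every child of \<open>k\<close> then lies to the left or to the right of
  this side according to its label.\<close>

lemma lft_eq: "k \<in> L \<Longrightarrow> lft k = Suc (rgt k)"
  using private_unique[OF _ private_lft(1)] private_lft(2)[of k] by fastforce

lemma child_gt:
  assumes "child c k" "k < c" shows "hi c \<le> rgt k"
  unfolding rgt_def using finite_children[of k "\<lambda>c. k < c"] assms by auto

lemma child_lt:
  assumes "child c k" "c < k" shows "rgt k < lo c"
proof -
  have "lft k \<le> lo c" unfolding lft_def using finite_children[of k "\<lambda>c. c < k"] assms by auto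
  then show ?thesis using lft_eq[of k] assms by (auto simp: child_def)
qed

lemma ex_cover_child:
  assumes "k \<in> L" "covers k m" "m \<noteq> rgt k"
  obtains c where "child c k" "covers c m"
proof -
  have "\<not> own k m" using private_unique[OF assms(1)] assms(3) by blast
  then show thesis using private_child[OF assms(1)] assms(2) that by blast
qed

lemma ex_cover_root:
  assumes "1 \<le> m" "m < N"
  obtains r where "root r" "covers r m"
proof -
  have "m \<in> rgt ` L" unfolding rgt_onto using assms by simp
  then obtain k where k: "k \<in> L" "m = rgt k" by blast
  then have cov: "covers k m" using private_rgt by (simp add: own_def)
  obtain r where "root r" "r = k \<or> ins k r" by (rule ex_root[OF k(1)])
  then show thesis using that ins_covers cov by blast
qed

text \<open>If the root stopped before \<open>N\<close>, the next root would start at its end and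
  have a larger label. With \<open>greatest_lower_child\<close> this turns the recursive choice of
  projective vertices into the condition of ending at \<open>N\<close>.\<close>

lemma greatest_root:
  assumes r: "root r" and mx: "\<And>x. root x \<Longrightarrow> x \<le> r"
  shows "hi r = N"
proof (rule ccontr)
  have rL: "r \<in> L" using r by (simp add: root_def)
  assume "hi r \<noteq> N"
  then have "hi r < N" "1 \<le> hi r" using chord[OF rL] by auto
  then obtain s where s: "root s" "covers s (hi r)" using ex_cover_root by blast
  have "s \<noteq> r" using s(2) by (auto simp: covers_def)
  from root_disjoint[OF s(1) r this] s chord[OF rL] have "hi r = lo s" by (auto simp: covers_def)
  then have "r < s" using label_order(1)[of r s] s rL \<open>s \<noteq> r\<close> by (auto simp: root_def)
  then show False using mx[OF s(1)] by simp
qed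

text \<open>The children with label below \<open>k\<close> fill the interval from
  \<open>lft k\<close> to \<open>hi k\<close> end to end, with labels increasing to the
  right.\<close>

lemma greatest_lower_child:
  assumes c: "child c k" "c < k" and mx: "\<And>x. child x k \<Longrightarrow> x < k \<Longrightarrow> x \<le> c"
  shows "hi c = hi k"
proof (rule ccontr)
  have L: "c \<in> L" "k \<in> L" "ins c k" using c by (auto simp: child_def)
  assume "hi c \<noteq> hi k"
  then have cov: "covers k (hi c)" using L chord[OF L(1)] by (auto simp: covers_def ins_def)
  have "rgt k < hi c" using child_lt[OF c] chord[OF L(1)] by simp
  then obtain d where d: "child d k" "covers d (hi c)" using ex_cover_child[OF L(2) cov] by auto
  have "d \<noteq> c" using d(2) by (auto simp: covers_def)
  from child_disjoint[OF d(1) c(1) this] d chord[OF L(1)] have e: "hi c = lo d"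
    by (auto simp: covers_def)
  then have "c < d" using label_order(1)[of c d] d L \<open>d \<noteq> c\<close> by (auto simp: child_def)
  have "d \<noteq> k" using d(1) by (auto simp: child_def)
  have "\<not> k < d" using child_gt[OF d(1)] d(2) \<open>rgt k < hi c\<close> by (auto simp: covers_def)
  then show False using mx[OF d(1)] \<open>c < d\<close> \<open>d \<noteq> k\<close> by simp
qed

text \<open>The mirror image, on the interval from \<open>lo k\<close> to \<open>rgt k\<close>. It
  will be applied after rotation to recognize the injective vertices.\<close>

lemma least_upper_child:
  assumes c: "child c k" "k < c" and mn: "\<And>x. child x k \<Longrightarrow> k < x \<Longrightarrow> c \<le> x"
  shows "lo c = lo k"
proof (rule ccontr)
  have L: "c \<in> L" "k \<in> L" "ins c k" using c by (auto simp: child_def)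
  assume "lo c \<noteq> lo k"
  then have cov: "covers k (lo c - 1)" and p: "lo c \<ge> 1"
    using L chord[OF L(1)] by (auto simp: covers_def ins_def)
  have "lo c \<le> rgt k" using child_gt[OF c] chord[OF L(1)] by simp
  then have "lo c - 1 \<noteq> rgt k" using p by simp
  then obtain d where d: "child d k" "covers d (lo c - 1)" using ex_cover_child[OF L(2) cov] by blast
  have "d \<noteq> c" using d(2) p by (auto simp: covers_def)
  from child_disjoint[OF d(1) c(1) this] d chord[OF L(1)] have e: "hi d = lo c"
    by (auto simp: covers_def)
  then have "d < c" using label_order(1)[of d c] d L \<open>d \<noteq> c\<close> by (auto simp: child_def)
  have "d \<noteq> k" using d(1) by (auto simp: child_def)
  have "\<not> d < k" using child_lt[OF d(1)] d(2) \<open>lo c \<le> rgt k\<close> by (auto simp: covers_def)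
  then show False using mn[OF d(1)] \<open>d < c\<close> \<open>d \<noteq> k\<close> by simp
qed

end

section \<open>Sequences of chords and uniqueness of a missing entry\<close>

definition chord_of :: "nat \<Rightarrow> nat \<times> nat \<Rightarrow> bool" where
  "chord_of N s \<longleftrightarrow> 1 \<le> fst s \<and> fst s < snd s \<and> snd s \<le> N"

definition exc_seq :: "nat \<Rightarrow> (nat \<Rightarrow> nat \<times> nat) \<Rightarrow> bool" where
  "exc_seq n t \<longleftrightarrow> (\<forall>i\<in>{1..n}. chord_of (Suc n) (t i)) \<and>
     (\<forall>i\<in>{1..n}. \<forall>k\<in>{1..n}. i < k \<longrightarrow> exc (t i) (t k))"

lemma exc_seq_family: "exc_seq n t \<longleftrightarrow> complete_family {1..n} (Suc n) t"
  by (auto simp: exc_seq_def chord_of_def complete_family_def chord_family_def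
      complete_family_axioms_def)

text \<open>Distinct chords that do not cross are disjoint, nested or share an endpoint, and in each
  of these positions at least one order is exceptional.\<close>

lemma exc_trichotomy:
  assumes "fst x < snd x" "fst y < snd y" "x \<noteq> y" "\<not> exc x y" "\<not> exc y x"
  shows "fst x < fst y \<and> fst y < snd x \<and> snd x < snd y \<or>
    fst y < fst x \<and> fst x < snd y \<and> snd y < snd x"
  using assms unfolding exc_def prod_eq_iff by linarith

text \<open>If \<open>x\<close> and \<open>y\<close> cross, the side \<open>z\<close> of their quadrilateral can be inserted into any sequence that
  both complete.\<close>

lemma exc_crossing:
  assumes "fst x < fst y" "fst y < snd x" "snd x < snd y" and z: "z = (fst y, snd x)"
  shows "exc z x"
    and "fst s < snd s \<Longrightarrow> exc s x \<Longrightarrow> exc s y \<Longrightarrow> exc s z"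
    and "fst s < snd s \<Longrightarrow> exc x s \<Longrightarrow> exc y s \<Longrightarrow> exc z s"
  using assms(1-3) unfolding exc_def z fst_conv snd_conv by linarith+

text \<open>Doubling the labels makes room for one more chord directly before the one with label \<open>j\<close>.\<close>

lemma no_insertion:
  assumes "exc_seq n t" "j \<in> {1..n}" "chord_of (Suc n) z" "exc z (t j)"
    and "\<And>i. i \<in> {1..n} \<Longrightarrow> i < j \<Longrightarrow> exc (t i) z"
    and "\<And>i. i \<in> {1..n} \<Longrightarrow> j < i \<Longrightarrow> exc z (t i)"
  shows False
proof -
  let ?L = "insert (2 * j - 1) ((*) 2 ` {1..n})"
  let ?t = "\<lambda>i. if even i then t (i div 2) else z"
  have j: "1 \<le> j" using assms(2) by simp
  have *: "exc (?t i) (?t k)" if ik: "i \<in> ?L" "k \<in> ?L" "i < k" for i k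
  proof -
    consider (a) a where "i = 2 * a" "a \<in> {1..n}" | (z) "i = 2 * j - 1" using ik(1) by blast
    then show ?thesis
    proof cases
      case a
      consider (b) b where "k = 2 * b" "b \<in> {1..n}" | (z) "k = 2 * j - 1" using ik(2) by blast
      then show ?thesis
      proof cases
        case b then show ?thesis using a assms(1) ik(3) by (auto simp: exc_seq_def)
      next
        case z
        then have "a < j" "odd k" using a ik(3) j by auto
        then show ?thesis using a assms(5) by auto
      qed
    next
      case z
      then have o: "odd i" using j by simp
      obtain b where b: "k = 2 * b" "b \<in> {1..n}" using ik z by auto
      then have "j \<le> b" using z ik(3) by linarith
      then show ?thesis using assms(4) assms(6)[of b] b o by (cases "b = j") auto
    qed
  qed
  have "chord_of (Suc n) (?t i)" if "i \<in> ?L" for i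
    using that assms(1,3) j by (auto simp: exc_seq_def)
  then interpret chord_family ?L "Suc n" ?t
    by unfold_locales (use * in \<open>auto simp: chord_of_def\<close>)
  have "2 * j - 1 \<notin> (*) 2 ` {1..n}" using j by auto presburger
  \<comment> \<open>The odd label is new, so there are \<open>n + 1\<close> chords, one more than a
    noncrossing tree on \<open>n + 1\<close> vertices has.\<close>
  then have "card ?L = Suc n" by (simp add: card_image inj_on_def)
  then show False using card_le by simp
qed

lemma exc_seq_upd:
  assumes "exc_seq n (t(j := x))" "j \<in> {1..n}"
  shows "chord_of (Suc n) x" "i \<in> {1..n} \<Longrightarrow> i < j \<Longrightarrow> exc (t i) x"
    "i \<in> {1..n} \<Longrightarrow> j < i \<Longrightarrow> exc x (t i)"
    "i \<in> {1..n} \<Longrightarrow> i \<noteq> j \<Longrightarrow> chord_of (Suc n) (t i)"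
  using assms unfolding exc_seq_def by (metis fun_upd_apply order_less_irrefl)+

text \<open>Otherwise \<open>y\<close> could be inserted directly before \<open>x\<close>.\<close>

lemma completion_not_exc:
  assumes x: "exc_seq n (t(j := x))" and y: "exc_seq n (t(j := y))" and j: "j \<in> {1..n}"
  shows "\<not> exc y x"
proof
  assume "exc y x"
  with no_insertion[OF x j, of y] show False
    using exc_seq_upd[OF y j] by simp
qed

lemma completion_not_crossing:
  assumes x: "exc_seq n (t(j := x))" and y: "exc_seq n (t(j := y))" and j: "j \<in> {1..n}"
  shows "\<not> (fst x < fst y \<and> fst y < snd x \<and> snd x < snd y)"
proof
  assume c: "fst x < fst y \<and> fst y < snd x \<and> snd x < snd y"
  \<comment> \<open>As an interval \<open>z\<close> is the overlap of \<open>x\<close> and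
    \<open>y\<close>, the image of the nonzero map from \<open>iv y\<close> to
    \<open>iv x\<close>.\<close>
  define z where "z = (fst y, snd x)"
  note X = exc_seq_upd[OF x j] and Y = exc_seq_upd[OF y j]
  have ch: "fst (t i) < snd (t i)" if "i \<in> {1..n}" "i \<noteq> j" for i
    using X(4)[OF that] by (simp add: chord_of_def)
  note C = exc_crossing[OF _ _ _ z_def]
  have "chord_of (Suc n) z" using X(1) Y(1) c by (auto simp: z_def chord_of_def)
  with no_insertion[OF x j, of z] show False
    using C X Y c ch by simp
qed

lemma completion_unique:
  assumes "exc_seq n (t(j := x))" "exc_seq n (t(j := y))" "j \<in> {1..n}"
  shows "x = y"
  using exc_trichotomy[of x y] completion_not_exc completion_not_crossing assms exc_seq_upd(1)
  unfolding chord_of_def by metis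

text \<open>Left mutation of \<open>t\<close> through \<open>s\<close>: the third side of the triangle when \<open>s\<close> and \<open>t\<close> share an
  endpoint.\<close>

definition mut :: "nat \<times> nat \<Rightarrow> nat \<times> nat \<Rightarrow> nat \<times> nat" where
  "mut s t = (if snd s = fst t then (fst s, snd t)
     else if fst s = fst t then (snd t, snd s)
     else if snd s = snd t then (fst t, fst s) else t)"

text \<open>Under \<open>exc s t\<close> the three triangles are, in the order of the definition,
  the extension of \<open>iv s\<close> by \<open>iv t\<close>, the kernel of a surjection from
  \<open>iv s\<close> to \<open>iv t\<close>, and the cokernel of an inclusion of
  \<open>iv s\<close> in \<open>iv t\<close>.\<close>

lemma mut_props:
  assumes "chord_of N s" "chord_of N t" "exc s t"
  shows "chord_of N (mut s t)" "exc (mut s t) s"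
    and "chord_of N u \<Longrightarrow> exc u s \<Longrightarrow> exc u t \<Longrightarrow> exc u (mut s t)"
    and "chord_of N u \<Longrightarrow> exc s u \<Longrightarrow> exc t u \<Longrightarrow> exc (mut s t) u"
proof -
  have 1: "fst s < snd s" "fst t < snd t" using assms by (auto simp: chord_of_def)
  show "chord_of N (mut s t)"
    using assms unfolding mut_def exc_def chord_of_def by auto
  show "exc (mut s t) s"
    using assms(3) 1 unfolding mut_def exc_def by auto
  show "exc u (mut s t)" if "chord_of N u" "exc u s" "exc u t"
  proof -
    have "fst u < snd u" using that(1) by (auto simp: chord_of_def)
    then show ?thesis using that(2,3) assms(3) 1
      unfolding mut_def exc_def by (simp split: if_splits) linarith
  qed
  show "exc (mut s t) u" if "chord_of N u" "exc s u" "exc t u"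
  proof -
    have "fst u < snd u" using that(1) by (auto simp: chord_of_def)
    then show ?thesis using that(2,3) assms(3) 1
      unfolding mut_def exc_def by (simp split: if_splits) linarith
  qed
qed

text \<open>This provides the existence of a module for \<open>SOME\<close> to choose in
  \<open>braid\<close>.\<close>

lemma exc_seq_mut:
  assumes "exc_seq n t" "i \<in> {1..<n}"
  shows "exc_seq n (t(i := mut (t i) (t (Suc i)), Suc i := t i))"
proof -
  let ?s = "t i" and ?r = "t (Suc i)"
  have c: "chord_of (Suc n) (t k)" if "k \<in> {1..n}" for k using assms that by (auto simp: exc_seq_def)
  have e: "exc (t k) (t l)" if "k \<in> {1..n}" "l \<in> {1..n}" "k < l" for k l
    using assms that by (auto simp: exc_seq_def)
  have i: "i \<in> {1..n}" "Suc i \<in> {1..n}" using assms by auto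
  note M = mut_props[OF c[OF i(1)] c[OF i(2)] e[OF i]]
  have "chord_of (Suc n) ((t(i := mut ?s ?r, Suc i := ?s)) k)" if "k \<in> {1..n}" for k
    using c that M(1) i by auto
  moreover have "exc ((t(i := mut ?s ?r, Suc i := ?s)) k) ((t(i := mut ?s ?r, Suc i := ?s)) l)"
    if kl: "k \<in> {1..n}" "l \<in> {1..n}" "k < l" for k l
  proof -
    consider "k = i" "l = Suc i" | "k = i" "l > Suc i" | "k = Suc i" "l > Suc i" | "l = i" "k < i"
      | "l = Suc i" "k < i" | "k \<noteq> i" "k \<noteq> Suc i" "l \<noteq> i" "l \<noteq> Suc i"
      using kl(3) by linarith
    then show ?thesis
      by cases (use kl i e c M in auto)
  qed
  ultimately show ?thesis by (auto simp: exc_seq_def)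
qed

text \<open>On modules the rotation of the polygon is \<open>\<tau>\<^sup>*\<close>.\<close>

definition rot :: "nat \<Rightarrow> nat \<times> nat \<Rightarrow> nat \<times> nat" where
  "rot N s = (if snd s = N then (1, Suc (fst s)) else (Suc (fst s), Suc (snd s)))"

lemma rot_chord: "chord_of N s \<Longrightarrow> chord_of N (rot N s)"
  by (auto simp: chord_of_def rot_def)

text \<open>The combinatorial form of Auslander--Reiten duality.\<close>

lemma exc_rot:
  assumes "chord_of N s" "chord_of N t"
  shows "exc (rot N t) s \<longleftrightarrow> exc s t"
  using assms unfolding exc_def rot_def chord_of_def by auto

definition rotate_seq :: "nat \<Rightarrow> (nat \<Rightarrow> nat \<times> nat) \<Rightarrow> nat \<Rightarrow> nat \<times> nat" where
  "rotate_seq n t i = (if i = 1 then rot (Suc n) (t n) else t (i - 1))"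

text \<open>Moving \<open>t n\<close> to the front reverses its order relative to all other entries,
  and \<open>exc_rot\<close> says that \<open>rot\<close> compensates exactly for this
  reversal.\<close>

lemma rotate_seq:
  assumes "exc_seq n t"
  shows "exc_seq n (rotate_seq n t)"
proof -
  have c: "chord_of (Suc n) (t k)" if "k \<in> {1..n}" for k using assms that by (auto simp: exc_seq_def)
  have e: "exc (t k) (t l)" if "k \<in> {1..n}" "l \<in> {1..n}" "k < l" for k l
    using assms that by (auto simp: exc_seq_def)
  have "chord_of (Suc n) (rotate_seq n t k)" if "k \<in> {1..n}" for k
  proof (cases "k = 1")
    case True
    then show ?thesis using c[of n] that rot_chord by (simp add: rotate_seq_def)
  next
    case False
    then have "k - 1 \<in> {1..n}" using that by auto
    then show ?thesis using c False by (simp add: rotate_seq_def)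
  qed
  moreover have "exc (rotate_seq n t k) (rotate_seq n t l)"
    if kl: "k \<in> {1..n}" "l \<in> {1..n}" "k < l" for k l
  proof (cases "k = 1")
    case True
    then have "l - 1 \<in> {1..n}" "n \<in> {1..n}" "l - 1 < n" using kl by auto
    then show ?thesis using kl True e c exc_rot[of "Suc n" "t (l - 1)" "t n"]
      by (simp add: rotate_seq_def)
  next
    case False
    then have "k - 1 \<in> {1..n}" "l - 1 \<in> {1..n}" "k - 1 < l - 1" using kl by auto
    then show ?thesis using kl e False by (simp add: rotate_seq_def)
  qed
  ultimately show ?thesis by (auto simp: exc_seq_def)
qed

text \<open>The first \<open>k\<close> positions hold the entries that have already passed the
  front, each rotated once; for \<open>k = n\<close> every entry is back at its own
  position.\<close>

lemma rotate_seq_pow: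
  assumes "k \<le> n" "i \<in> {1..n}"
  shows "(rotate_seq n ^^ k) t i = (if i \<le> k then rot (Suc n) (t (n + i - k)) else t (i - k))"
  using assms
proof (induction k arbitrary: i)
  case (Suc k)
  show ?case
  proof (cases "i = 1")
    case True
    then show ?thesis using Suc by (auto simp: rotate_seq_def)
  next
    case False
    then have "i - 1 \<in> {1..n}" "i \<noteq> 0" using Suc.prems by auto
    then show ?thesis using Suc.IH[of "i - 1"] Suc.prems False
      by (auto simp: rotate_seq_def intro!: arg_cong[where f = "\<lambda>x. rot (Suc n) (t x)"] arg_cong[where f = t])
  qed
qed auto

section \<open>Rerooting the forest\<close>

declare One_nat_def [simp del]

definition chord_forest :: "nat \<Rightarrow> (nat \<Rightarrow> nat \<times> nat) \<Rightarrow> forest" where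
  "chord_forest n t = {(i, k). chord_family.child {1..n} t i k}"

locale rotated_pair =
  A: complete_family "{1..n}" "Suc n" t + B: complete_family "{1..n}" "Suc n" "\<lambda>i. rot (Suc n) (t i)"
  for n t +
  fixes p :: nat and j :: "nat \<Rightarrow> nat"
  assumes n: "n \<ge> 1"
    and proj: "projective_vertices n (chord_forest n t) p j"
begin

abbreviation "F \<equiv> chord_forest n t"
abbreviation "F' \<equiv> chord_forest n (\<lambda>i. rot (Suc n) (t i))"

section \<open>The projective vertices are the chords ending at \<open>n + 1\<close>\<close>

definition pv :: "nat \<Rightarrow> bool" where
  "pv i \<longleftrightarrow> i \<in> {1..n} \<and> A.hi i = Suc n"

lemma roots_F: "forest_roots n F = {v. A.root v}"
proof -
  have "A.root v \<longleftrightarrow> v \<in> {1..n} \<and> (\<forall>w. \<not> A.child v w)" for v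
    using A.ex_parent[of v] A.parent_not_root unfolding A.root_def by blast
  then show ?thesis unfolding forest_roots_def chord_forest_def by simp
qed

lemma roots_F': "forest_roots n F' = {v. B.root v}"
proof -
  have "B.root v \<longleftrightarrow> v \<in> {1..n} \<and> (\<forall>w. \<not> B.child v w)" for v
    using B.ex_parent[of v] B.parent_not_root unfolding B.root_def by blast
  then show ?thesis unfolding forest_roots_def chord_forest_def by simp
qed

lemma children_F: "children F v = {c. A.child c v}"
  by (simp add: children_def chord_forest_def)

lemma children_F': "children F' v = {c. B.child c v}"
  by (simp add: children_def chord_forest_def)

lemma p1: "p \<ge> 1"
  using proj by (simp add: projective_vertices_def)

lemma j_root: "A.root (j p)" "\<And>x. A.root x \<Longrightarrow> x \<le> j p"
  using proj unfolding projective_vertices_def greatest_in_def roots_F by auto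

lemma j_child:
  assumes "1 \<le> i" "i < p"
  shows "A.child (j i) (j (Suc i))" "j i < j (Suc i)"
    "\<And>x. A.child x (j (Suc i)) \<Longrightarrow> x < j (Suc i) \<Longrightarrow> x \<le> j i"
  using proj assms unfolding projective_vertices_def greatest_in_def children_F by auto

lemma j_last: "A.child c (j 1) \<Longrightarrow> j 1 < c"
proof -
  assume c: "A.child c (j 1)"
  then have "\<not> c < j 1" using proj unfolding projective_vertices_def children_F by blast
  moreover have "c \<noteq> j 1" using c by (auto simp: A.child_def)
  ultimately show ?thesis by simp
qed

lemma pv_j: "1 \<le> i \<Longrightarrow> i \<le> p \<Longrightarrow> pv (j i)"
proof (induction "p - i" arbitrary: i)
  case 0
  then have "i = p" by simp
  then show ?case using A.greatest_root[OF j_root] j_root(1) by (simp add: pv_def A.root_def)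
next
  case (Suc d)
  then have i: "1 \<le> i" "i < p" by auto
  have "pv (j (Suc i))" using Suc i by auto
  then show ?case using A.greatest_lower_child[OF j_child[OF i]] j_child(1)[OF i]
    by (simp add: pv_def A.child_def)
qed

lemma j_mem: "1 \<le> i \<Longrightarrow> i \<le> p \<Longrightarrow> j i \<in> {1..n}"
  using pv_j by (simp add: pv_def)

lemma pv_not_disjoint: "pv i \<Longrightarrow> pv k \<Longrightarrow> \<not> A.hi i \<le> A.lo k"
  using A.chord[of k] by (auto simp: pv_def)

text \<open>Chords ending at \<open>n + 1\<close> are nested in one another. Descending from the
  root, \<open>k\<close> stays inside every \<open>j i\<close> unless it equals some projective
  vertex. Inside \<open>j 1\<close> it would produce a child of \<open>j 1\<close> with smaller
  label, which the end of the process excludes.\<close>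

lemma pv_obtain:
  assumes "pv k"
  obtains i where "1 \<le> i" "i \<le> p" "k = j i"
proof -
  have k: "k \<in> {1..n}" using assms by (simp add: pv_def)
  have up: "pv c" if "c \<in> {1..n}" "c = k \<or> A.ins k c" for c
    using that assms A.chord[of c] by (auto simp: pv_def A.ins_def)
  have "(\<exists>i'. 1 \<le> i' \<and> i' \<le> p \<and> k = j i') \<or> A.ins k (j i)" if "1 \<le> i" "i \<le> p" for i
    using that
  proof (induction "p - i" arbitrary: i)
    case 0
    then have ip: "i = p" by simp
    obtain r where r: "A.root r" "r = k \<or> A.ins k r" using A.ex_root[OF k] by blast
    then have "pv r" using up by (simp add: A.root_def)
    then have "r = j p" using A.root_disjoint[OF r(1) j_root(1)] pv_not_disjoint pv_j p1 by blast
    then show ?case using r ip p1 by blast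
  next
    case (Suc d)
    then have i: "1 \<le> i" "i < p" by auto
    then have "(\<exists>i'. 1 \<le> i' \<and> i' \<le> p \<and> k = j i') \<or> A.ins k (j (Suc i))" using Suc by auto
    then show ?case
    proof
      assume "A.ins k (j (Suc i))"
      then obtain c where c: "A.child c (j (Suc i))" "c = k \<or> A.ins k c"
        using A.ex_child[OF k j_mem] i by (metis Suc_leI le_SucI)
      then have "pv c" using up by (simp add: A.child_def)
      then have "c = j i"
        using A.child_disjoint[OF c(1) j_child(1)[OF i]] pv_not_disjoint pv_j i by (meson less_imp_le)
      then show ?thesis using c i by auto
    qed auto
  qed
  from this[of 1] p1 have "(\<exists>i'. 1 \<le> i' \<and> i' \<le> p \<and> k = j i') \<or> A.ins k (j 1)" by simp
  then show thesis
  proof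
    assume "A.ins k (j 1)"
    then obtain c where c: "A.child c (j 1)" "c = k \<or> A.ins k c"
      using A.ex_child[OF k j_mem] p1 by blast
    then have "pv c" using up by (simp add: A.child_def)
    then have "A.hi c = A.hi (j 1)" using pv_j[of 1] p1 by (simp add: pv_def)
    moreover have "c \<in> {1..n}" "j 1 \<in> {1..n}" "c \<noteq> j 1" "A.ins c (j 1)"
      using c(1) by (auto simp: A.child_def)
    ultimately have "c < j 1" by (intro A.label_order(3))
    then show ?thesis using j_last[OF c(1)] by simp
  qed (use that in blast)
qed

lemma j_less: "1 \<le> i \<Longrightarrow> i < k \<Longrightarrow> k \<le> p \<Longrightarrow> j i < j k \<and> A.ins (j i) (j k)"
proof (induction k)
  case (Suc k)
  show ?case
  proof (cases "i = k")
    case True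
    then show ?thesis using j_child(1,2)[of i] Suc.prems by (auto simp: A.child_def)
  next
    case False
    then have "j i < j k \<and> A.ins (j i) (j k)" using Suc by auto
    then show ?thesis using j_child(1,2)[of k] Suc.prems A.ins_trans
      by (auto simp: A.child_def)
  qed
qed auto

lemma ins_asym: "A.ins i k \<Longrightarrow> \<not> A.ins k i"
  using A.ins_trans A.ins_irrefl by blast

lemma ins_j: "1 \<le> i \<Longrightarrow> i \<le> p \<Longrightarrow> 1 \<le> k \<Longrightarrow> k \<le> p \<Longrightarrow> A.ins (j i) (j k) \<longleftrightarrow> i < k"
  using j_less[of i k] j_less[of k i] ins_asym by (metis A.ins_irrefl linorder_neqE_nat)

section \<open>Nesting and parents after rotation\<close>

lemma rot_pv: "pv i \<Longrightarrow> rot (Suc n) (t i) = (1, Suc (A.lo i))"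
  by (simp add: pv_def rot_def)

lemma rot_npv: "i \<in> {1..n} \<Longrightarrow> \<not> pv i \<Longrightarrow> rot (Suc n) (t i) = (Suc (A.lo i), Suc (A.hi i))"
  by (simp add: pv_def rot_def)

text \<open>The chords ending at \<open>n + 1\<close> all start at 1 after rotation. This reverses
  their nesting and lets each contain the chords formerly to its left; every other rotated chord
  starts at 2 or later.\<close>

lemma B_ins:
  assumes "i \<in> {1..n}" "k \<in> {1..n}"
  shows "\<not> pv i \<Longrightarrow> \<not> pv k \<Longrightarrow> B.ins i k \<longleftrightarrow> A.ins i k"
    and "pv i \<Longrightarrow> \<not> pv k \<Longrightarrow> \<not> B.ins i k"
    and "pv i \<Longrightarrow> pv k \<Longrightarrow> B.ins i k \<longleftrightarrow> A.ins k i"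
    and "\<not> pv i \<Longrightarrow> pv k \<Longrightarrow> B.ins i k \<longleftrightarrow> A.hi i \<le> A.lo k"
proof -
  show "B.ins i k \<longleftrightarrow> A.ins i k" if "\<not> pv i" "\<not> pv k"
    using that assms by (simp add: A.ins_def B.ins_def rot_npv prod_eq_iff)
  show "\<not> B.ins i k" if "pv i" "\<not> pv k"
    using that assms A.chord[of k] by (simp add: B.ins_def rot_npv rot_pv)
  show "B.ins i k \<longleftrightarrow> A.ins k i" if "pv i" "pv k"
    using that assms by (auto simp: A.ins_def B.ins_def rot_pv prod_eq_iff pv_def)
  show "B.ins i k \<longleftrightarrow> A.hi i \<le> A.lo k" if "\<not> pv i" "pv k"
    using that assms A.chord[of i] by (auto simp: B.ins_def rot_pv rot_npv)
qed

lemma ins_pv: "A.ins i k \<Longrightarrow> k \<in> {1..n} \<Longrightarrow> pv i \<Longrightarrow> pv k"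
  using A.chord[of k] by (auto simp: pv_def A.ins_def)

text \<open>Two chords above \<open>i\<close> are nested, and a chord ending at \<open>n + 1\<close>
  cannot lie inside one that ends earlier.\<close>

lemma between_inside:
  assumes "l \<in> {1..n}" "\<not> pv l" "A.ins i l" "A.ins i k" "pv k" "i \<in> {1..n}"
  shows "A.ins l k"
proof -
  have "k \<in> {1..n}" "l \<noteq> k" using assms by (auto simp: pv_def)
  moreover have "A.covers i (A.lo i)" using A.chord[OF assms(6)] by (simp add: A.covers_def)
  ultimately have "A.ins l k \<or> A.ins k l" using A.covers_laminar[OF assms(1)] A.ins_covers assms by blast
  then show ?thesis using ins_pv assms by blast
qed

lemma B_child_same:
  assumes "A.child i k" "\<not> pv i" "\<not> pv k"
  shows "B.child i k"
  using assms B_ins unfolding A.child_def B.child_def by metis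

lemma lo_mono: "1 \<le> s \<Longrightarrow> s \<le> m \<Longrightarrow> m \<le> p \<Longrightarrow> A.lo (j m) \<le> A.lo (j s)"
  using j_less[of s m] by (cases "s = m") (auto simp: A.ins_def)

text \<open>The vertex \<open>i\<close> lies to the left of its sibling \<open>j s\<close>, hence
  below it after rotation, while the rotated chords \<open>j m\<close> with \<open>m > s\<close> end
  too early to contain \<open>i\<close>.\<close>

lemma B_child_down:
  assumes c: "A.child i (j (Suc s))" "\<not> pv i" and s: "1 \<le> s" "s < p"
  shows "B.child i (j s)"
proof -
  have L: "i \<in> {1..n}" "j s \<in> {1..n}" "pv (j s)" "pv (j (Suc s))" "A.ins i (j (Suc s))"
    using c s j_mem pv_j by (auto simp: A.child_def)
  have "i \<noteq> j s" using L c by auto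
  then have "A.hi i \<le> A.lo (j s)"
    using A.child_disjoint[OF c(1) j_child(1)[OF s]] L A.chord[of i] by (auto simp: pv_def)
  then have ii: "B.ins i (j s)" using B_ins(4)[of i "j s"] L c by simp
  moreover have "\<not> (B.ins i l \<and> B.ins l (j s))" if l: "l \<in> {1..n}" for l
  proof
    assume a: "B.ins i l \<and> B.ins l (j s)"
    show False
    proof (cases "pv l")
      case True
      then obtain m where m: "1 \<le> m" "m \<le> p" "l = j m" by (rule pv_obtain)
      then have "s < m" using a B_ins(3)[OF l L(2) True L(3)] ins_j[of s m] s by simp
      then have "A.lo (j m) \<le> A.lo (j (Suc s))" using lo_mono[of "Suc s" m] m by simp
      moreover have "A.hi i \<le> A.lo (j m)" using a B_ins(4)[OF L(1) l c(2) True] m by simp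
      ultimately show False using L A.chord[of i] by (simp add: A.ins_def)
    next
      case False
      then have "A.ins i l" using a B_ins(1) l L c by simp
      then show False using between_inside[OF l False _ L(5,4,1)] c l by (auto simp: A.child_def)
    qed
  qed
  ultimately show ?thesis using L unfolding B.child_def by blast
qed

lemma B_root_down:
  assumes c: "A.child i (j 1)" "\<not> pv i"
  shows "B.root i"
proof -
  have L: "i \<in> {1..n}" "pv (j 1)" "A.ins i (j 1)"
    using c j_mem pv_j p1 by (auto simp: A.child_def)
  have "\<not> B.ins i l" if l: "l \<in> {1..n}" for l
  proof
    assume a: "B.ins i l"
    show False
    proof (cases "pv l")
      case True
      then obtain m where m: "1 \<le> m" "m \<le> p" "l = j m" by (rule pv_obtain)
      then have "A.lo (j m) \<le> A.lo (j 1)" using lo_mono[of 1 m] by simp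
      moreover have "A.hi i \<le> A.lo (j m)" using a B_ins(4)[OF L(1) l c(2) True] m by simp
      ultimately show False using L A.chord[of i] by (simp add: A.ins_def)
    next
      case False
      then have "A.ins i l" using a B_ins(1) l L c by simp
      then show False using between_inside[OF l False _ L(3,2,1)] c l by (auto simp: A.child_def)
    qed
  qed
  then show ?thesis using L unfolding B.root_def by blast
qed

text \<open>The other roots lie to the left of \<open>j p\<close>, and after rotation
  \<open>j p\<close> is the shortest of the projective chords.\<close>

lemma B_child_root:
  assumes c: "A.root i" "\<not> pv i"
  shows "B.child i (j p)"
proof -
  have L: "i \<in> {1..n}" "j p \<in> {1..n}" "pv (j p)"
    using c j_mem pv_j p1 by (auto simp: A.root_def)
  have "i \<noteq> j p" using L c by auto
  then have "A.hi i \<le> A.lo (j p)"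
    using A.root_disjoint[OF c(1) j_root(1)] L A.chord[of i] by (auto simp: pv_def)
  then have ii: "B.ins i (j p)" using B_ins(4)[of i "j p"] L c by simp
  moreover have "\<not> (B.ins i l \<and> B.ins l (j p))" if l: "l \<in> {1..n}" for l
    using B_ins(1)[OF L(1) l c(2)] B_ins(3)[OF l L(2) _ L(3)] c j_root(1) l
    unfolding A.root_def by blast
  ultimately show ?thesis using L unfolding B.child_def by blast
qed

lemma B_root_j1: "B.root (j 1)"
proof -
  have L: "j 1 \<in> {1..n}" "pv (j 1)" using j_mem pv_j p1 by auto
  have "\<not> B.ins (j 1) l" if l: "l \<in> {1..n}" for l
  proof
    assume a: "B.ins (j 1) l"
    then have pl: "pv l" using B_ins(2)[OF L(1) l L(2)] by blast
    then obtain m where m: "1 \<le> m" "m \<le> p" "l = j m" by (rule pv_obtain)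
    then show False using a B_ins(3)[OF L(1) l L(2) pl] ins_j[of m 1] p1 by simp
  qed
  then show ?thesis using L unfolding B.root_def by blast
qed

lemma B_child_j:
  assumes s: "1 \<le> s" "s < p"
  shows "B.child (j (Suc s)) (j s)"
proof -
  have L: "j s \<in> {1..n}" "j (Suc s) \<in> {1..n}" "pv (j s)" "pv (j (Suc s))"
    using s j_mem pv_j by auto
  have "B.ins (j (Suc s)) (j s)" using B_ins(3)[OF L(2,1,4,3)] ins_j[of s "Suc s"] s by simp
  moreover have "\<not> (B.ins (j (Suc s)) l \<and> B.ins l (j s))" if l: "l \<in> {1..n}" for l
  proof
    assume a: "B.ins (j (Suc s)) l \<and> B.ins l (j s)"
    then have pl: "pv l" using B_ins(2)[OF L(2) l L(4)] by blast
    then have "A.ins l (j (Suc s))" "A.ins (j s) l"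
      using a B_ins(3)[OF L(2) l L(4) pl] B_ins(3)[OF l L(1) pl L(3)] by auto
    then show False using j_child(1)[OF s] l unfolding A.child_def by blast
  qed
  ultimately show ?thesis using L unfolding B.child_def by blast
qed

text \<open>Sends the name of a region after rotation to its name before rotation. The
  \<open>SOME\<close> inverts \<open>j\<close>, which is injective on \<open>{1..p}\<close> by
  \<open>j_inj\<close>.\<close>

definition cyc :: "nat \<Rightarrow> nat" where
  "cyc x = (if x = 0 then j 1 else if x = j p then 0
     else if x \<in> j ` {1..<p} then j (Suc (SOME i. i \<in> {1..<p} \<and> j i = x)) else x)"

lemma j_inj: "1 \<le> i \<Longrightarrow> i \<le> p \<Longrightarrow> 1 \<le> k \<Longrightarrow> k \<le> p \<Longrightarrow> j i = j k \<Longrightarrow> i = k"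
  using j_less[of i k] j_less[of k i] by (metis less_irrefl linorder_neqE_nat)

lemma j_pos: "1 \<le> i \<Longrightarrow> i \<le> p \<Longrightarrow> j i \<noteq> 0"
  using j_mem by force

lemma cyc_0: "cyc 0 = j 1"
  by (simp add: cyc_def)

lemma cyc_p: "cyc (j p) = 0"
  using j_pos[of p] p1 by (simp add: cyc_def)

lemma cyc_j:
  assumes "1 \<le> i" "i < p" shows "cyc (j i) = j (Suc i)"
proof -
  have "j i \<noteq> j p" using j_less[of i p] assms by simp
  moreover have "(SOME i'. i' \<in> {1..<p} \<and> j i' = j i) = i"
    by (rule some_equality) (use assms j_inj in auto)
  ultimately show ?thesis using assms j_pos[of i] by (auto simp: cyc_def)
qed

lemma cyc_npv:
  assumes "k \<in> {1..n}" "\<not> pv k" shows "cyc k = k"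
proof -
  have "k \<noteq> j i" if "1 \<le> i" "i \<le> p" for i using pv_j[OF that] assms by auto
  then have "k \<noteq> j p" "k \<notin> j ` {1..<p}"
    using p1 by (simp, fastforce)
  then show ?thesis using assms by (auto simp: cyc_def)
qed

lemma cyc_bij: "bij_betw cyc {0..n} {0..n}"
proof -
  have "{0..n} \<subseteq> cyc ` {0..n}"
  proof
    fix y assume y: "y \<in> {0..n}"
    consider "y = 0" | "y \<in> {1..n}" "\<not> pv y" | "pv y" using y by force
    then show "y \<in> cyc ` {0..n}"
    proof cases
      case 1 then show ?thesis using cyc_p j_mem[of p] p1 by force
    next
      case 2 then show ?thesis using cyc_npv y by force
    next
      case 3
      then obtain i where i: "1 \<le> i" "i \<le> p" "y = j i" by (rule pv_obtain)
      show ?thesis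
      proof (cases "i = 1")
        case True then show ?thesis using i cyc_0 by force
      next
        case False
        then have "cyc (j (i - 1)) = y" "j (i - 1) \<in> {1..n}"
          using cyc_j[of "i - 1"] j_mem[of "i - 1"] i by auto
        then show ?thesis by force
      qed
    qed
  qed
  moreover from this have eq: "{0..n} = cyc ` {0..n}"
    by (intro card_seteq) (simp_all add: card_image_le del: card_atLeastAtMost)
  ultimately show ?thesis by (auto simp: bij_betw_def intro: eq_card_imp_inj_on)
qed

section \<open>Edges of the two trees, with 0 as parent of the roots\<close>

definition upA :: "nat \<Rightarrow> nat \<Rightarrow> bool" where
  "upA i k \<longleftrightarrow> A.root i \<and> k = 0 \<or> A.child i k"

definition upB :: "nat \<Rightarrow> nat \<Rightarrow> bool" where
  "upB i k \<longleftrightarrow> B.root i \<and> k = 0 \<or> B.child i k"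

lemma edges_A: "plus_edges n F = {{i, k} | i k. upA i k}"
  unfolding plus_edges_def roots_F upA_def by (auto simp: chord_forest_def insert_commute)

lemma edges_B: "plus_edges n F' = {{i, k} | i k. upB i k}"
  unfolding plus_edges_def roots_F' upB_def by (auto simp: chord_forest_def insert_commute)

lemma upA_unique: "upA i k \<Longrightarrow> upA i l \<Longrightarrow> k = l"
  using A.parent_unique A.parent_not_root unfolding upA_def by blast

lemma upB_unique: "upB i k \<Longrightarrow> upB i l \<Longrightarrow> k = l"
  using B.parent_unique B.parent_not_root unfolding upB_def by blast

lemma up_mem: "upA i k \<Longrightarrow> i \<in> {1..n} \<and> k \<in> {0..n}" "upB i k \<Longrightarrow> i \<in> {1..n} \<and> k \<in> {0..n}"
  unfolding upA_def A.root_def A.child_def upB_def B.root_def B.child_def by auto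

text \<open>Each label determines one edge of either tree, so both trees have the same edges up to
  \<open>cyc\<close>.\<close>

lemma edge_match:
  assumes i: "i \<in> {1..n}"
  obtains k l where "upB i k" "upA i l" "{cyc i, cyc k} = {i, l}"
proof (cases "pv i")
  case True
  then obtain s where s: "1 \<le> s" "s \<le> p" "i = j s" by (rule pv_obtain)
  obtain l where l: "upA i l" "cyc i = l"
    using s cyc_p cyc_j[of s] j_child(1)[of s] j_root(1) unfolding upA_def
    by (cases "s = p") auto
  obtain k where k: "upB i k" "cyc k = i"
  proof (cases "s = 1")
    case True
    then show ?thesis using that[of 0] s cyc_0 B_root_j1 by (simp add: upB_def)
  next
    case False
    then have "1 \<le> s - 1" "s - 1 < p" "Suc (s - 1) = s" using s by auto
    then show ?thesis using that[of "j (s - 1)"] s cyc_j[of "s - 1"] B_child_j[of "s - 1"]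
      by (simp add: upB_def)
  qed
  \<comment> \<open>Here \<open>cyc i = l\<close> and \<open>cyc k = i\<close>: along the path of
    projective vertices the roles of parent and child are exchanged.\<close>
  show thesis using that[OF k(1) l(1)] k l by auto
next
  case False
  then have ci: "cyc i = i" using i cyc_npv by simp
  consider (root) "A.root i" | (n) k where "A.child i k" "\<not> pv k" | (p) s where "A.child i (j s)" "1 \<le> s" "s \<le> p"
    using A.ex_parent[OF i] pv_obtain by metis
  then show thesis
  proof cases
    case root
    then show thesis using that[of "j p" 0] B_child_root[OF root False] ci cyc_p
      by (simp add: upA_def upB_def)
  next
    case (n k)
    then have "cyc k = k" using cyc_npv by (simp add: A.child_def)
    then show thesis using that[of k k] B_child_same[OF n(1) False n(2)] n ci
      by (simp add: upA_def upB_def)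
  next
    case (p s)
    \<comment> \<open>Below \<open>j 1\<close> the vertex becomes a root, below a later
      \<open>j s\<close> it becomes a child of \<open>j (s - 1)\<close>; in both cases
      \<open>cyc\<close> sends its new parent to \<open>j s\<close>.\<close>
    show thesis
    proof (cases "s = 1")
      case True
      then show thesis using that[of 0 "j 1"] p B_root_down False ci cyc_0
        by (simp add: upA_def upB_def)
    next
      case ne: False
      then have "1 \<le> s - 1" "s - 1 < p" "Suc (s - 1) = s" using p by auto
      then show thesis using that[of "j (s - 1)" "j s"] p B_child_down[of i "s - 1"] False ci cyc_j[of "s - 1"]
        by (simp add: upA_def upB_def)
    qed
  qed
qed

text \<open>An edge of either tree joins some label to its unique parent, so it is the edge that
  \<open>edge_match\<close> provides for this label.\<close>

lemma cyc_iso: "graph_iso {0..n} (plus_edges n F') {0..n} (plus_edges n F) cyc"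
  unfolding graph_iso_def
proof (intro conjI ballI)
  show "bij_betw cyc {0..n} {0..n}" by (rule cyc_bij)
  fix x y assume xy: "x \<in> {0..n}" "y \<in> {0..n}"
  show "{x, y} \<in> plus_edges n F' \<longleftrightarrow> {cyc x, cyc y} \<in> plus_edges n F"
  proof
    assume "{x, y} \<in> plus_edges n F'"
    then obtain i k0 where 0: "{x, y} = {i, k0}" "upB i k0" unfolding edges_B by blast
    obtain k l where kl: "upB i k" "upA i l" "{cyc i, cyc k} = {i, l}"
      using edge_match up_mem(2)[OF 0(2)] by blast
    have "{cyc x, cyc y} = cyc ` {x, y}" by simp
    also have "\<dots> = cyc ` {i, k0}" unfolding 0 by simp
    also have "\<dots> = {i, l}" using upB_unique[OF 0(2) kl(1)] kl(3) by simp
    finally show "{cyc x, cyc y} \<in> plus_edges n F" unfolding edges_A using kl(2) by blast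
  next
    assume "{cyc x, cyc y} \<in> plus_edges n F"
    then obtain i l0 where 0: "{cyc x, cyc y} = {i, l0}" "upA i l0" unfolding edges_A by blast
    obtain k l where kl: "upB i k" "upA i l" "{cyc i, cyc k} = {i, l}"
      using edge_match up_mem(1)[OF 0(2)] by blast
    have "cyc ` {x, y} = {i, l}" using 0(1) upA_unique[OF 0(2) kl(2)] by simp
    then have "cyc ` {x, y} = cyc ` {i, k}" using kl(3) by simp
    then have "{x, y} = {i, k}"
      using inj_on_image_eq_iff[OF bij_betw_imp_inj_on[OF cyc_bij], of "{x, y}" "{i, k}"]
        up_mem(2)[OF kl(1)] xy by auto
    then show "{x, y} \<in> plus_edges n F'" unfolding edges_B using kl(1) by blast
  qed
qed

text \<open>The new master root is the region under \<open>j 1\<close>, which is bounded by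
  \<open>j 1\<close> and the children it had before rotation.\<close>

lemma B_root_iff: "B.root i \<longleftrightarrow> i = j 1 \<or> A.child i (j 1)"
proof -
  have pvc: "\<not> pv i" if "A.child i (j 1)"
  proof
    assume "pv i"
    then obtain m where m: "1 \<le> m" "m \<le> p" "i = j m" by (rule pv_obtain)
    then show False using that ins_j[of m 1] p1 by (simp add: A.child_def)
  qed
  have "i = j 1 \<or> A.child i (j 1)" if r: "B.root i"
  proof -
    have i: "i \<in> {1..n}" and nc: "\<not> B.child i k" for k
      using r by (auto simp: B.root_def B.child_def)
    show ?thesis
    proof (cases "pv i")
      case True
      then obtain s where s: "1 \<le> s" "s \<le> p" "i = j s" by (rule pv_obtain)
      have "s = 1"
      proof (rule ccontr)
        assume "s \<noteq> 1"
        then have "1 \<le> s - 1" "s - 1 < p" using s by auto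
        then show False using B_child_j[of "s - 1"] nc s by auto
      qed
      then show ?thesis using s by simp
    next
      case False
      then have "\<not> A.root i" using B_child_root nc by blast
      then obtain k where k: "A.child i k" using A.ex_parent[OF i] by blast
      then have "pv k" using B_child_same[OF k False] nc by blast
      then obtain s where s: "1 \<le> s" "s \<le> p" "k = j s" by (rule pv_obtain)
      have "s = 1"
      proof (rule ccontr)
        assume "s \<noteq> 1"
        then have "1 \<le> s - 1" "s - 1 < p" using s by auto
        then show False using B_child_down[of i "s - 1"] k nc s False by auto
      qed
      then show ?thesis using s k by simp
    qed
  qed
  then show ?thesis using B_root_j1 B_root_down pvc by blast
qed

lemma roots_eq: "forest_roots n F' = insert (j 1) (children F (j 1))"
  unfolding roots_F' children_F using B_root_iff by auto

section \<open>The injective vertices of the rotated forest\<close>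

lemma B_lo_iff: "i \<in> {1..n} \<Longrightarrow> B.lo i = 1 \<longleftrightarrow> pv i"
  using A.chord[of i] rot_pv[of i] rot_npv[of i] by (cases "pv i") auto

text \<open>The least child with a larger label starts where its parent does, at 1, and after
  rotation only projective vertices start at 1.\<close>

lemma least_upper_pv:
  assumes "B.child c (j i)" "j i < c" "1 \<le> i" "i \<le> p"
  obtains d where "B.child d (j i)" "j i < d" "\<forall>x. B.child x (j i) \<longrightarrow> j i < x \<longrightarrow> d \<le> x" "pv d"
proof -
  define d where "d = (LEAST x. B.child x (j i) \<and> j i < x)"
  have d: "B.child d (j i) \<and> j i < d" unfolding d_def by (rule LeastI) (use assms in blast)
  have le: "d \<le> x" if "B.child x (j i)" "j i < x" for x
    unfolding d_def by (rule Least_le) (use that in blast)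
  have "B.lo d = B.lo (j i)" by (rule B.least_upper_child) (use d le in auto)
  then have "pv d" using B_lo_iff[of d] B_lo_iff[of "j i"] pv_j[of i] assms d by (simp add: B.child_def)
  then show thesis using that d le by blast
qed

lemma inj_vertices: "injective_vertices n F' p j"
  unfolding injective_vertices_def
proof (intro conjI ballI)
  show "p \<ge> 1" by (rule p1)
  show "least_in (forest_roots n F') (j 1)"
    unfolding least_in_def roots_eq children_F using less_imp_le[OF j_last] by simp
  show "least_in {c \<in> children F' (j i). j i < c} (j (Suc i))" if "i \<in> {1..<p}" for i
  proof -
    have i: "1 \<le> i" "i < p" "i \<le> p" using that by auto
    note c = B_child_j[OF i(1,2)]
    obtain d where d: "B.child d (j i)" "\<forall>x. B.child x (j i) \<longrightarrow> j i < x \<longrightarrow> d \<le> x" "pv d"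
      using least_upper_pv[OF c j_child(2)[OF i(1,2)] i(1,3)] by blast
    have "B.lo d = 1" "B.lo (j (Suc i)) = 1"
      using d(3) pv_j[of "Suc i"] i by (auto simp: rot_pv)
    moreover have "d \<in> {1..n}" "j (Suc i) \<in> {1..n}" using d(1) c by (auto simp: B.child_def)
    \<comment> \<open>Different children of the same parent are disjoint, so they cannot both start
      at 1.\<close>
    ultimately have "d = j (Suc i)"
      using B.child_disjoint[OF d(1) c] B.chord[of d] B.chord[of "j (Suc i)"] by linarith
    then show ?thesis using d c j_child(2)[OF i(1,2)]
      unfolding least_in_def children_F' by auto
  qed
  show "{c \<in> children F' (j p). j p < c} = {}"
  proof (rule ccontr)
    assume "{c \<in> children F' (j p). j p < c} \<noteq> {}"
    then obtain c where "B.child c (j p)" "j p < c" unfolding children_F' by blast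
    then obtain d where d: "B.child d (j p)" "pv d" using least_upper_pv[of c p] p1 by blast
    obtain m where m: "1 \<le> m" "m \<le> p" "d = j m" using d(2) by (rule pv_obtain)
    have "A.ins (j p) d" using d B_ins(3)[of d "j p"] pv_j[of p] p1 by (simp add: B.child_def)
    then show False using m ins_j[of p m] p1 by simp
  qed
qed

end

section \<open>Morphisms and isomorphisms of representations\<close>

text \<open>Dimensions enter as equations rather than carriers, so that rewriting can discharge them
  from \<open>hom_dims\<close> and \<open>rep_dims\<close>.\<close>

lemma mat_assoc:
  fixes A :: "'k::semiring_0 mat"
  shows "dim_col A = dim_row B \<Longrightarrow> dim_col B = dim_row C \<Longrightarrow> A * B * C = A * (B * C)"
  by (rule assoc_mult_mat[of _ "dim_row A" "dim_row B" _ "dim_row C" _ "dim_col C"]) auto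

lemma mat_cancel:
  fixes A :: "'k::semiring_1 mat"
  shows "A * B = 1\<^sub>m m \<Longrightarrow> dim_col A = dim_row B \<Longrightarrow> dim_col B = dim_row C \<Longrightarrow> A * (B * C) = C"
  by (metis index_mult_mat(2) index_one_mat(2,3) left_mult_one_mat' mat_assoc index_mult_mat(3))

lemma zero_col_eq: "dim_row A = dim_row B \<Longrightarrow> dim_col A = 0 \<Longrightarrow> dim_col B = 0 \<Longrightarrow> A = B"
  by (rule eq_matI) auto

lemma zero_row_eq: "dim_col A = dim_col B \<Longrightarrow> dim_row A = 0 \<Longrightarrow> dim_row B = 0 \<Longrightarrow> A = B"
  by (rule eq_matI) auto

lemma inner_zero:
  fixes A :: "'k::semiring_0 mat"
  assumes "dim_col A = 0" "dim_row B = 0"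
  shows "A * B = 0\<^sub>m (dim_row A) (dim_col B)"
  using assms by (intro eq_matI) (auto simp: scalar_prod_def)

lemma hom_dims:
  assumes "f \<in> rep_hom n M N" "1 \<le> i" "i \<le> n"
  shows "dim_row (f i) = dimv N i" "dim_col (f i) = dimv M i"
proof -
  have "\<forall>i\<in>{1..n}. f i \<in> carrier_mat (dimv N i) (dimv M i)"
    using assms(1) unfolding rep_hom_def by blast
  then have "f i \<in> carrier_mat (dimv N i) (dimv M i)" using assms by simp
  then show "dim_row (f i) = dimv N i" "dim_col (f i) = dimv M i" by blast+
qed

lemma hom_comm:
  assumes "f \<in> rep_hom n M N" "1 \<le> i" "i < n"
  shows "f (Suc i) * arr M i = arr N i * f i"
proof -
  have "\<forall>i\<in>{1..<n}. f (Suc i) * arr M i = arr N i * f i"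
    using assms(1) unfolding rep_hom_def by blast
  then show ?thesis using assms by simp
qed

lemma rep_dims:
  assumes "is_rep n M" "1 \<le> i" "i < n"
  shows "dim_row (arr M i) = dimv M (Suc i)" "dim_col (arr M i) = dimv M i"
proof -
  have "arr M i \<in> carrier_mat (dimv M (Suc i)) (dimv M i)"
    using assms unfolding is_rep_def by simp
  then show "dim_row (arr M i) = dimv M (Suc i)" "dim_col (arr M i) = dimv M i" by blast+
qed

abbreviation cols :: "'k::field qrep \<Rightarrow> nat \<Rightarrow> 'k mat set" where
  "cols M i \<equiv> carrier_mat (dimv M i) 1"

lemma homI:
  assumes "\<And>i. 1 \<le> i \<Longrightarrow> i \<le> n \<Longrightarrow> dim_row (f i) = dimv N i"
    "\<And>i. 1 \<le> i \<Longrightarrow> i \<le> n \<Longrightarrow> dim_col (f i) = dimv M i"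
    "\<And>i. 1 \<le> i \<Longrightarrow> i < n \<Longrightarrow> f (Suc i) * arr M i = arr N i * f i"
  shows "f \<in> rep_hom n M N"
proof -
  have "f i \<in> carrier_mat (dimv N i) (dimv M i)" if "i \<in> {1..n}" for i
    using assms(1,2)[of i] that by auto
  moreover have "f (Suc i) * arr M i = arr N i * f i" if "i \<in> {1..<n}" for i
    using assms(3)[of i] that by auto
  ultimately show ?thesis unfolding rep_hom_def by blast
qed

lemma comp_hom:
  assumes "is_rep n M" "is_rep n N" "is_rep n L" "f \<in> rep_hom n M N" "g \<in> rep_hom n N L"
  shows "comp_mor g f \<in> rep_hom n M L"
proof (rule homI)
  fix i assume i: "1 \<le> i" "i < n"
  note d = hom_dims[OF assms(4)] hom_dims[OF assms(5)] rep_dims[OF assms(1)] rep_dims[OF assms(2)]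
    rep_dims[OF assms(3)]
  have "g (Suc i) * f (Suc i) * arr M i = g (Suc i) * (arr N i * f i)"
    using i by (simp add: mat_assoc d hom_comm[OF assms(4)])
  also have "\<dots> = g (Suc i) * arr N i * f i" using i by (simp add: mat_assoc d)
  also have "\<dots> = arr L i * g i * f i" using i by (simp add: d hom_comm[OF assms(5)])
  also have "\<dots> = arr L i * (g i * f i)" using i by (simp add: mat_assoc d)
  finally show "comp_mor g f (Suc i) * arr M i = arr L i * comp_mor g f i"
    by (simp add: comp_mor_def)
qed (use hom_dims assms in \<open>auto simp: comp_mor_def\<close>)

text \<open>The inverse is part of the data, because transporting splittings and exact sequences
  uses both directions.\<close>

definition iso_pair :: "nat \<Rightarrow> 'k::field qrep \<Rightarrow> 'k qrep \<Rightarrow> (nat \<Rightarrow> 'k mat) \<Rightarrow> (nat \<Rightarrow> 'k mat) \<Rightarrow> bool" where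
  "iso_pair n M N u w \<longleftrightarrow> u \<in> rep_hom n M N \<and> w \<in> rep_hom n N M \<and>
     (\<forall>i. 1 \<le> i \<longrightarrow> i \<le> n \<longrightarrow> w i * u i = 1\<^sub>m (dimv M i) \<and> u i * w i = 1\<^sub>m (dimv N i))"

lemma rep_iso_iff: "rep_iso n M N \<longleftrightarrow> (\<exists>u w. iso_pair n M N u w)"
  unfolding rep_iso_def iso_pair_def eq_mor_def comp_mor_def id_mor_def Bex_def Ball_def
    atLeastAtMost_iff by blast

lemma iso_pairD:
  assumes "iso_pair n M N u w"
  shows "u \<in> rep_hom n M N" "w \<in> rep_hom n N M"
    "1 \<le> i \<Longrightarrow> i \<le> n \<Longrightarrow> w i * u i = 1\<^sub>m (dimv M i)"
    "1 \<le> i \<Longrightarrow> i \<le> n \<Longrightarrow> u i * w i = 1\<^sub>m (dimv N i)"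
  using assms by (auto simp: iso_pair_def)

lemma iso_pair_sym: "iso_pair n M N u w \<Longrightarrow> iso_pair n N M w u"
  by (auto simp: iso_pair_def)

lemma rep_iso_sym: "rep_iso n M N \<Longrightarrow> rep_iso n N M"
  using iso_pair_sym rep_iso_iff by blast

lemma rep_iso_trans:
  assumes "is_rep n M" "is_rep n N" "is_rep n L" "rep_iso n M N" "rep_iso n N L"
  shows "rep_iso n M L"
proof -
  obtain u w where 1: "iso_pair n M N u w" using assms(4) rep_iso_iff by blast
  obtain u' w' where 2: "iso_pair n N L u' w'" using assms(5) rep_iso_iff by blast
  note D = iso_pairD[OF 1] iso_pairD[OF 2]
  note d = hom_dims[OF D(1)] hom_dims[OF D(2)] hom_dims[OF D(5)] hom_dims[OF D(6)]
  have "iso_pair n M L (comp_mor u' u) (comp_mor w w')"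
    unfolding iso_pair_def
    using comp_hom[OF assms(1-3) D(1,5)] comp_hom[OF assms(3,2,1) D(6,2)] D(3,4,7,8)
    by (auto simp: comp_mor_def mat_assoc d mat_cancel[OF D(7)] mat_cancel[OF D(4)])
  then show ?thesis using rep_iso_iff by blast
qed

lemma rep_iso_refl:
  assumes "is_rep n M" shows "rep_iso n M M"
proof -
  have "id_mor M \<in> rep_hom n M M"
    by (rule homI) (auto simp: id_mor_def rep_dims[OF assms] left_mult_one_mat' right_mult_one_mat')
  then have "iso_pair n M M (id_mor M) (id_mor M)"
    by (auto simp: iso_pair_def id_mor_def)
  then show ?thesis using rep_iso_iff by blast
qed

text \<open>If one of two isomorphic spaces is zero, the identity of the other factors through it
  and vanishes.\<close>

lemma iso_supp:
  assumes "rep_iso n M N" shows "supp n M = supp n N"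
proof -
  have *: "dimv N i = 0" if iso: "iso_pair n M N u w" and i: "1 \<le> i" "i \<le> n" and z: "dimv M i = 0"
    for M N :: "'a qrep" and u w i
  proof (rule ccontr)
    assume p: "dimv N i \<noteq> 0"
    note D = iso_pairD[OF iso]
    have "1\<^sub>m (dimv N i) = (0\<^sub>m (dimv N i) (dimv N i) :: 'a mat)"
      using D(4)[OF i] inner_zero[of "u i" "w i"] hom_dims[OF D(1) i] hom_dims[OF D(2) i] z by simp
    then have "(1\<^sub>m (dimv N i) :: 'a mat) $$ (0,0) = 0\<^sub>m (dimv N i) (dimv N i) $$ (0,0)" by simp
    then show False using p by simp
  qed
  obtain u w where "iso_pair n M N u w" using assms rep_iso_iff by blast
  then have d: "dimv M i = 0 \<longleftrightarrow> dimv N i = 0" if "1 \<le> i" "i \<le> n" for i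
    using *[of M N u w i] *[of N M w u i] iso_pair_sym that by blast
  have "i \<in> supp n M \<longleftrightarrow> i \<in> supp n N" for i
    using d[of i] unfolding supp_def mem_Collect_eq atLeastAtMost_iff by argo
  then show ?thesis by blast
qed

text \<open>Vectors are handled as matrices with one column.\<close>

definition colm :: "'k vec \<Rightarrow> 'k mat" where
  "colm v = mat (dim_vec v) 1 (\<lambda>(i, j). v $ i)"

lemma colm_dims [simp]: "dim_row (colm v) = dim_vec v" "dim_col (colm v) = 1"
  by (simp_all add: colm_def)

lemma colm_mult: "dim_col A = dim_vec v \<Longrightarrow> A * colm v = colm (A *\<^sub>v v)"
  by (rule eq_matI) (auto simp: colm_def scalar_prod_def)

lemma colm_inj: "colm v = colm w \<longleftrightarrow> v = w"
proof
  assume e: "colm v = colm w"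
  then have "dim_row (colm v) = dim_row (colm w)" by simp
  then have d: "dim_vec v = dim_vec w" by simp
  show "v = w"
  proof (rule eq_vecI)
    fix i assume "i < dim_vec w"
    then show "v $ i = w $ i" using arg_cong[OF e, of "\<lambda>A. A $$ (i, 0)"] d by (simp add: colm_def)
  qed (rule d)
qed simp

lemma colm_ex: "x \<in> carrier_mat m 1 \<Longrightarrow> \<exists>v\<in>carrier_vec m. x = colm v"
proof (rule bexI[of _ "col x 0"])
  assume x: "x \<in> carrier_mat m 1"
  show "x = colm (col x 0)" by (rule eq_matI) (use x in \<open>auto simp: colm_def\<close>)
  show "col x 0 \<in> carrier_vec m" using x by (intro carrier_vecI) simp
qed

lemma colm_carrier: "v \<in> carrier_vec m \<Longrightarrow> colm v \<in> carrier_mat m 1"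
  by (rule carrier_matI) auto

lemma colm_ball: "(\<forall>x\<in>carrier_mat m 1. P x) \<longleftrightarrow> (\<forall>v\<in>carrier_vec m. P (colm v))"
  using colm_ex colm_carrier by blast

lemma colm_bex: "(\<exists>x\<in>carrier_mat m 1. P x) \<longleftrightarrow> (\<exists>v\<in>carrier_vec m. P (colm v))"
  using colm_ex colm_carrier by blast

lemma colm_zero: "colm (0\<^sub>v m) = 0\<^sub>m m 1"
  by (rule eq_matI) (auto simp: colm_def)

lemma image_iff': "w \<in> h ` A \<longleftrightarrow> (\<exists>v\<in>A. h v = w)"
  by auto

section \<open>Monomorphisms, epimorphisms and exactness in terms of columns\<close>

lemma mono_iff:
  fixes f :: "nat \<Rightarrow> 'k::field mat"
  assumes "f \<in> rep_hom n M N"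
  shows "mono_mor n M f \<longleftrightarrow>
    (\<forall>i. 1 \<le> i \<longrightarrow> i \<le> n \<longrightarrow> (\<forall>x\<in>cols M i. f i * x = 0\<^sub>m (dimv N i) 1 \<longrightarrow> x = 0\<^sub>m (dimv M i) 1))"
proof -
  have "inj_on (\<lambda>v. f i *\<^sub>v v) (carrier_vec (dimv M i)) \<longleftrightarrow>
      (\<forall>x\<in>cols M i. f i * x = 0\<^sub>m (dimv N i) 1 \<longrightarrow> x = 0\<^sub>m (dimv M i) 1)" (is "?L \<longleftrightarrow> ?R")
    if i: "1 \<le> i" "i \<le> n" for i
  proof -
    have c: "f i \<in> carrier_mat (dimv N i) (dimv M i)" using hom_dims[OF assms i] by auto
    have "?R \<longleftrightarrow> (\<forall>v\<in>carrier_vec (dimv M i). f i *\<^sub>v v = 0\<^sub>v (dimv N i) \<longrightarrow> v = 0\<^sub>v (dimv M i))" (is "_ \<longleftrightarrow> ?V")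
    proof -
      have "f i * colm v = 0\<^sub>m (dimv N i) 1 \<longleftrightarrow> f i *\<^sub>v v = 0\<^sub>v (dimv N i)"
        if "v \<in> carrier_vec (dimv M i)" for v
        using that c by (simp add: colm_mult colm_zero[symmetric] colm_inj)
      moreover have "colm v = 0\<^sub>m (dimv M i) 1 \<longleftrightarrow> v = (0\<^sub>v (dimv M i) :: 'k vec)" for v
        by (simp add: colm_zero[symmetric] colm_inj)
      ultimately show ?thesis unfolding colm_ball by blast
    qed
    also have "\<dots> \<longleftrightarrow> ?L"
    proof
      assume v: ?V
      show ?L
      proof (rule inj_onI)
        fix x y :: "'k vec" assume xy: "x \<in> carrier_vec (dimv M i)" "y \<in> carrier_vec (dimv M i)" "f i *\<^sub>v x = f i *\<^sub>v y"
        have "f i *\<^sub>v (x - y) = f i *\<^sub>v x - f i *\<^sub>v y" using c xy by (simp add: mult_minus_distrib_mat_vec)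
        also have "\<dots> = 0\<^sub>v (dimv N i)" using xy c by simp
        finally have "f i *\<^sub>v (x - y) = 0\<^sub>v (dimv N i)" .
        moreover have "x - y \<in> carrier_vec (dimv M i)" using xy by simp
        ultimately have "x - y = 0\<^sub>v (dimv M i)" using v by blast
        then have "(x - y) $ k = 0" if "k < dimv M i" for k using that by simp
        then show "x = y" using xy by (intro eq_vecI) auto
      qed
    next
      assume l: ?L
      show ?V
      proof (intro ballI impI)
        fix v :: "'k vec" assume "v \<in> carrier_vec (dimv M i)" "f i *\<^sub>v v = 0\<^sub>v (dimv N i)"
        moreover have "f i *\<^sub>v 0\<^sub>v (dimv M i) = 0\<^sub>v (dimv N i)"
          using c by (intro eq_vecI) (auto simp: scalar_prod_def)
        ultimately show "v = 0\<^sub>v (dimv M i)" using inj_onD[OF l, of v "0\<^sub>v (dimv M i)"] by simp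
      qed
    qed
    finally show ?thesis by simp
  qed
  then show ?thesis unfolding mono_mor_def by auto
qed

lemma epi_iff:
  fixes f :: "nat \<Rightarrow> 'k::field mat"
  assumes "f \<in> rep_hom n M N"
  shows "epi_mor n M N f \<longleftrightarrow>
    (\<forall>i. 1 \<le> i \<longrightarrow> i \<le> n \<longrightarrow> (\<forall>y\<in>cols N i. \<exists>x\<in>cols M i. f i * x = y))"
proof -
  have "(\<lambda>v. f i *\<^sub>v v) ` carrier_vec (dimv M i) = carrier_vec (dimv N i) \<longleftrightarrow>
      (\<forall>y\<in>cols N i. \<exists>x\<in>cols M i. f i * x = y)" (is "?L \<longleftrightarrow> ?R")
    if i: "1 \<le> i" "i \<le> n" for i
  proof -
    have c: "f i \<in> carrier_mat (dimv N i) (dimv M i)" using hom_dims[OF assms i] by auto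
    have e: "f i * colm v = colm w \<longleftrightarrow> f i *\<^sub>v v = w" if "v \<in> carrier_vec (dimv M i)" for v w
      using that c by (simp add: colm_mult colm_inj)
    have "?R \<longleftrightarrow> (\<forall>w\<in>carrier_vec (dimv N i). \<exists>v\<in>carrier_vec (dimv M i). f i *\<^sub>v v = w)"
      unfolding colm_ball colm_bex using e by (meson ball_cong bex_cong)
    also have "\<dots> \<longleftrightarrow> carrier_vec (dimv N i) \<subseteq> (\<lambda>v. f i *\<^sub>v v) ` carrier_vec (dimv M i)"
      unfolding subset_iff image_iff' by blast
    also have "\<dots> \<longleftrightarrow> ?L" using c by auto
    finally show ?thesis by simp
  qed
  then show ?thesis unfolding epi_mor_def by auto
qed

lemma exact_iff:
  fixes f g :: "nat \<Rightarrow> 'k::field mat"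
  assumes "f \<in> rep_hom n N E" "g \<in> rep_hom n E M" "1 \<le> i" "i \<le> n"
  shows "(\<lambda>v. f i *\<^sub>v v) ` carrier_vec (dimv N i) = mat_kernel (g i) \<longleftrightarrow>
    (\<forall>x\<in>cols E i. g i * x = 0\<^sub>m (dimv M i) 1 \<longleftrightarrow>
       (\<exists>y\<in>cols N i. f i * y = x))" (is "?L \<longleftrightarrow> ?R")
proof -
  have cf: "f i \<in> carrier_mat (dimv E i) (dimv N i)" and cg: "g i \<in> carrier_mat (dimv M i) (dimv E i)"
    using hom_dims[OF assms(1,3,4)] hom_dims[OF assms(2,3,4)] by auto
  have ef: "f i * colm v = colm w \<longleftrightarrow> f i *\<^sub>v v = w" if "v \<in> carrier_vec (dimv N i)" for v w
    using that cf by (simp add: colm_mult colm_inj)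
  have eg: "g i * colm v = 0\<^sub>m (dimv M i) 1 \<longleftrightarrow> v \<in> mat_kernel (g i)" if "v \<in> carrier_vec (dimv E i)" for v
    using that cg by (simp add: colm_mult colm_zero[symmetric] colm_inj mat_kernel_def)
  have k: "mat_kernel (g i) \<subseteq> carrier_vec (dimv E i)" using cg by (auto simp: mat_kernel_def)
  have ex: "(\<exists>v\<in>carrier_vec (dimv N i). f i * colm v = colm w) \<longleftrightarrow> (\<exists>v\<in>carrier_vec (dimv N i). f i *\<^sub>v v = w)" for w
    by (rule bex_cong[OF refl]) (rule ef)
  have "?R \<longleftrightarrow> (\<forall>w\<in>carrier_vec (dimv E i). w \<in> mat_kernel (g i) \<longleftrightarrow> (\<exists>v\<in>carrier_vec (dimv N i). f i *\<^sub>v v = w))"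
    unfolding colm_ball colm_bex ex by (rule ball_cong[OF refl]) (simp only: eg)
  also have "\<dots> \<longleftrightarrow> ?L"
  proof
    assume a: "\<forall>w\<in>carrier_vec (dimv E i). w \<in> mat_kernel (g i) \<longleftrightarrow> (\<exists>v\<in>carrier_vec (dimv N i). f i *\<^sub>v v = w)"
    have c: "f i *\<^sub>v v \<in> carrier_vec (dimv E i)" if "v \<in> carrier_vec (dimv N i)" for v using that cf by simp
    show ?L
    proof (intro subset_antisym subsetI)
      fix w assume "w \<in> (\<lambda>v. f i *\<^sub>v v) ` carrier_vec (dimv N i)"
      then obtain v where v: "v \<in> carrier_vec (dimv N i)" "f i *\<^sub>v v = w" by blast
      then show "w \<in> mat_kernel (g i)" using bspec[OF a c[OF v(1)]] by blast
    next
      fix w assume "w \<in> mat_kernel (g i)"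
      then show "w \<in> (\<lambda>v. f i *\<^sub>v v) ` carrier_vec (dimv N i)" using a k unfolding image_iff' by blast
    qed
  next
    assume l: ?L
    show "\<forall>w\<in>carrier_vec (dimv E i). w \<in> mat_kernel (g i) \<longleftrightarrow> (\<exists>v\<in>carrier_vec (dimv N i). f i *\<^sub>v v = w)"
      unfolding l[symmetric] image_iff' by blast
  qed
  finally show ?thesis by simp
qed

lemma short_exact_iff:
  "short_exact n N f E g M \<longleftrightarrow> is_rep n N \<and> is_rep n E \<and> is_rep n M \<and>
     f \<in> rep_hom n N E \<and> g \<in> rep_hom n E M \<and> mono_mor n N f \<and> epi_mor n E M g \<and>
     (\<forall>i. 1 \<le> i \<longrightarrow> i \<le> n \<longrightarrow> (\<forall>x\<in>cols E i. g i * x = 0\<^sub>m (dimv M i) 1 \<longleftrightarrow>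
       (\<exists>y\<in>cols N i. f i * y = x)))"
proof -
  have "(\<forall>i\<in>{1..n}. (\<lambda>v. f i *\<^sub>v v) ` carrier_vec (dimv N i) = mat_kernel (g i)) \<longleftrightarrow>
     (\<forall>i. 1 \<le> i \<longrightarrow> i \<le> n \<longrightarrow> (\<forall>x\<in>cols E i. g i * x = 0\<^sub>m (dimv M i) 1 \<longleftrightarrow>
       (\<exists>y\<in>cols N i. f i * y = x)))"
    if "f \<in> rep_hom n N E" "g \<in> rep_hom n E M"
    using exact_iff[OF that] by (metis (no_types, lifting) atLeastAtMost_iff)
  then show ?thesis unfolding short_exact_def by blast
qed

lemma transport_hom:
  assumes "is_rep n M" "is_rep n M'" "is_rep n N" "is_rep n N'"
    and "iso_pair n M M' u w" "iso_pair n N N' u' w'" "f \<in> rep_hom n M' N'"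
  shows "comp_mor w' (comp_mor f u) \<in> rep_hom n M N"
  by (rule comp_hom[OF assms(1,4,3) comp_hom[OF assms(1,2,4) iso_pairD(1)[OF assms(5)] assms(7)]
        iso_pairD(2)[OF assms(6)]])

lemma mat_zero_mult:
  fixes A :: "'k::semiring_0 mat"
  shows "dim_row A = n \<Longrightarrow> 0\<^sub>m m n * A = 0\<^sub>m m (dim_col A)" "dim_col A = n \<Longrightarrow> A * 0\<^sub>m n m = 0\<^sub>m (dim_row A) m"
  by (intro eq_matI; simp)+

lemma hom_zero_iso:
  assumes r: "is_rep n M" "is_rep n M'" "is_rep n N" "is_rep n N'"
    and "rep_iso n M M'" "rep_iso n N N'" "hom_zero n M N"
  shows "hom_zero n M' N'"
proof -
  obtain u w where 1: "iso_pair n M M' u w" using assms(5) rep_iso_iff by blast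
  obtain u' w' where 2: "iso_pair n N N' u' w'" using assms(6) rep_iso_iff by blast
  note D = iso_pairD[OF 1] iso_pairD[OF 2]
  have "f i = 0\<^sub>m (dimv N' i) (dimv M' i)" if f: "f \<in> rep_hom n M' N'" and i: "1 \<le> i" "i \<le> n" for f i
  proof -
    note d = hom_dims[OF D(1) i] hom_dims[OF D(2) i] hom_dims[OF D(5) i] hom_dims[OF D(6) i] hom_dims[OF f i]
    have "w' i * (f i * u i) = 0\<^sub>m (dimv N i) (dimv M i)"
      using transport_hom[OF r 1 2 f] assms(7) i unfolding hom_zero_def eq_mor_def zero_mor_def comp_mor_def by auto
    then have "u' i * (w' i * (f i * u i)) * w i = 0\<^sub>m (dimv N' i) (dimv M' i)"
      by (simp add: mat_zero_mult d)
    then show ?thesis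
      using i by (simp add: mat_assoc d D mat_cancel[OF D(8)] right_mult_one_mat')
  qed
  then show ?thesis unfolding hom_zero_def eq_mor_def zero_mor_def by auto
qed

text \<open>The middle term stays fixed and only the end maps are composed with isomorphisms. This
  is how extensions and almost split sequences are transported.\<close>

lemma short_exact_iso:
  fixes f g :: "nat \<Rightarrow> 'k::field mat"
  assumes se: "short_exact n N' f E g M'" and r: "is_rep n N" "is_rep n M"
    and 1: "iso_pair n N N' u w" and 2: "iso_pair n M M' u' w'"
  shows "short_exact n N (comp_mor f u) E (comp_mor w' g) M"
proof -
  have s: "is_rep n N'" "is_rep n E" "is_rep n M'" "f \<in> rep_hom n N' E" "g \<in> rep_hom n E M'"
     "mono_mor n N' f" "epi_mor n E M' g" and
    ex: "\<And>i x. 1 \<le> i \<Longrightarrow> i \<le> n \<Longrightarrow> x\<in>cols E i \<Longrightarrow> g i * x = 0\<^sub>m (dimv M' i) 1 \<longleftrightarrow>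
       (\<exists>y\<in>cols N' i. f i * y = x)"
    using se unfolding short_exact_iff by blast+
  note D = iso_pairD[OF 1] iso_pairD[OF 2]
  have h: "comp_mor f u \<in> rep_hom n N E" "comp_mor w' g \<in> rep_hom n E M"
    by (rule comp_hom[OF r(1) s(1,2) D(1) s(4)], rule comp_hom[OF s(2,3) r(2) s(5) D(6)])
  have mono: "mono_mor n N (comp_mor f u)"
    unfolding mono_iff[OF h(1)]
  proof (intro allI impI ballI)
    fix i and x :: "'k mat" assume i: "1 \<le> i" "i \<le> n" and x: "x \<in> cols N i"
      and z: "comp_mor f u i * x = 0\<^sub>m (dimv E i) 1"
    note d = hom_dims[OF D(1) i] hom_dims[OF D(2) i] hom_dims[OF s(4) i]
    have "f i * (u i * x) = 0\<^sub>m (dimv E i) 1" using z x d by (simp add: comp_mor_def mat_assoc)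
    moreover have "u i * x \<in> cols N' i" using x d by auto
    ultimately have "u i * x = 0\<^sub>m (dimv N' i) 1" using s(6) i unfolding mono_iff[OF s(4)] by blast
    then have "w i * (u i * x) = 0\<^sub>m (dimv N i) 1" using d by (simp add: mat_zero_mult)
    then show "x = 0\<^sub>m (dimv N i) 1" using x d by (simp add: mat_cancel[OF D(3)[OF i]])
  qed
  have epi: "epi_mor n E M (comp_mor w' g)"
    unfolding epi_iff[OF h(2)]
  proof (intro allI impI ballI)
    fix i and y :: "'k mat" assume i: "1 \<le> i" "i \<le> n" and y: "y \<in> cols M i"
    note d = hom_dims[OF D(5) i] hom_dims[OF D(6) i] hom_dims[OF s(5) i]
    have "u' i * y \<in> cols M' i" using y d by auto
    then obtain x where x: "x \<in> cols E i" "g i * x = u' i * y"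
      using s(7) i unfolding epi_iff[OF s(5)] by blast
    then have "w' i * g i * x = y" using y d by (simp add: mat_assoc mat_cancel[OF D(7)[OF i]])
    then show "\<exists>x\<in>cols E i. comp_mor w' g i * x = y" using x by (auto simp: comp_mor_def)
  qed
  have "comp_mor w' g i * x = 0\<^sub>m (dimv M i) 1 \<longleftrightarrow> (\<exists>y\<in>cols N i. comp_mor f u i * y = x)"
    if i: "1 \<le> i" "i \<le> n" and x: "x\<in>cols E i" for i and x :: "'k mat"
  proof -
    note d = hom_dims[OF D(5) i] hom_dims[OF D(6) i] hom_dims[OF s(5) i] hom_dims[OF D(1) i]
      hom_dims[OF D(2) i] hom_dims[OF s(4) i]
    have "comp_mor w' g i * x = 0\<^sub>m (dimv M i) 1 \<longleftrightarrow> g i * x = 0\<^sub>m (dimv M' i) 1"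
    proof
      assume "comp_mor w' g i * x = 0\<^sub>m (dimv M i) 1"
      then have "w' i * (g i * x) = 0\<^sub>m (dimv M i) 1" using x d by (simp add: comp_mor_def mat_assoc)
      then have "u' i * (w' i * (g i * x)) = 0\<^sub>m (dimv M' i) 1" using d by (simp add: mat_zero_mult)
      then show "g i * x = 0\<^sub>m (dimv M' i) 1" using x d by (simp add: mat_cancel[OF D(8)[OF i]])
    next
      assume "g i * x = 0\<^sub>m (dimv M' i) 1"
      then show "comp_mor w' g i * x = 0\<^sub>m (dimv M i) 1" using x d
        by (simp add: comp_mor_def mat_assoc mat_zero_mult)
    qed
    also have "\<dots> \<longleftrightarrow> (\<exists>y\<in>cols N' i. f i * y = x)" by (rule ex[OF i x])
    also have "\<dots> \<longleftrightarrow> (\<exists>y\<in>cols N i. comp_mor f u i * y = x)"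
    proof
      assume "\<exists>y\<in>cols N' i. f i * y = x"
      then obtain y where y: "y \<in> cols N' i" "f i * y = x" by blast
      have "comp_mor f u i * (w i * y) = x" using y d
        by (simp add: comp_mor_def mat_assoc mat_cancel[OF D(4)[OF i]])
      moreover have "w i * y \<in> cols N i" using y d by auto
      ultimately show "\<exists>y\<in>cols N i. comp_mor f u i * y = x" by blast
    next
      assume "\<exists>y\<in>cols N i. comp_mor f u i * y = x"
      then obtain y where y: "y \<in> cols N i" "comp_mor f u i * y = x" by blast
      have "f i * (u i * y) = x" using y d by (simp add: comp_mor_def mat_assoc)
      moreover have "u i * y \<in> cols N' i" using y d by auto
      ultimately show "\<exists>y\<in>cols N' i. f i * y = x" by blast
    qed
    finally show ?thesis .
  qed
  then show ?thesis unfolding short_exact_iff using s r h mono epi by blast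
qed

lemma ball_1n: "(\<forall>i\<in>{1..n}. P i) \<longleftrightarrow> (\<forall>i. 1 \<le> i \<longrightarrow> i \<le> n \<longrightarrow> P i)" for n :: nat
  unfolding Ball_def atLeastAtMost_iff by blast

lemma split_epi_iff:
  "split_epi n M N f \<longleftrightarrow> (\<exists>s\<in>rep_hom n N M. \<forall>i. 1 \<le> i \<longrightarrow> i \<le> n \<longrightarrow> f i * s i = 1\<^sub>m (dimv N i))"
  unfolding split_epi_def eq_mor_def comp_mor_def id_mor_def ball_1n by (rule refl)

lemma split_mono_iff:
  "split_mono n M N f \<longleftrightarrow> (\<exists>s\<in>rep_hom n N M. \<forall>i. 1 \<le> i \<longrightarrow> i \<le> n \<longrightarrow> s i * f i = 1\<^sub>m (dimv M i))"
  unfolding split_mono_def eq_mor_def comp_mor_def id_mor_def ball_1n by (rule refl)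

lemma split_epi_iso:
  fixes g :: "nat \<Rightarrow> 'k::field mat"
  assumes r: "is_rep n E" "is_rep n M" "is_rep n M'" and g: "g \<in> rep_hom n E M'"
    and 1: "iso_pair n M M' u w"
  shows "split_epi n E M (comp_mor w g) \<longleftrightarrow> split_epi n E M' g"
proof
  note D = iso_pairD[OF 1]
  assume "split_epi n E M (comp_mor w g)"
  then obtain s where s: "s \<in> rep_hom n M E" "\<And>i. 1 \<le> i \<Longrightarrow> i \<le> n \<Longrightarrow> comp_mor w g i * s i = 1\<^sub>m (dimv M i)"
    unfolding split_epi_iff by blast
  have "g i * comp_mor s w i = 1\<^sub>m (dimv M' i)" if i: "1 \<le> i" "i \<le> n" for i
  proof -
    note d = hom_dims[OF D(1) i] hom_dims[OF D(2) i] hom_dims[OF g i] hom_dims[OF s(1) i]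
    have "u i * (w i * g i * s i) = u i" using s(2)[OF i] d by (simp add: comp_mor_def right_mult_one_mat')
    then have "g i * s i = u i" using d by (simp add: mat_assoc mat_cancel[OF D(4)[OF i]])
    then have "g i * s i * w i = 1\<^sub>m (dimv M' i)" using D(4)[OF i] by simp
    then show ?thesis using d by (simp add: comp_mor_def mat_assoc)
  qed
  then show "split_epi n E M' g" unfolding split_epi_iff using comp_hom[OF r(3,2,1) D(2) s(1)] by blast
next
  note D = iso_pairD[OF 1]
  assume "split_epi n E M' g"
  then obtain s where s: "s \<in> rep_hom n M' E" "\<And>i. 1 \<le> i \<Longrightarrow> i \<le> n \<Longrightarrow> g i * s i = 1\<^sub>m (dimv M' i)"
    unfolding split_epi_iff by blast
  have "comp_mor w g i * comp_mor s u i = 1\<^sub>m (dimv M i)" if i: "1 \<le> i" "i \<le> n" for i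
  proof -
    note d = hom_dims[OF D(1) i] hom_dims[OF D(2) i] hom_dims[OF g i] hom_dims[OF s(1) i]
    show ?thesis using d by (simp add: comp_mor_def mat_assoc mat_cancel[OF s(2)[OF i]] D(3)[OF i])
  qed
  then show "split_epi n E M (comp_mor w g)" unfolding split_epi_iff
    using comp_hom[OF r(2,3,1) D(1) s(1)] by blast
qed

lemma split_mono_iso:
  fixes f :: "nat \<Rightarrow> 'k::field mat"
  assumes r: "is_rep n E" "is_rep n N" "is_rep n N'" and f: "f \<in> rep_hom n N' E"
    and 1: "iso_pair n N N' u w"
  shows "split_mono n N E (comp_mor f u) \<longleftrightarrow> split_mono n N' E f"
proof
  note D = iso_pairD[OF 1]
  assume "split_mono n N E (comp_mor f u)"
  then obtain s where s: "s \<in> rep_hom n E N" "\<And>i. 1 \<le> i \<Longrightarrow> i \<le> n \<Longrightarrow> s i * comp_mor f u i = 1\<^sub>m (dimv N i)"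
    unfolding split_mono_iff by blast
  have "comp_mor u s i * f i = 1\<^sub>m (dimv N' i)" if i: "1 \<le> i" "i \<le> n" for i
  proof -
    note d = hom_dims[OF D(1) i] hom_dims[OF D(2) i] hom_dims[OF f i] hom_dims[OF s(1) i]
    have "s i * (f i * u i) * w i = w i" using s(2)[OF i] d by (simp add: comp_mor_def left_mult_one_mat')
    then have "s i * f i = w i" using d by (simp add: mat_assoc D(4)[OF i] right_mult_one_mat')
    then show ?thesis using d D(4)[OF i] by (simp add: comp_mor_def mat_assoc)
  qed
  then show "split_mono n N' E f" unfolding split_mono_iff using comp_hom[OF r(1,2,3) s(1) D(1)] by blast
next
  note D = iso_pairD[OF 1]
  assume "split_mono n N' E f"
  then obtain s where s: "s \<in> rep_hom n E N'" "\<And>i. 1 \<le> i \<Longrightarrow> i \<le> n \<Longrightarrow> s i * f i = 1\<^sub>m (dimv N' i)"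
    unfolding split_mono_iff by blast
  have "comp_mor w s i * comp_mor f u i = 1\<^sub>m (dimv N i)" if i: "1 \<le> i" "i \<le> n" for i
  proof -
    note d = hom_dims[OF D(1) i] hom_dims[OF D(2) i] hom_dims[OF f i] hom_dims[OF s(1) i]
    show ?thesis using d by (simp add: comp_mor_def mat_assoc mat_cancel[OF s(2)[OF i]] D(3)[OF i])
  qed
  then show "split_mono n N E (comp_mor f u)" unfolding split_mono_iff
    using comp_hom[OF r(1,3,2) s(1) D(2)] by blast
qed

lemma ext_zero_iso:
  assumes "is_rep n M" "is_rep n N" "rep_iso n M M'" "rep_iso n N N'" "ext_zero n M N"
  shows "ext_zero n M' N'"
  unfolding ext_zero_def
proof (intro allI impI)
  fix E :: "'a qrep" and f g assume se: "short_exact n N' f E g M'"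
  obtain u w where 1: "iso_pair n M M' u w" using assms(3) rep_iso_iff by blast
  obtain u' w' where 2: "iso_pair n N N' u' w'" using assms(4) rep_iso_iff by blast
  have "split_epi n E M (comp_mor w g)"
    using short_exact_iso[OF se assms(2,1) 2 1] assms(5) unfolding ext_zero_def by blast
  then show "split_epi n E M' g"
    using split_epi_iso[OF _ assms(1) _ _ 1, of E g] se unfolding short_exact_iff by blast
qed

lemma indecomposable_iso:
  assumes "is_rep n M" "is_rep n M'" "rep_iso n M M'" "indecomposable n M"
  shows "indecomposable n M'"
proof -
  have "\<not> is_zero n M'"
    using iso_supp[OF assms(3)] assms(4) unfolding indecomposable_def is_zero_def supp_def by blast
  moreover have "rep_iso n M (direct_sum A B)"
    if a: "is_rep n A" "is_rep n B" "rep_iso n M' (direct_sum A B)" for A B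
  proof -
    have "is_rep n (direct_sum A B)"
      using a(1,2) unfolding is_rep_def direct_sum_def by simp
    then show ?thesis using rep_iso_trans[OF assms(1,2) _ assms(3) a(3)] by blast
  qed
  ultimately show ?thesis using assms unfolding indecomposable_def by blast
qed

section \<open>Interval modules\<close>

text \<open>The map that \<open>M\<close> attaches to the path of length \<open>k\<close> starting
  at \<open>i\<close>.\<close>

fun pth :: "'k::field qrep \<Rightarrow> nat \<Rightarrow> nat \<Rightarrow> 'k mat" where
  "pth M i 0 = 1\<^sub>m (dimv M i)"
| "pth M i (Suc k) = arr M (i + k) * pth M i k"

lemma pth_dims:
  assumes "is_rep n M" "1 \<le> i" "i + k \<le> n"
  shows "dim_row (pth M i k) = dimv M (i + k)" "dim_col (pth M i k) = dimv M i"
  using assms(3) by (induction k) (use rep_dims[OF assms(1)] assms(2) in auto)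

lemma pth_left:
  assumes "is_rep n M" "1 \<le> i" "i + Suc k \<le> n"
  shows "pth M i (Suc k) = pth M (Suc i) k * arr M i"
  using assms(3)
proof (induction k)
  case 0
  then show ?case using rep_dims[OF assms(1,2)] by (simp add: left_mult_one_mat' right_mult_one_mat')
next
  case (Suc k)
  then have "pth M i (Suc k) = pth M (Suc i) k * arr M i" by simp
  then show ?case
    using pth_dims[OF assms(1), of "Suc i" k] rep_dims[OF assms(1), of i] rep_dims[OF assms(1), of "Suc (i + k)"] assms(2) Suc.prems
    by (simp add: mat_assoc)
qed

lemma pth_add:
  assumes "is_rep n M" "1 \<le> i" "i + k + l \<le> n"
  shows "pth M i (k + l) = pth M (i + k) l * pth M i k"
  using assms(3)
proof (induction l)
  case 0
  then show ?case using pth_dims[OF assms(1,2), of k] by (simp add: left_mult_one_mat')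
next
  case (Suc l)
  then show ?case
    using pth_dims[OF assms(1), of "i + k" l] pth_dims[OF assms(1,2), of k] rep_dims[OF assms(1), of "i + k + l"] assms(2)
    by (simp add: mat_assoc add.assoc)
qed

lemma pth_natural:
  assumes "is_rep n M" "is_rep n N" "f \<in> rep_hom n M N" "1 \<le> i" "i + k \<le> n"
  shows "f (i + k) * pth M i k = pth N i k * f i"
  using assms(5)
proof (induction k)
  case 0
  then show ?case using hom_dims[OF assms(3,4)] by (simp add: left_mult_one_mat' right_mult_one_mat')
next
  case (Suc k)
  let ?j = "i + k"
  have j: "1 \<le> ?j" "?j < n" using assms(4) Suc.prems by auto
  note d = rep_dims[OF assms(1) j] rep_dims[OF assms(2) j] hom_dims[OF assms(3), of ?j] hom_dims[OF assms(3), of "Suc ?j"]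
    pth_dims[OF assms(1,4), of k] pth_dims[OF assms(2,4), of k] hom_dims[OF assms(3), of i]
  have "f (Suc ?j) * (arr M ?j * pth M i k) = f (Suc ?j) * arr M ?j * pth M i k"
    using j d assms(4) Suc.prems by (simp add: mat_assoc)
  also have "\<dots> = arr N ?j * (f ?j * pth M i k)"
    using j d assms(4) Suc.prems by (simp add: mat_assoc hom_comm[OF assms(3) j])
  also have "\<dots> = arr N ?j * pth N i k * f i"
    using j d assms(4) Suc by (simp add: mat_assoc)
  finally show ?case by simp
qed

text \<open>A truncated identity. The bases of interval modules and of \<open>mid\<close> are
  ordered so that every structure map has this shape.\<close>

definition rect :: "nat \<Rightarrow> nat \<Rightarrow> 'k::field mat" where
  "rect m k = mat m k (\<lambda>(i, j). if i = j then 1 else 0)"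

lemma rect_dims [simp]: "dim_row (rect m k) = m" "dim_col (rect m k) = k"
  by (simp_all add: rect_def)

lemma rect_mult: "dim_row B = k \<Longrightarrow> rect m k * B = mat m (dim_col B) (\<lambda>(r, s). if r < k then B $$ (r, s) else 0)"
  by (rule eq_matI) (auto simp: rect_def scalar_prod_def if_distrib[of "\<lambda>x. x * _"] cong: if_cong)

lemma mult_rect: "dim_col B = m \<Longrightarrow> B * rect m k = mat (dim_row B) k (\<lambda>(r, s). if s < m then B $$ (r, s) else 0)"
  by (rule eq_matI) (auto simp: rect_def scalar_prod_def if_distrib[of "\<lambda>x. _ * x"] cong: if_cong)

lemma rect_one: "rect m m = 1\<^sub>m m"
  by (rule eq_matI) (auto simp: rect_def)

definition idim :: "nat \<Rightarrow> nat \<Rightarrow> nat \<Rightarrow> nat" where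
  "idim a b i = (if a \<le> i \<and> i < b then 1 else 0)"

definition ivl :: "nat \<Rightarrow> nat \<Rightarrow> 'k::field qrep" where
  "ivl a b = \<lparr> dimv = idim a b, arr = (\<lambda>i. rect (idim a b (Suc i)) (idim a b i)) \<rparr>"

lemma ivl_simps [simp]: "dimv (ivl a b) = idim a b" "arr (ivl a b) i = rect (idim a b (Suc i)) (idim a b i)"
  by (simp_all add: ivl_def)

lemma ivl_rep [simp]: "is_rep n (ivl a b)"
  unfolding is_rep_def by (intro ballI carrier_matI) simp_all

lemma idim_in: "a \<le> i \<Longrightarrow> i < b \<Longrightarrow> idim a b i = 1"
  and idim_out: "\<not> (a \<le> i \<and> i < b) \<Longrightarrow> idim a b i = 0"
  by (simp_all add: idim_def)

lemma ivl_supp: "1 \<le> a \<Longrightarrow> b \<le> Suc n \<Longrightarrow> supp n (ivl a b) = {a..<b}"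
  by (auto simp: supp_def idim_def)

lemma pth_ivl:
  assumes "a \<le> i" "i + k < b"
  shows "pth (ivl a b) i k = 1\<^sub>m 1"
  using assms(2)
proof (induction k)
  case (Suc k)
  then show ?case using assms(1) by (simp add: idim_in rect_one)
qed (use assms in \<open>simp add: idim_in\<close>)

lemma pth_ivl_dims:
  assumes "1 \<le> i"
  shows "dim_row (pth (ivl a b) i k) = idim a b (i + k)" "dim_col (pth (ivl a b) i k) = idim a b i"
  using pth_dims[OF ivl_rep assms order_refl] by (simp_all only: ivl_simps)

text \<open>The module \<open>ivl a b\<close> is generated by its vector at \<open>a\<close>, which
  dies at \<open>b\<close>. A morphism from it amounts to an element \<open>v\<close> at
  \<open>a\<close> that is killed on the way to \<open>b\<close>, an empty condition for
  \<open>b = n + 1\<close>.\<close>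

definition from_ivl :: "'k::field qrep \<Rightarrow> nat \<Rightarrow> nat \<Rightarrow> 'k mat \<Rightarrow> nat \<Rightarrow> 'k mat" where
  "from_ivl M a b v i = (if a \<le> i \<and> i < b then pth M a (i - a) * v else 0\<^sub>m (dimv M i) 0)"

text \<open>Dually, a morphism to \<open>ivl a b\<close> amounts to a functional \<open>l\<close> at
  the last vertex \<open>b - 1\<close> that vanishes on what comes from \<open>a - 1\<close>, an
  empty condition for \<open>a = 1\<close>.\<close>

definition to_ivl :: "'k::field qrep \<Rightarrow> nat \<Rightarrow> nat \<Rightarrow> 'k mat \<Rightarrow> nat \<Rightarrow> 'k mat" where
  "to_ivl M a b l i = (if a \<le> i \<and> i < b then l * pth M i (b - 1 - i) else 0\<^sub>m 0 (dimv M i))"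

lemma from_ivl_hom:
  assumes M: "is_rep n M" and ab: "1 \<le> a" "a < b" "b \<le> Suc n" and v: "v \<in> cols M a"
    and z: "b \<le> n \<Longrightarrow> pth M a (b - a) * v = 0\<^sub>m (dimv M b) 1"
  shows "from_ivl M a b v \<in> rep_hom n (ivl a b) M"
proof (rule homI)
  note d = pth_dims[OF M ab(1)]
  fix i assume i: "1 \<le> i" "i \<le> n"
  show "dim_row (from_ivl M a b v i) = dimv M i" "dim_col (from_ivl M a b v i) = dimv (ivl a b :: 'a qrep) i"
    using d[of "i - a"] i v by (auto simp: from_ivl_def idim_def)
next
  fix i assume i: "1 \<le> i" "i < n"
  note d = rep_dims[OF M i]
  consider "\<not> (a \<le> i \<and> i < b)" | "a \<le> i" "Suc i < b" | "a \<le> i" "Suc i = b" by linarith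
  then show "from_ivl M a b v (Suc i) * arr (ivl a b) i = arr M i * from_ivl M a b v i"
  proof cases
    case 1
    then have "dim_row (from_ivl M a b v (Suc i)) = dimv M (Suc i)"
      using pth_dims[OF M ab(1), of "Suc i - a"] i by (auto simp: from_ivl_def)
    then show ?thesis using 1 d by (intro zero_col_eq) (auto simp: from_ivl_def idim_out)
  next
    case 2
    then have e: "Suc i - a = Suc (i - a)" by simp
    then show ?thesis using 2 d pth_dims[OF M ab(1), of "i - a"] v i
      by (simp add: from_ivl_def e idim_in rect_one mat_assoc right_mult_one_mat')
  next
    case 3
    then have e: "b - a = Suc (i - a)" by simp
    have "arr M i * (pth M a (i - a) * v) = 0\<^sub>m (dimv M b) 1"
      using 3 d pth_dims[OF M ab(1), of "i - a"] v i z by (simp add: e mat_assoc)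
    then show ?thesis using 3 d by (simp add: from_ivl_def idim_in idim_out inner_zero)
  qed
qed

lemma to_ivl_hom:
  assumes M: "is_rep n M" and ab: "1 \<le> a" "a < b" "b \<le> Suc n" and l: "l \<in> carrier_mat 1 (dimv M (b - 1))"
    and z: "1 < a \<Longrightarrow> l * pth M (a - 1) (b - a) = 0\<^sub>m 1 (dimv M (a - 1))"
  shows "to_ivl M a b l \<in> rep_hom n M (ivl a b)"
proof (rule homI)
  fix i assume i: "1 \<le> i" "i \<le> n"
  show "dim_row (to_ivl M a b l i) = dimv (ivl a b :: 'a qrep) i" "dim_col (to_ivl M a b l i) = dimv M i"
    using pth_dims[OF M i(1), of "b - 1 - i"] i l ab by (auto simp: to_ivl_def idim_def)
next
  fix i assume i: "1 \<le> i" "i < n"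
  note d = rep_dims[OF M i]
  have P: "dim_row (pth M (Suc i) (b - 1 - Suc i)) = dimv M (b - 1)" "dim_col (pth M (Suc i) (b - 1 - Suc i)) = dimv M (Suc i)"
    if sb: "Suc i < b"
  proof -
    have e: "Suc i + (b - 1 - Suc i) = b - 1" using sb by simp
    show "dim_row (pth M (Suc i) (b - 1 - Suc i)) = dimv M (b - 1)" "dim_col (pth M (Suc i) (b - 1 - Suc i)) = dimv M (Suc i)"
      using pth_dims[OF M, of "Suc i" "b - 1 - Suc i"] i sb ab unfolding e by auto
  qed
  consider "\<not> (a \<le> Suc i \<and> Suc i < b)" | "a \<le> i" "Suc i < b" | "a = Suc i" "Suc i < b" by linarith
  then show "to_ivl M a b l (Suc i) * arr M i = arr (ivl a b) i * to_ivl M a b l i"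
  proof cases
    case 1
    then have "dim_col (to_ivl M a b l i) = dimv M i"
      using pth_dims[OF M, of i "b - 1 - i"] i ab by (auto simp: to_ivl_def)
    then show ?thesis using 1 d by (intro zero_row_eq) (auto simp: to_ivl_def idim_out)
  next
    case 2
    then have e: "b - 1 - i = Suc (b - 1 - Suc i)" by simp
    have "pth M i (b - 1 - i) = pth M (Suc i) (b - 1 - Suc i) * arr M i"
      unfolding e by (rule pth_left[OF M]) (use 2 i ab in auto)
    then show ?thesis using 2 d P l
      by (simp add: to_ivl_def idim_in rect_one mat_assoc left_mult_one_mat')
  next
    case 3
    then have e: "b - a = Suc (b - 1 - Suc i)" by simp
    have "pth M i (b - a) = pth M (Suc i) (b - 1 - Suc i) * arr M i"
      unfolding e by (rule pth_left[OF M]) (use 3 i ab in auto)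
    then have "l * pth M (Suc i) (b - 1 - Suc i) * arr M i = 0\<^sub>m 1 (dimv M i)"
      using 3 d P l i z by (simp add: mat_assoc)
    then show ?thesis using 3 d by (simp add: to_ivl_def idim_in idim_out inner_zero)
  qed
qed

lemma hom_from_ivl:
  assumes M: "is_rep n M" and f: "f \<in> rep_hom n (ivl a b) M" and i: "1 \<le> a" "a \<le> i" "i < b" "i \<le> n"
  shows "f i = pth M a (i - a) * f a"
proof -
  have "f i * 1\<^sub>m 1 = pth M a (i - a) * f a"
    using pth_natural[OF ivl_rep M f i(1), of "i - a"] i by (simp add: pth_ivl)
  then show ?thesis using hom_dims[OF f, of i] i by (simp add: idim_in right_mult_one_mat')
qed

lemma hom_from_ivl_zero:
  assumes M: "is_rep n M" and f: "f \<in> rep_hom n (ivl a b) M" and i: "1 \<le> a" "a < b" "b \<le> n"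
  shows "pth M a (b - a) * f a = 0\<^sub>m (dimv M b) 1"
proof -
  have "f b * pth (ivl a b) a (b - a) = pth M a (b - a) * f a"
    using pth_natural[OF ivl_rep M f i(1), of "b - a"] i by simp
  then show ?thesis using hom_dims[OF f, of b] i
    by (simp add: pth_ivl_dims idim_in idim_out inner_zero)
qed

lemma hom_to_ivl:
  assumes M: "is_rep n M" and f: "f \<in> rep_hom n M (ivl a b)" and i: "1 \<le> i" "a \<le> i" "i < b" "b \<le> Suc n"
  shows "f i = f (b - 1) * pth M i (b - 1 - i)"
proof -
  have "f (b - 1) * pth M i (b - 1 - i) = 1\<^sub>m 1 * f i"
    using pth_natural[OF M ivl_rep f i(1), of "b - 1 - i"] i by (simp add: pth_ivl)
  then show ?thesis using hom_dims[OF f, of i] i by (simp add: idim_in left_mult_one_mat')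
qed

lemma hom_to_ivl_zero:
  assumes M: "is_rep n M" and f: "f \<in> rep_hom n M (ivl a b)" and i: "1 < a" "a < b" "b \<le> Suc n"
  shows "f (b - 1) * pth M (a - 1) (b - a) = 0\<^sub>m 1 (dimv M (a - 1))"
proof -
  have "f (b - 1) * pth M (a - 1) (b - a) = pth (ivl a b) (a - 1) (b - a) * f (a - 1)"
    using pth_natural[OF M ivl_rep f, of "a - 1" "b - a"] i by simp
  then show ?thesis using hom_dims[OF f, of "a - 1"] i
    by (simp add: pth_ivl_dims idim_in idim_out inner_zero)
qed

lemma one_not_zero_mat: "1\<^sub>m 1 \<noteq> (0\<^sub>m 1 1 :: 'k::field mat)"
proof
  assume "1\<^sub>m 1 = (0\<^sub>m 1 1 :: 'k mat)"
  then have "(1\<^sub>m 1 :: 'k mat) $$ (0, 0) = 0\<^sub>m 1 1 $$ (0, 0)" by simp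
  then show False by simp
qed

text \<open>The image of a nonzero map is an interval that starts at \<open>a\<close>, being a
  quotient of \<open>ivl a b\<close>, and ends at \<open>d\<close>, being a submodule of
  \<open>ivl c d\<close>.\<close>

lemma hom_zero_ivl:
  assumes "1 \<le> a" "a < b" "b \<le> Suc n" "1 \<le> c" "c < d" "d \<le> Suc n"
  shows "hom_zero n (ivl a b) (ivl c d :: 'k::field qrep) \<longleftrightarrow> \<not> (c \<le> a \<and> a < d \<and> d \<le> b)"
proof
  assume h: "hom_zero n (ivl a b) (ivl c d :: 'k qrep)"
  show "\<not> (c \<le> a \<and> a < d \<and> d \<le> b)"
  proof
    assume e: "c \<le> a \<and> a < d \<and> d \<le> b"
    let ?f = "from_ivl (ivl c d) a b (1\<^sub>m 1) :: nat \<Rightarrow> 'k mat"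
    have "?f \<in> rep_hom n (ivl a b) (ivl c d)"
    proof (rule from_ivl_hom[OF ivl_rep assms(1-3)])
      show "pth (ivl c d) a (b - a) * 1\<^sub>m 1 = (0\<^sub>m (dimv (ivl c d :: 'k qrep) b) 1 :: 'k mat)" if "b \<le> n"
        by (rule zero_row_eq) (use that e assms in \<open>auto simp: idim_out pth_ivl_dims\<close>)
    qed (use e in \<open>auto simp: idim_in\<close>)
    then have "?f a = 0\<^sub>m (dimv (ivl c d :: 'k qrep) a) (dimv (ivl a b :: 'k qrep) a)"
      using h assms unfolding hom_zero_def eq_mor_def zero_mor_def by simp
    then show False using e assms one_not_zero_mat[where 'k = 'k] by (simp add: from_ivl_def idim_in left_mult_one_mat')
  qed
next
  assume ne: "\<not> (c \<le> a \<and> a < d \<and> d \<le> b)"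
  have "f i = 0\<^sub>m (idim c d i) (idim a b i)" if f: "f \<in> rep_hom n (ivl a b) (ivl c d :: 'k qrep)" and i: "1 \<le> i" "i \<le> n" for f i
  proof (cases "a \<le> i \<and> i < b \<and> c \<le> i \<and> i < d")
    case False
    then have "idim c d i = 0 \<or> idim a b i = 0" by (auto simp: idim_def)
    then show ?thesis using hom_dims[OF f i] by (auto intro: zero_row_eq zero_col_eq)
  next
    case True
    consider "a < c" | "b < d" using ne True by linarith
    then show ?thesis
    proof cases
      case 1
      have "f i = pth (ivl c d) a (i - a) * f a"
        by (rule hom_from_ivl[OF ivl_rep f]) (use True i assms in auto)
      also have "\<dots> = 0\<^sub>m (idim c d i) (idim a b i)"
        using hom_dims[OF f, of a] 1 True i assms
        by (simp add: pth_ivl_dims inner_zero idim_out idim_in)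
      finally show ?thesis .
    next
      case 2
      have "pth (ivl c d) i (b - i) * f i = f b * pth (ivl a b) i (b - i)"
        using pth_natural[OF ivl_rep ivl_rep f i(1), of "b - i"] True 2 assms by simp
      also have "\<dots> = 0\<^sub>m 1 1"
        using hom_dims[OF f, of b] 2 True i assms
        by (simp add: pth_ivl_dims inner_zero idim_out idim_in)
      finally show ?thesis using True 2 hom_dims[OF f i] by (simp add: pth_ivl idim_in left_mult_one_mat')
    qed
  qed
  then show "hom_zero n (ivl a b) (ivl c d :: 'k qrep)" unfolding hom_zero_def eq_mor_def zero_mor_def by simp
qed

section \<open>Solvability of linear systems\<close>

lemma functional_factor:
  fixes a :: "nat \<Rightarrow> nat \<Rightarrow> 'k::field" and l :: "nat \<Rightarrow> 'k"
  assumes "\<And>v. (\<forall>i<m. (\<Sum>j<n. a i j * v j) = 0) \<Longrightarrow> (\<Sum>j<n. l j * v j) = 0"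
  shows "\<exists>u. \<forall>j<n. l j = (\<Sum>i<m. u i * a i j)"
  using assms
proof (induction m arbitrary: l)
  case 0
  have "l j = 0" if "j < n" for j
    using 0[of "\<lambda>i. if i = j then 1 else 0"] that by (simp add: if_distrib cong: if_cong)
  then show ?case by simp
next
  case (Suc m)
  show ?case
  proof (cases "\<forall>v. (\<forall>i<m. (\<Sum>j<n. a i j * v j) = 0) \<longrightarrow> (\<Sum>j<n. l j * v j) = 0")
    case True
    then obtain u where u: "\<forall>j<n. l j = (\<Sum>i<m. u i * a i j)" using Suc.IH[of l] by blast
    then have "\<forall>j<n. l j = (\<Sum>i<Suc m. (u(m := 0)) i * a i j)" by simp
    then show ?thesis by blast
  next
    case False
    then obtain v where v: "\<And>i. i < m \<Longrightarrow> (\<Sum>j<n. a i j * v j) = 0" "(\<Sum>j<n. l j * v j) \<noteq> 0" by blast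
    define r where "r = (\<Sum>j<n. a m j * v j)"
    have r: "r \<noteq> 0" using Suc.prems[of v] v unfolding r_def less_Suc_eq by blast
    \<comment> \<open>With this \<open>c\<close> the functional \<open>l - c * a m\<close> vanishes
      at \<open>v\<close>. Any \<open>w\<close> killed by the first \<open>m\<close> rows can be
      moved along \<open>v\<close> until row \<open>m\<close> kills it too, and this does not change
      the value of that functional.\<close>
    define c where "c = (\<Sum>j<n. l j * v j) / r"
    have "\<exists>u. \<forall>j<n. l j - c * a m j = (\<Sum>i<m. u i * a i j)"
    proof (rule Suc.IH)
      fix w assume w: "\<forall>i<m. (\<Sum>j<n. a i j * w j) = 0"
      define s where "s = (\<Sum>j<n. a m j * w j)"
      have lin: "(\<Sum>j<n. b j * (w j - s / r * v j)) = (\<Sum>j<n. b j * w j) - s / r * (\<Sum>j<n. b j * v j)" for b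
        by (simp add: algebra_simps sum_subtractf sum_distrib_left)
      have z: "(\<Sum>j<n. a i j * (w j - s / r * v j)) = 0" if "i < Suc m" for i
      proof (cases "i = m")
        case True
        show ?thesis unfolding lin True using r by (simp add: s_def[symmetric] r_def[symmetric])
      next
        case False
        then have "i < m" using that by simp
        then show ?thesis unfolding lin using w v(1) by simp
      qed
      have "(\<Sum>j<n. l j * (w j - s / r * v j)) = 0" by (rule Suc.prems, intro allI impI, rule z)
      then have "(\<Sum>j<n. l j * w j) = s / r * (\<Sum>j<n. l j * v j)" unfolding lin by simp
      then have "(\<Sum>j<n. l j * w j) = c * s" unfolding c_def by simp
      moreover have "(\<Sum>j<n. (l j - c * a m j) * w j) = (\<Sum>j<n. l j * w j) - c * s"
        unfolding s_def sum_distrib_left sum_subtractf[symmetric]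
        by (rule sum.cong) (simp_all add: left_diff_distrib)
      ultimately show "(\<Sum>j<n. (l j - c * a m j) * w j) = 0" by simp
    qed
    then obtain u where "\<forall>j<n. l j - c * a m j = (\<Sum>i<m. u i * a i j)" by blast
    then have "\<forall>j<n. l j = (\<Sum>i<Suc m. (u(m := c)) i * a i j)" by (simp add: algebra_simps)
    then show ?thesis by blast
  qed
qed

text \<open>The alternative behind the almost split property: a factorization yields the lift, a
  witness yields a splitting, for which it is scaled to \<open>l * v = 1\<close>.\<close>

lemma row_factor:
  fixes A l :: "'k::field mat"
  assumes d: "dim_row l = 1" "dim_col l = dim_col A"
  obtains (factor) u where "u \<in> carrier_mat 1 (dim_row A)" "l = u * A"
  | (witness) v where "v \<in> carrier_mat (dim_col A) 1" "A * v = 0\<^sub>m (dim_row A) 1" "l * v = 1\<^sub>m 1"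
proof (cases "\<forall>v. (\<forall>i<dim_row A. (\<Sum>j<dim_col A. A $$ (i, j) * v j) = 0) \<longrightarrow> (\<Sum>j<dim_col A. l $$ (0, j) * v j) = 0")
  case True
  then obtain u where u: "\<forall>j<dim_col A. l $$ (0, j) = (\<Sum>i<dim_row A. u i * A $$ (i, j))"
    using functional_factor[where m = "dim_row A" and n = "dim_col A" and a = "\<lambda>i j. A $$ (i, j)" and l = "\<lambda>j. l $$ (0, j)"] by blast
  let ?u = "mat 1 (dim_row A) (\<lambda>(i, j). u j)"
  have "l = ?u * A"
    by (rule eq_matI) (use u d in \<open>auto simp: scalar_prod_def lessThan_atLeast0\<close>)
  then show thesis by (intro factor[of ?u]) auto
next
  case False
  then obtain v where v: "\<And>i. i < dim_row A \<Longrightarrow> (\<Sum>j<dim_col A. A $$ (i, j) * v j) = 0"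
    and nz: "(\<Sum>j<dim_col A. l $$ (0, j) * v j) \<noteq> 0" by blast
  define c where "c = (\<Sum>j<dim_col A. l $$ (0, j) * v j)"
  let ?v = "mat (dim_col A) 1 (\<lambda>(i, j). v i / c)"
  have "A * ?v = 0\<^sub>m (dim_row A) 1"
    by (rule eq_matI) (use v in \<open>auto simp: scalar_prod_def lessThan_atLeast0 sum_divide_distrib[symmetric]\<close>)
  moreover have "l * ?v = 1\<^sub>m 1"
    by (rule eq_matI) (use d nz in \<open>auto simp: scalar_prod_def lessThan_atLeast0 sum_divide_distrib[symmetric] c_def\<close>)
  ultimately show thesis by (intro witness[of ?v]) auto
qed

lemma col_factor:
  fixes A w :: "'k::field mat"
  assumes d: "dim_col w = 1" "dim_row w = dim_row A"
  obtains (factor) u where "u \<in> carrier_mat (dim_col A) 1" "w = A * u"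
  | (witness) l where "l \<in> carrier_mat 1 (dim_row A)" "l * A = 0\<^sub>m 1 (dim_col A)" "l * w = 1\<^sub>m 1"
proof (rule row_factor[of "w\<^sup>T" "A\<^sup>T"])
  fix u assume u: "u \<in> carrier_mat 1 (dim_row A\<^sup>T)" "w\<^sup>T = u * A\<^sup>T"
  have "w = (u * A\<^sup>T)\<^sup>T" unfolding u(2)[symmetric] by simp
  also have "\<dots> = A * u\<^sup>T" using transpose_mult[of u 1 "dim_col A" "A\<^sup>T" "dim_row A"] u(1) by auto
  finally show thesis using u(1) by (intro factor[of "u\<^sup>T"]) auto
next
  fix v assume v: "v \<in> carrier_mat (dim_col A\<^sup>T) 1" "A\<^sup>T * v = 0\<^sub>m (dim_row A\<^sup>T) 1" "w\<^sup>T * v = 1\<^sub>m 1"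
  have "w \<in> carrier_mat (dim_row A) 1" using d by (intro carrier_matI)
  then have "v\<^sup>T * A = (A\<^sup>T * v)\<^sup>T" "v\<^sup>T * w = (w\<^sup>T * v)\<^sup>T"
    using transpose_mult[of "A\<^sup>T" "dim_col A" "dim_row A" v 1] transpose_mult[of "w\<^sup>T" 1 "dim_row A" v 1] v(1) by auto
  then show thesis using v by (intro witness[of "v\<^sup>T"]) auto
qed (use d in auto)

lemma mat_mult_minus:
  fixes A B C :: "'k::ring mat"
  shows "dim_row B = dim_row C \<Longrightarrow> dim_col B = dim_col C \<Longrightarrow> dim_col A = dim_row C \<Longrightarrow> A * (B - C) = A * B - A * C"
  by (rule mult_minus_distrib_mat[of _ "dim_row A" "dim_col A" _ "dim_col C"]) auto

lemma mat_minus_mult: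
  fixes A B C :: "'k::ring mat"
  shows "dim_row A = dim_row B \<Longrightarrow> dim_col A = dim_col B \<Longrightarrow> dim_col B = dim_row C \<Longrightarrow> (A - B) * C = A * C - B * C"
  by (rule minus_mult_distrib_mat[of _ "dim_row A" "dim_col A" _ _ "dim_col C"]) auto

lemma mat_minus_self: "A - A = 0\<^sub>m (dim_row A) (dim_col A)" for A :: "'k::ring mat"
  by (rule eq_matI) auto

lemma mat_minus_zero: "dim_row A = m \<Longrightarrow> dim_col A = k \<Longrightarrow> A - 0\<^sub>m m k = A" for A :: "'k::ring mat"
  by (rule eq_matI) auto

lemma short_exactD:
  assumes "short_exact n N f E g M"
  shows "is_rep n N" "is_rep n E" "is_rep n M" "f \<in> rep_hom n N E" "g \<in> rep_hom n E M"
    "mono_mor n N f" "epi_mor n E M g"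
    "1 \<le> i \<Longrightarrow> i \<le> n \<Longrightarrow> x\<in>cols E i \<Longrightarrow> g i * x = 0\<^sub>m (dimv M i) 1 \<longleftrightarrow>
       (\<exists>y\<in>cols N i. f i * y = x)"
  using assms unfolding short_exact_iff by blast+

lemma epiE:
  assumes "epi_mor n M N f" "f \<in> rep_hom n M N" "1 \<le> i" "i \<le> n" "y \<in> cols N i"
  obtains x where "x \<in> cols M i" "f i * x = y"
  using assms(1,3-5) unfolding epi_iff[OF assms(2)] by blast

text \<open>A lift of the generator of \<open>ivl a b\<close> is corrected by an element of the submodule so that it
  dies at vertex \<open>b\<close>.\<close>

lemma ext_zero_ivl:
  assumes ab: "1 \<le> a" "a < b" "b \<le> Suc n" and ne: "\<not> (a < c \<and> c \<le> b \<and> b < d)"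
  shows "ext_zero n (ivl a b :: 'k::field qrep) (ivl c d)"
  unfolding ext_zero_def
proof (intro allI impI)
  fix E :: "'k qrep" and f g assume se: "short_exact n (ivl c d) f E g (ivl a b)"
  note S = short_exactD[OF se]
  have an: "a \<le> n" using ab by simp
  note df = hom_dims[OF S(4)] and dg = hom_dims[OF S(5)] and dp = pth_dims[OF S(2) ab(1)]
  obtain v where v: "v \<in> cols E a" "g a * v = 1\<^sub>m 1"
    by (rule epiE[OF S(7,5) ab(1) an, of "1\<^sub>m 1"]) (use ab in \<open>auto simp: idim_in\<close>)
  obtain v' where v': "v' \<in> cols E a" "g a * v' = 1\<^sub>m 1"
    "b \<le> n \<Longrightarrow> pth E a (b - a) * v' = 0\<^sub>m (dimv E b) 1"
  proof (cases "b \<le> n")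
    case False
    then show ?thesis using that v by blast
  next
    case bn: True
    have b1: "1 \<le> b" using ab by simp
    let ?u = "pth E a (b - a) * v"
    have u: "?u \<in> cols E b" using dp[of "b - a"] v ab bn by auto
    have "g b * ?u = 0\<^sub>m (dimv (ivl a b :: 'k qrep) b) 1"
      by (rule zero_row_eq) (use dg[OF b1 bn] u in \<open>auto simp: idim_out\<close>)
    then obtain y where y: "y \<in> carrier_mat (idim c d b) 1" "f b * y = ?u"
      using S(8)[OF b1 bn u] by auto
    show ?thesis
    proof (cases "c \<le> b \<and> b < d")
      case False
      then have "f b * y = 0\<^sub>m (dimv E b) 1" using y df[OF b1 bn] by (simp add: inner_zero idim_out)
      then show ?thesis using that[of v] v y by simp
    next
      case True
      \<comment> \<open>The submodule is nonzero at \<open>b\<close>, so \<open>ne\<close> makes it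
        start no later than \<open>a\<close>. Its path from \<open>a\<close> to \<open>b\<close> is
        then the identity, and the coordinate \<open>y\<close> found at \<open>b\<close> also
        defines an element at \<open>a\<close>, by which \<open>v\<close> is corrected.\<close>
      then have ca: "c \<le> a" using ne by auto
      have ya: "y \<in> carrier_mat (idim c d a) 1" "f a * y \<in> cols E a"
        using y df[OF ab(1) an] True ca ab by (auto simp: idim_in)
      have "g a * (f a * y) = 0\<^sub>m 1 1"
        using S(8)[OF ab(1) an ya(2)] ya(1) ab by (auto simp: idim_in)
      then have 1: "g a * (v - f a * y) = 1\<^sub>m 1"
        using v ya df[OF ab(1) an] dg[OF ab(1) an] by (simp add: mat_mult_minus mat_minus_zero)
      have nat: "f b * pth (ivl c d) a (b - a) = pth E a (b - a) * f a"
        using pth_natural[OF ivl_rep S(2,4) ab(1), of "b - a"] ab bn by simp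
      have "f b = pth E a (b - a) * f a"
        using nat True ca ab df[OF b1 bn] by (simp add: pth_ivl idim_in right_mult_one_mat')
      then have "pth E a (b - a) * (f a * y) = ?u"
        using y(2) carrier_matD[OF ya(1)] df[OF ab(1) an] dp[of "b - a"] ab bn
        by (simp add: mat_assoc[symmetric])
      then have "pth E a (b - a) * (v - f a * y) = 0\<^sub>m (dimv E b) 1"
        using v ya df[OF ab(1) an] dp[of "b - a"] ab bn by (simp add: mat_mult_minus mat_minus_self)
      then show ?thesis using that[OF minus_carrier_mat[OF ya(2)] 1] by simp
    qed
  qed
  have hom: "from_ivl E a b v' \<in> rep_hom n (ivl a b) E"
    by (rule from_ivl_hom[OF S(2) ab v'(1) v'(3)])
  moreover have "g i * from_ivl E a b v' i = 1\<^sub>m (dimv (ivl a b :: 'k qrep) i)" if i: "1 \<le> i" "i \<le> n" for i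
  proof (cases "a \<le> i \<and> i < b")
    case False
    then show ?thesis using dg[OF i] hom_dims[OF hom i] by (intro zero_row_eq) (auto simp: idim_out)
  next
    case True
    then have "g i * pth E a (i - a) = g a"
      using pth_natural[OF S(2) ivl_rep S(5) ab(1), of "i - a"] i dg[OF ab(1) an] ab
      by (simp add: pth_ivl idim_in left_mult_one_mat')
    then have "g i * pth E a (i - a) * v' = 1\<^sub>m 1" using v' by simp
    then show ?thesis using True dg[OF i] dp[of "i - a"] i v'(1)
      by (simp add: from_ivl_def idim_in mat_assoc)
  qed
  ultimately show "split_epi n E (ivl a b) g" unfolding split_epi_iff by blast
qed

text \<open>The sequence \<open>0 \<rightarrow> ivl c d \<rightarrow> ivl a d \<oplus> ivl c b \<rightarrow> ivl a b \<rightarrow> 0\<close>.\<close>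

definition mdim :: "nat \<Rightarrow> nat \<Rightarrow> nat \<Rightarrow> nat \<Rightarrow> nat \<Rightarrow> nat" where
  "mdim a b c d i = idim a d i + idim c b i"

text \<open>Coordinate 0 belongs to \<open>ivl a d\<close>; coordinate 1 belongs to
  \<open>ivl c b\<close>, whose support lies inside that of \<open>ivl a d\<close>. Hence
  \<open>rect\<close> acts as the direct sum of the two structure maps.\<close>

definition mid :: "nat \<Rightarrow> nat \<Rightarrow> nat \<Rightarrow> nat \<Rightarrow> 'k::field qrep" where
  "mid a b c d = \<lparr> dimv = mdim a b c d, arr = (\<lambda>i. rect (mdim a b c d (Suc i)) (mdim a b c d i)) \<rparr>"

definition mid_in :: "nat \<Rightarrow> nat \<Rightarrow> nat \<Rightarrow> nat \<Rightarrow> nat \<Rightarrow> 'k::field mat" where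
  "mid_in a b c d i = mat (mdim a b c d i) (idim c d i) (\<lambda>_. 1)"

definition mid_out :: "nat \<Rightarrow> nat \<Rightarrow> nat \<Rightarrow> nat \<Rightarrow> nat \<Rightarrow> 'k::field mat" where
  "mid_out a b c d i = mat (idim a b i) (mdim a b c d i) (\<lambda>(r, s). if s = 0 then 1 else - 1)"

text \<open>With \<open>mid_sect\<close> it splits the sequence at each vertex separately; these
  maps are not compatible with the arrows and serve to check exactness.\<close>

definition mid_retr :: "nat \<Rightarrow> nat \<Rightarrow> nat \<Rightarrow> nat \<Rightarrow> nat \<Rightarrow> 'k::field mat" where
  "mid_retr a b c d i = mat (idim c d i) (mdim a b c d i) (\<lambda>(r, s). if Suc s = mdim a b c d i then 1 else 0)"

definition mid_sect :: "nat \<Rightarrow> nat \<Rightarrow> nat \<Rightarrow> nat \<Rightarrow> nat \<Rightarrow> 'k::field mat" where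
  "mid_sect a b c d i = mat (mdim a b c d i) (idim a b i) (\<lambda>(r, s). if r = 0 then 1 else 0)"

lemma mid_simps [simp]: "dimv (mid a b c d) = mdim a b c d"
  "arr (mid a b c d) i = rect (mdim a b c d (Suc i)) (mdim a b c d i)"
  by (simp_all add: mid_def)

lemma mid_rep [simp]: "is_rep n (mid a b c d)"
  unfolding is_rep_def by (intro ballI carrier_matI) simp_all

lemma mid_in_dims [simp]: "dim_row (mid_in a b c d i) = mdim a b c d i" "dim_col (mid_in a b c d i) = idim c d i"
  by (simp_all add: mid_in_def)

lemma mid_out_dims [simp]: "dim_row (mid_out a b c d i) = idim a b i" "dim_col (mid_out a b c d i) = mdim a b c d i"
  by (simp_all add: mid_out_def)

lemma set_01: "{0..<1::nat} = {0}"
  by auto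

lemma set_02: "{0..<2::nat} = {0, 1}"
  by auto

lemma mid_retr_dims [simp]: "dim_row (mid_retr a b c d i) = idim c d i" "dim_col (mid_retr a b c d i) = mdim a b c d i"
  by (simp_all add: mid_retr_def)

lemma mid_sect_dims [simp]: "dim_row (mid_sect a b c d i) = mdim a b c d i" "dim_col (mid_sect a b c d i) = idim a b i"
  by (simp_all add: mid_sect_def)

context
  fixes a b c d :: nat
  assumes abcd: "a < c" "c \<le> b" "b < d"
begin

lemma mid_in_hom: "mid_in a b c d \<in> rep_hom n (ivl c d) (mid a b c d)"
proof (rule homI)
  fix i
  show "mid_in a b c d (Suc i) * arr (ivl c d) i = arr (mid a b c d) i * mid_in a b c d i"
    using abcd by (simp add: rect_mult mult_rect, intro eq_matI)
      (auto simp: mid_in_def mdim_def idim_def split: if_splits)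
qed simp_all

lemma mid_out_hom: "mid_out a b c d \<in> rep_hom n (mid a b c d) (ivl a b)"
proof (rule homI)
  fix i
  show "mid_out a b c d (Suc i) * arr (mid a b c d) i = arr (ivl a b) i * mid_out a b c d i"
    using abcd by (simp add: rect_mult mult_rect, intro eq_matI)
      (auto simp: mid_out_def mdim_def idim_def split: if_splits)
qed simp_all

lemma mid_cases:
  obtains "mdim a b c d i = 0" "idim a b i = 0" "idim c d i = 0"
  | "mdim a b c d i = 1" "idim a b i = 1" "idim c d i = 0"
  | "mdim a b c d i = 1" "idim a b i = 0" "idim c d i = 1"
  | "mdim a b c d i = 2" "idim a b i = 1" "idim c d i = 1"
proof -
  consider "i < a" | "a \<le> i" "i < c" | "c \<le> i" "i < b" | "b \<le> i" "i < d" | "d \<le> i" by linarith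
  then show thesis by cases (rule that; use abcd in \<open>simp add: mdim_def idim_def\<close>)+
qed

lemma mid_split:
  "mid_retr a b c d i * mid_in a b c d i = (1\<^sub>m (idim c d i) :: 'k::field mat)"
  "mid_out a b c d i * mid_sect a b c d i = (1\<^sub>m (idim a b i) :: 'k::field mat)"
  "mid_out a b c d i * mid_in a b c d i = (0\<^sub>m (idim a b i) (idim c d i) :: 'k::field mat)"
  "mid_in a b c d i * mid_retr a b c d i + mid_sect a b c d i * mid_out a b c d i = (1\<^sub>m (mdim a b c d i) :: 'k::field mat)"
  by (rule mid_cases[of i]; (intro eq_matI;
      auto simp: mid_retr_def mid_sect_def mid_in_def mid_out_def scalar_prod_def set_02 less_2_cases_iff))+

end

text \<open>Exactness is tested vertex by vertex, so linear splittings suffice even for a sequence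
  that no morphism splits.\<close>

lemma short_exact_splitI:
  fixes f g :: "nat \<Rightarrow> 'k::field mat"
  assumes "is_rep n N" "is_rep n E" "is_rep n M" and f: "f \<in> rep_hom n N E" and g: "g \<in> rep_hom n E M"
    and rs: "\<And>i. dim_row (r i) = dimv N i" "\<And>i. dim_col (r i) = dimv E i"
      "\<And>i. dim_row (s i) = dimv E i" "\<And>i. dim_col (s i) = dimv M i"
    and e: "\<And>i. r i * f i = 1\<^sub>m (dimv N i)" "\<And>i. g i * s i = 1\<^sub>m (dimv M i)"
      "\<And>i. g i * f i = 0\<^sub>m (dimv M i) (dimv N i)" "\<And>i. f i * r i + s i * g i = 1\<^sub>m (dimv E i)"
  shows "short_exact n N f E g M"
proof -
  have "mono_mor n N f"
    unfolding mono_iff[OF f]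
  proof (intro allI impI ballI)
    fix i and x :: "'k mat" assume i: "1 \<le> i" "i \<le> n" and x: "x \<in> cols N i" "f i * x = 0\<^sub>m (dimv E i) 1"
    have "x = r i * (f i * x)" using x(1) hom_dims[OF f i] rs by (simp add: mat_cancel[OF e(1)])
    then show "x = 0\<^sub>m (dimv N i) 1" using x(2) rs by (simp add: mat_zero_mult)
  qed
  moreover have "epi_mor n E M g"
    unfolding epi_iff[OF g]
  proof (intro allI impI ballI)
    fix i and y :: "'k mat" assume i: "1 \<le> i" "i \<le> n" and y: "y \<in> cols M i"
    have "g i * (s i * y) = y" using y hom_dims[OF g i] rs by (simp add: mat_cancel[OF e(2)])
    moreover have "s i * y \<in> cols E i" using y rs by (intro carrier_matI) auto
    ultimately show "\<exists>x\<in>cols E i. g i * x = y" by blast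
  qed
  moreover have "g i * x = 0\<^sub>m (dimv M i) 1 \<longleftrightarrow> (\<exists>y\<in>cols N i. f i * y = x)"
    if i: "1 \<le> i" "i \<le> n" and x: "x \<in> cols E i" for i x
  proof
    note d = hom_dims[OF f i] hom_dims[OF g i] rs[of i] carrier_matD[OF x]
    assume z: "g i * x = 0\<^sub>m (dimv M i) 1"
    have "x = (f i * r i + s i * g i) * x" using d by (simp add: e left_mult_one_mat')
    also have "\<dots> = f i * r i * x + s i * g i * x"
      by (rule add_mult_distrib_mat[of _ "dimv E i" "dimv E i" _ _ 1]) (use d in auto)
    also have "\<dots> = f i * (r i * x) + 0\<^sub>m (dimv E i) 1" using d z by (simp add: mat_assoc mat_zero_mult)
    also have "\<dots> = f i * (r i * x)"
      by (rule right_add_zero_mat) (use d in \<open>auto intro!: carrier_matI\<close>)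
    finally have "f i * (r i * x) = x" by simp
    moreover have "r i * x \<in> cols N i" using d by (intro carrier_matI) auto
    ultimately show "\<exists>y\<in>cols N i. f i * y = x" by blast
  next
    note d = hom_dims[OF f i] hom_dims[OF g i]
    assume "\<exists>y\<in>cols N i. f i * y = x"
    then obtain y where y: "y \<in> cols N i" "f i * y = x" by blast
    have "g i * f i * y = 0\<^sub>m (dimv M i) 1" using y by (simp add: e mat_zero_mult)
    then show "g i * x = 0\<^sub>m (dimv M i) 1" using y d by (simp add: mat_assoc)
  qed
  ultimately show ?thesis unfolding short_exact_iff using assms(1-5) by blast
qed

text \<open>Before \<open>c\<close> the space is spanned by coordinate 0, which the arrows carry
  along up to \<open>d - 1\<close>.\<close>

lemma pth_mid:
  assumes "a \<le> i" "i < c" "i + k < d"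
  shows "pth (mid a b c d) i k = (mat (mdim a b c d (i + k)) 1 (\<lambda>(r, _). if r = 0 then 1 else 0) :: 'k::field mat)"
  using assms(3)
proof (induction k)
  case 0
  then show ?case using assms by (auto simp: mdim_def idim_def intro!: eq_matI)
next
  case (Suc k)
  then have p: "mdim a b c d (i + k) > 0" using assms by (simp add: mdim_def idim_in)
  have "pth (mid a b c d) i k = (mat (mdim a b c d (i + k)) 1 (\<lambda>(r, _). if r = 0 then 1 else 0) :: 'k mat)"
    using Suc by simp
  then show ?case using p by (auto simp: rect_mult intro!: eq_matI)
qed

context
  fixes a b c d n :: nat
  assumes abcd: "1 \<le> a" "a < c" "c \<le> b" "b < d" "d \<le> Suc n"
begin

lemma mid_exact: "short_exact n (ivl c d) (mid_in a b c d) (mid a b c d) (mid_out a b c d) (ivl a b :: 'k::field qrep)"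
  by (rule short_exact_splitI[OF ivl_rep mid_rep ivl_rep mid_in_hom[OF abcd(2-4)] mid_out_hom[OF abcd(2-4)],
        of "mid_retr a b c d" "mid_sect a b c d"])
    (simp_all add: mid_split[OF abcd(2-4)])

text \<open>A section sends the generator at \<open>a\<close> to coordinate 0. That vector is still
  alive at \<open>b\<close> because \<open>b < d\<close>, while the generator of
  \<open>ivl a b\<close> dies there.\<close>

lemma mid_not_split_epi: "\<not> split_epi n (mid a b c d) (ivl a b :: 'k::field qrep) (mid_out a b c d)"
proof
  assume "split_epi n (mid a b c d) (ivl a b :: 'k qrep) (mid_out a b c d)"
  then obtain s where s: "s \<in> rep_hom n (ivl a b :: 'k qrep) (mid a b c d)"
    "\<And>i. 1 \<le> i \<Longrightarrow> i \<le> n \<Longrightarrow> mid_out a b c d i * s i = 1\<^sub>m (idim a b i)" unfolding split_epi_iff by auto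
  have md: "mdim a b c d a = 1" "idim a b a = 1" using abcd by (auto simp: mdim_def idim_def)
  have "mid_out a b c d a = (1\<^sub>m 1 :: 'k mat)" using md by (auto simp: mid_out_def intro!: eq_matI)
  then have "s a = 1\<^sub>m 1" using s(2)[of a] md hom_dims[OF s(1), of a] abcd by (simp add: left_mult_one_mat')
  then have "pth (mid a b c d) a (b - a) * 1\<^sub>m 1 = (0\<^sub>m (mdim a b c d b) 1 :: 'k mat)"
    using hom_from_ivl_zero[OF mid_rep s(1)] abcd by simp
  then have "mat (mdim a b c d b) 1 (\<lambda>(r, _). if r = 0 then 1 else 0) = (0\<^sub>m (mdim a b c d b) 1 :: 'k mat)"
    using pth_mid[of a a c "b - a" d b, where 'k = 'k] abcd by (simp add: right_mult_one_mat')
  then have "mat (mdim a b c d b) 1 (\<lambda>(r, _). if r = 0 then 1 else 0) $$ (0, 0) = (0\<^sub>m (mdim a b c d b) 1 :: 'k mat) $$ (0, 0)"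
    by simp
  moreover have "mdim a b c d b > 0" using abcd by (simp add: mdim_def idim_in)
  ultimately show False by simp
qed

text \<open>A retraction is the identity at \<open>d - 1\<close>, yet it has to vanish on the vector
  that arrives there from \<open>c - 1\<close>, where \<open>ivl c d\<close> is zero.\<close>

lemma mid_not_split_mono: "\<not> split_mono n (ivl c d :: 'k::field qrep) (mid a b c d) (mid_in a b c d)"
proof
  assume "split_mono n (ivl c d :: 'k qrep) (mid a b c d) (mid_in a b c d)"
  then obtain r where r: "r \<in> rep_hom n (mid a b c d) (ivl c d :: 'k qrep)"
    "\<And>i. 1 \<le> i \<Longrightarrow> i \<le> n \<Longrightarrow> r i * mid_in a b c d i = 1\<^sub>m (idim c d i)" unfolding split_mono_iff by auto
  have md: "mdim a b c d (d - 1) = 1" "idim c d (d - 1) = 1" "mdim a b c d (c - 1) = 1"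
    using abcd by (auto simp: mdim_def idim_def)
  have "mid_in a b c d (d - 1) = (1\<^sub>m 1 :: 'k mat)" using md by (auto simp: mid_in_def intro!: eq_matI)
  then have "r (d - 1) = 1\<^sub>m 1" using r(2)[of "d - 1"] md hom_dims[OF r(1), of "d - 1"] abcd
    by (simp add: right_mult_one_mat')
  then have z: "1\<^sub>m 1 * pth (mid a b c d) (c - 1) (d - c) = (0\<^sub>m 1 1 :: 'k mat)"
    using hom_to_ivl_zero[OF mid_rep r(1)] abcd md by simp
  have "c - 1 + (d - c) = d - 1" using abcd by simp
  then have "pth (mid a b c d) (c - 1) (d - c) = (1\<^sub>m 1 :: 'k mat)"
    using pth_mid[of a "c - 1" c "d - c" d b, where 'k = 'k] abcd md by (auto intro!: eq_matI)
  then show False using z one_not_zero_mat[where 'k = 'k] by simp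
qed

lemma not_ext_zero_ivl: "\<not> ext_zero n (ivl a b :: 'k::field qrep) (ivl c d)"
  using mid_exact mid_not_split_epi unfolding ext_zero_def by blast

text \<open>The universal property of the direct sum in the coordinates of \<open>mid\<close>;
  \<open>costack_hom\<close> is its dual.\<close>

lemma stack_hom:
  fixes Z :: "'k::field qrep"
  assumes Z: "is_rep n Z" and K: "K1 \<in> rep_hom n Z (ivl a d)" "K2 \<in> rep_hom n Z (ivl c b)"
  shows "(\<lambda>i. mat (mdim a b c d i) (dimv Z i) (\<lambda>(r, s). if r = 0 then K1 i $$ (0, s) else K2 i $$ (0, s)))
    \<in> rep_hom n Z (mid a b c d)" (is "?S \<in> _")
proof (rule homI)
  fix i assume i: "1 \<le> i" "i < n"
  note d = rep_dims[OF Z i] hom_dims[OF K(1), of "Suc i"] hom_dims[OF K(1), of i]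
    hom_dims[OF K(2), of "Suc i"] hom_dims[OF K(2), of i]
  note c1 = hom_comm[OF K(1) i] and c2 = hom_comm[OF K(2) i]
  show "?S (Suc i) * arr Z i = arr (mid a b c d) i * ?S i"
  proof (rule eq_matI)
    fix r s assume "r < dim_row (arr (mid a b c d) i * ?S i)" "s < dim_col (arr (mid a b c d) i * ?S i)"
    then have rs: "r < mdim a b c d (Suc i)" "s < dimv Z i" by auto
    then have m: "idim a d (Suc i) = 1" using abcd by (auto simp: mdim_def idim_def split: if_splits)
    have q: "r = 1 \<and> idim c b (Suc i) = 1" if "r \<noteq> 0"
      using rs that abcd by (auto simp: mdim_def idim_def split: if_splits)
    show "(?S (Suc i) * arr Z i) $$ (r, s) = (arr (mid a b c d) i * ?S i) $$ (r, s)"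
    proof (cases "r = 0")
      case True
      have "(?S (Suc i) * arr Z i) $$ (r, s) = (K1 (Suc i) * arr Z i) $$ (0, s)"
        using rs d i m True by (simp add: scalar_prod_def)
      also have "\<dots> = (if 0 < idim a d i then K1 i $$ (0, s) else 0)"
        unfolding c1 using rs d i m by (simp add: rect_mult)
      also have "0 < idim a d i \<longleftrightarrow> 0 < mdim a b c d i" using abcd by (simp add: mdim_def idim_def)
      finally show ?thesis using rs True d i by (simp add: rect_mult)
    next
      case False
      have "(?S (Suc i) * arr Z i) $$ (r, s) = (K2 (Suc i) * arr Z i) $$ (0, s)"
        using rs d i q[OF False] by (simp add: scalar_prod_def)
      also have "\<dots> = (if 0 < idim c b i then K2 i $$ (0, s) else 0)"
        unfolding c2 using rs d i q[OF False] by (simp add: rect_mult)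
      also have "0 < idim c b i \<longleftrightarrow> 1 < mdim a b c d i" using abcd by (simp add: mdim_def idim_def)
      finally show ?thesis using rs q[OF False] d i by (simp add: rect_mult)
    qed
  qed (use d i in auto)
qed auto

lemma costack_hom:
  fixes Z :: "'k::field qrep"
  assumes Z: "is_rep n Z" and K: "K1 \<in> rep_hom n (ivl a d) Z" "K2 \<in> rep_hom n (ivl c b) Z"
  shows "(\<lambda>i. mat (dimv Z i) (mdim a b c d i) (\<lambda>(r, s). if s = 0 then K1 i $$ (r, 0) else K2 i $$ (r, 0)))
    \<in> rep_hom n (mid a b c d) Z" (is "?S \<in> _")
proof (rule homI)
  fix i assume i: "1 \<le> i" "i < n"
  note d = rep_dims[OF Z i] hom_dims[OF K(1), of "Suc i"] hom_dims[OF K(1), of i]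
    hom_dims[OF K(2), of "Suc i"] hom_dims[OF K(2), of i]
  note c1 = hom_comm[OF K(1) i, symmetric] and c2 = hom_comm[OF K(2) i, symmetric]
  show "?S (Suc i) * arr (mid a b c d) i = arr Z i * ?S i"
  proof (rule eq_matI)
    fix r s assume "r < dim_row (arr Z i * ?S i)" "s < dim_col (arr Z i * ?S i)"
    then have rs: "r < dimv Z (Suc i)" "s < mdim a b c d i" using d i by auto
    then have m: "idim a d i = 1" using abcd by (auto simp: mdim_def idim_def split: if_splits)
    have q: "s = 1 \<and> idim c b i = 1" if "s \<noteq> 0"
      using rs that abcd by (auto simp: mdim_def idim_def split: if_splits)
    show "(?S (Suc i) * arr (mid a b c d) i) $$ (r, s) = (arr Z i * ?S i) $$ (r, s)"
    proof (cases "s = 0")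
      case True
      have "(arr Z i * ?S i) $$ (r, s) = (arr Z i * K1 i) $$ (r, 0)"
        using rs d i m True by (simp add: scalar_prod_def)
      also have "\<dots> = (if 0 < idim a d (Suc i) then K1 (Suc i) $$ (r, 0) else 0)"
        unfolding c1 using rs d i m by (simp add: mult_rect)
      also have "0 < idim a d (Suc i) \<longleftrightarrow> 0 < mdim a b c d (Suc i)" using abcd by (simp add: mdim_def idim_def)
      finally show ?thesis using rs True d i by (simp add: mult_rect)
    next
      case False
      have "(arr Z i * ?S i) $$ (r, s) = (arr Z i * K2 i) $$ (r, 0)"
        using rs d i q[OF False] by (simp add: scalar_prod_def)
      also have "\<dots> = (if 0 < idim c b (Suc i) then K2 (Suc i) $$ (r, 0) else 0)"
        unfolding c2 using rs d i q[OF False] by (simp add: mult_rect)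
      also have "0 < idim c b (Suc i) \<longleftrightarrow> 1 < mdim a b c d (Suc i)" using abcd by (simp add: mdim_def idim_def)
      finally show ?thesis using rs q[OF False] d i by (simp add: mult_rect)
    qed
  qed (use d i in auto)
qed auto

end

lemma scalar_mat: "A \<in> carrier_mat 1 1 \<Longrightarrow> A = (A $$ (0,0)) \<cdot>\<^sub>m 1\<^sub>m 1" for A :: "'k::field mat"
  by (rule eq_matI) auto

section \<open>Almost split sequences of interval modules\<close>

lemma right_almost_split_ivl:
  assumes ab: "1 \<le> a" "a < b" "b \<le> n"
  shows "right_almost_split n (mid a b (Suc a) (Suc b)) (ivl a b :: 'k::field qrep) (mid_out a b (Suc a) (Suc b))"
  unfolding right_almost_split_def
proof (intro conjI allI impI ballI)
  show "\<not> split_epi n (mid a b (Suc a) (Suc b)) (ivl a b :: 'k qrep) (mid_out a b (Suc a) (Suc b))"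
    by (rule mid_not_split_epi) (use ab in auto)
  fix Z :: "'k qrep" and h assume Z: "is_rep n Z" and h: "h \<in> rep_hom n Z (ivl a b)"
    and ns: "\<not> split_epi n Z (ivl a b) h"
  note dh = hom_dims[OF h] and dp = pth_dims[OF Z]
  have an: "a \<le> n" "1 \<le> b" using ab by auto
  \<comment> \<open>An element at \<open>a\<close> that dies on the way to \<open>b\<close> and has
    value 1 under \<open>h\<close> would generate a section of \<open>h\<close>.\<close>
  have sect: False if v': "v' \<in> cols Z a" and pv': "pth Z a (b - a) * v' = 0\<^sub>m (dimv Z b) 1"
    and hv': "h a * v' = 1\<^sub>m 1" for v'
  proof -
    have s: "from_ivl Z a b v' \<in> rep_hom n (ivl a b) Z"
      by (rule from_ivl_hom[OF Z ab(1,2) _ v' pv']) (use ab in simp)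
    have "h i * from_ivl Z a b v' i = 1\<^sub>m (dimv (ivl a b :: 'k qrep) i)" if i: "1 \<le> i" "i \<le> n" for i
    proof (cases "a \<le> i \<and> i < b")
      case False
      then show ?thesis using dh[OF i] hom_dims[OF s i] by (intro zero_row_eq) (auto simp: idim_out)
    next
      case True
      then have "h i * pth Z a (i - a) = h a"
        using pth_natural[OF Z ivl_rep h ab(1), of "i - a"] i dh[OF ab(1) an(1)] ab
        by (simp add: pth_ivl idim_in left_mult_one_mat')
      then have "h i * pth Z a (i - a) * v' = 1\<^sub>m 1" using hv' by simp
      then show ?thesis using True dh[OF i] dp[OF ab(1), of "i - a"] i v'
        by (simp add: from_ivl_def idim_in mat_assoc)
    qed
    then show ?thesis using ns s unfolding split_epi_iff by blast
  qed
  have dpa: "dim_row (pth Z a (b - a)) = dimv Z b" "dim_col (pth Z a (b - a)) = dimv Z a"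
    using dp[OF ab(1), of "b - a"] ab by auto
  \<comment> \<open>By \<open>sect\<close> the functional \<open>h a\<close> vanishes on the kernel
    of the path from \<open>a\<close> to \<open>b\<close>, so it factors through \<open>Z\<close> at
    \<open>b\<close>. The factor \<open>u\<close> defines a map to the interval that is longer by
    one vertex.\<close>
  obtain u where u: "u \<in> carrier_mat 1 (dimv Z b)" "h a = u * pth Z a (b - a)"
    by (rule row_factor[of "h a" "pth Z a (b - a)"]) (use dh[OF ab(1) an(1)] ab dpa sect in \<open>auto simp: idim_in\<close>)
  let ?K1 = "to_ivl Z a (Suc b) u"
  have K1: "?K1 \<in> rep_hom n Z (ivl a (Suc b))"
  proof (rule to_ivl_hom[OF Z ab(1)])
    assume a1: "1 < a"
    have "Suc b - a = Suc (b - a)" using ab by simp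
    moreover have "pth Z (a - 1) (Suc (b - a)) = pth Z (Suc (a - 1)) (b - a) * arr Z (a - 1)"
      by (rule pth_left[OF Z]) (use a1 ab in auto)
    ultimately have "u * pth Z (a - 1) (Suc b - a) = h a * arr Z (a - 1)"
      using u dpa rep_dims[OF Z, of "a - 1"] a1 ab by (simp add: mat_assoc)
    also have "\<dots> = rect 1 0 * h (a - 1)"
      using hom_comm[OF h, of "a - 1"] a1 ab by (simp add: idim_in idim_out)
    also have "\<dots> = 0\<^sub>m 1 (dimv Z (a - 1))"
      using dh[of "a - 1"] a1 ab by (simp add: inner_zero idim_out)
    finally show "u * pth Z (a - 1) (Suc b - a) = 0\<^sub>m 1 (dimv Z (a - 1))" .
  qed (use ab u in auto)
  have K1a: "?K1 a = h a" using ab u by (simp add: to_ivl_def)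
  \<comment> \<open>The first component agrees with \<open>h\<close> at \<open>a\<close>, so the
    difference lives on the interval starting at \<open>Suc a\<close>; \<open>mid_out\<close>
    subtracts it and recovers \<open>h\<close>.\<close>
  let ?K2 = "\<lambda>i. if Suc a \<le> i \<and> i < b then ?K1 i - h i else 0\<^sub>m 0 (dimv Z i)"
  have K2: "?K2 \<in> rep_hom n Z (ivl (Suc a) b)"
  proof (rule homI)
    fix i assume i: "1 \<le> i" "i \<le> n"
    show "dim_row (?K2 i) = dimv (ivl (Suc a) b :: 'k qrep) i" "dim_col (?K2 i) = dimv Z i"
      using dh[OF i] hom_dims[OF K1 i] by (auto simp: idim_def)
  next
    fix i assume i: "1 \<le> i" "i < n"
    note d = rep_dims[OF Z i] dh[of i] dh[of "Suc i"] hom_dims[OF K1, of i] hom_dims[OF K1, of "Suc i"]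
    note c = hom_comm[OF K1 i] hom_comm[OF h i]
    consider "\<not> (a \<le> i \<and> Suc i < b)" | "a = i" "Suc i < b" | "Suc a \<le> i" "Suc i < b" by linarith
    then show "?K2 (Suc i) * arr Z i = arr (ivl (Suc a) b) i * ?K2 i"
    proof cases
      case 1
      then show ?thesis using d i by (intro zero_row_eq) (auto simp: idim_def)
    next
      case 2
      have "(?K1 (Suc i) - h (Suc i)) * arr Z i = ?K1 (Suc i) * arr Z i - h (Suc i) * arr Z i"
        by (rule mat_minus_mult) (use d i 2 in \<open>auto simp: idim_in\<close>)
      also have "\<dots> = ?K1 i - h i"
        unfolding c using 2 d i by (simp add: idim_in rect_one left_mult_one_mat')
      also have "\<dots> = 0\<^sub>m 1 (dimv Z i)" using K1a 2 d i by (simp add: mat_minus_self idim_in)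
      finally show ?thesis using 2 d i by (simp add: inner_zero idim_in idim_out)
    next
      case 3
      have "(?K1 (Suc i) - h (Suc i)) * arr Z i = ?K1 (Suc i) * arr Z i - h (Suc i) * arr Z i"
        by (rule mat_minus_mult) (use d i 3 in \<open>auto simp: idim_in\<close>)
      also have "\<dots> = ?K1 i - h i"
        using 3 d i by (simp add: c idim_in rect_one left_mult_one_mat')
      finally show ?thesis using 3 d i by (simp add: idim_in rect_one left_mult_one_mat')
    qed
  qed
  let ?S = "\<lambda>i. mat (mdim a b (Suc a) (Suc b) i) (dimv Z i) (\<lambda>(r, s). if r = 0 then ?K1 i $$ (0, s) else ?K2 i $$ (0, s))"
  have S: "?S \<in> rep_hom n Z (mid a b (Suc a) (Suc b))"
    by (rule stack_hom[OF _ _ _ _ _ Z K1 K2]) (use ab in auto)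
  have e: "mid_out a b (Suc a) (Suc b) i * ?S i = h i" if i: "1 \<le> i" "i \<le> n" for i
  proof -
    consider "\<not> (a \<le> i \<and> i < b)" | "i = a" | "Suc a \<le> i" "i < b" by linarith
    then show ?thesis
    proof cases
      case 1
      then show ?thesis using dh[OF i] by (intro zero_row_eq) (auto simp: idim_out)
    next
      case 2
      then have "mdim a b (Suc a) (Suc b) i = 1" "idim a b i = 1" using ab by (auto simp: mdim_def idim_def)
      then show ?thesis using dh[OF i] K1a 2
        by (intro eq_matI) (auto simp: mid_out_def scalar_prod_def set_01)
    next
      case 3
      then have "mdim a b (Suc a) (Suc b) i = 2" "idim a b i = 1" by (auto simp: mdim_def idim_def)
      then show ?thesis using dh[OF i] hom_dims[OF K1 i] 3
        by (intro eq_matI) (auto simp: mid_out_def scalar_prod_def set_02)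
    qed
  qed
  show "\<exists>k\<in>rep_hom n Z (mid a b (Suc a) (Suc b)). eq_mor n (comp_mor (mid_out a b (Suc a) (Suc b)) k) h"
    unfolding eq_mor_def comp_mor_def ball_1n by (rule bexI[OF _ S], intro allI impI e)
qed

lemma left_almost_split_ivl:
  assumes ab: "1 \<le> a" "a < b" "b \<le> n"
  shows "left_almost_split n (ivl (Suc a) (Suc b) :: 'k::field qrep) (mid a b (Suc a) (Suc b)) (mid_in a b (Suc a) (Suc b))"
  unfolding left_almost_split_def
proof (intro conjI allI impI ballI)
  let ?Y = "ivl (Suc a) (Suc b) :: 'k qrep"
  show "\<not> split_mono n ?Y (mid a b (Suc a) (Suc b)) (mid_in a b (Suc a) (Suc b))"
    by (rule mid_not_split_mono) (use ab in auto)
  fix Z :: "'k qrep" and h assume Z: "is_rep n Z" and h: "h \<in> rep_hom n ?Y Z"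
    and ns: "\<not> split_mono n ?Y Z h"
  note dh = hom_dims[OF h] and dp = pth_dims[OF Z]
  have an: "1 \<le> b" "1 \<le> Suc a" "Suc a \<le> n" using ab by auto
  have hb: "dim_row (h b) = dimv Z b" "dim_col (h b) = 1" using dh[OF an(1) ab(3)] ab by (auto simp: idim_in)
  have sect: False if l': "l' \<in> carrier_mat 1 (dimv Z b)" and pl': "l' * pth Z a (b - a) = 0\<^sub>m 1 (dimv Z a)"
    and lh': "l' * h b = 1\<^sub>m 1" for l'
  proof -
    have s: "to_ivl Z (Suc a) (Suc b) l' \<in> rep_hom n Z ?Y"
      by (rule to_ivl_hom[OF Z an(2)]) (use ab l' pl' in auto)
    have "to_ivl Z (Suc a) (Suc b) l' i * h i = 1\<^sub>m (dimv ?Y i)" if i: "1 \<le> i" "i \<le> n" for i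
    proof (cases "Suc a \<le> i \<and> i < Suc b")
      case False
      then show ?thesis using dh[OF i] hom_dims[OF s i] by (intro zero_row_eq) (auto simp: idim_out)
    next
      case True
      then have "h b * pth ?Y i (b - i) = pth Z i (b - i) * h i"
        using pth_natural[OF ivl_rep Z h i(1), of "b - i"] ab by simp
      then have "pth Z i (b - i) * h i = h b" using True hb by (simp add: pth_ivl right_mult_one_mat')
      then show ?thesis using True dh[OF i] dp[OF i(1), of "b - i"] ab l' lh'
        by (simp add: to_ivl_def idim_in mat_assoc)
    qed
    then show ?thesis using ns s unfolding split_mono_iff by blast
  qed
  have dpa: "dim_row (pth Z a (b - a)) = dimv Z b" "dim_col (pth Z a (b - a)) = dimv Z a"
    using dp[OF ab(1), of "b - a"] ab by auto
  \<comment> \<open>The column \<open>h b\<close> lies in the image of the path from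
    \<open>a\<close>; a functional that kills this image and has value 1 on \<open>h b\<close> would
    give a retraction.\<close>
  obtain u where u: "u \<in> cols Z a" "h b = pth Z a (b - a) * u"
    by (rule col_factor[of "h b" "pth Z a (b - a)"]) (use hb dpa sect in auto)
  let ?K1 = "from_ivl Z a (Suc b) u"
  have K1: "?K1 \<in> rep_hom n (ivl a (Suc b)) Z"
  proof (rule from_ivl_hom[OF Z ab(1) _ _ u(1)])
    assume b: "Suc b \<le> n"
    have "Suc b - a = Suc (b - a)" "a + (b - a) = b" using ab by auto
    then have "pth Z a (Suc b - a) * u = arr Z b * h b"
      using u dpa rep_dims[OF Z, of b] b ab by (simp add: mat_assoc)
    also have "\<dots> = h (Suc b) * rect 0 1"
      using hom_comm[OF h, of b] b ab by (simp add: idim_in idim_out)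
    also have "\<dots> = 0\<^sub>m (dimv Z (Suc b)) 1"
      using dh[of "Suc b"] b ab by (simp add: inner_zero idim_out)
    finally show "pth Z a (Suc b - a) * u = 0\<^sub>m (dimv Z (Suc b)) 1" .
  qed (use ab in auto)
  have K1b: "?K1 b = h b" using ab u by (simp add: from_ivl_def)
  \<comment> \<open>The sign differs from the dual argument because composing with
    \<open>mid_in\<close> adds the two components.\<close>
  let ?K2 = "\<lambda>i. if Suc a \<le> i \<and> i < b then h i - ?K1 i else 0\<^sub>m (dimv Z i) 0"
  have K2: "?K2 \<in> rep_hom n (ivl (Suc a) b) Z"
  proof (rule homI)
    fix i assume i: "1 \<le> i" "i \<le> n"
    show "dim_row (?K2 i) = dimv Z i" "dim_col (?K2 i) = dimv (ivl (Suc a) b :: 'k qrep) i"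
      using dh[OF i] hom_dims[OF K1 i] by (auto simp: idim_def)
  next
    fix i assume i: "1 \<le> i" "i < n"
    note d = rep_dims[OF Z i] dh[of i] dh[of "Suc i"] hom_dims[OF K1, of i] hom_dims[OF K1, of "Suc i"]
    note c = hom_comm[OF K1 i, symmetric] hom_comm[OF h i, symmetric]
    consider "\<not> (Suc a \<le> i \<and> i < b)" | "Suc a \<le> i" "Suc i = b" | "Suc a \<le> i" "Suc i < b" by linarith
    then show "?K2 (Suc i) * arr (ivl (Suc a) b) i = arr Z i * ?K2 i"
    proof cases
      case 1
      then show ?thesis using d i by (intro zero_col_eq) (auto simp: idim_def)
    next
      case 2
      have "arr Z i * (h i - ?K1 i) = arr Z i * h i - arr Z i * ?K1 i"
        by (rule mat_mult_minus) (use d i 2 in \<open>auto simp: idim_in\<close>)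
      also have "\<dots> = h (Suc i) - ?K1 (Suc i)"
        unfolding c using 2 d i by (simp add: idim_in rect_one right_mult_one_mat')
      also have "\<dots> = 0\<^sub>m (dimv Z (Suc i)) 1" using K1b 2 d i by (simp add: mat_minus_self idim_in)
      finally show ?thesis using 2 d i by (simp add: inner_zero idim_in idim_out)
    next
      case 3
      have "arr Z i * (h i - ?K1 i) = arr Z i * h i - arr Z i * ?K1 i"
        by (rule mat_mult_minus) (use d i 3 in \<open>auto simp: idim_in\<close>)
      also have "\<dots> = h (Suc i) - ?K1 (Suc i)"
        using 3 d i by (simp add: c idim_in rect_one right_mult_one_mat')
      finally show ?thesis using 3 d i by (simp add: idim_in rect_one right_mult_one_mat')
    qed
  qed
  let ?S = "\<lambda>i. mat (dimv Z i) (mdim a b (Suc a) (Suc b) i) (\<lambda>(r, s). if s = 0 then ?K1 i $$ (r, 0) else ?K2 i $$ (r, 0))"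
  have S: "?S \<in> rep_hom n (mid a b (Suc a) (Suc b)) Z"
    by (rule costack_hom[OF _ _ _ _ _ Z K1 K2]) (use ab in auto)
  have e: "?S i * mid_in a b (Suc a) (Suc b) i = h i" if i: "1 \<le> i" "i \<le> n" for i
  proof -
    consider "\<not> (Suc a \<le> i \<and> i < Suc b)" | "i = b" | "Suc a \<le> i" "i < b" by linarith
    then show ?thesis
    proof cases
      case 1
      then show ?thesis using dh[OF i] by (intro zero_col_eq) (auto simp: idim_out)
    next
      case 2
      then have "mdim a b (Suc a) (Suc b) i = 1" "idim (Suc a) (Suc b) i = 1" using ab by (auto simp: mdim_def idim_def)
      then show ?thesis using dh[OF i] K1b 2
        by (intro eq_matI) (auto simp: mid_in_def scalar_prod_def set_01)
    next
      case 3
      then have "mdim a b (Suc a) (Suc b) i = 2" "idim (Suc a) (Suc b) i = 1" by (auto simp: mdim_def idim_def)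
      then show ?thesis using dh[OF i] hom_dims[OF K1 i] 3
        by (intro eq_matI) (auto simp: mid_in_def scalar_prod_def set_02 idim_in)
    qed
  qed
  show "\<exists>k\<in>rep_hom n (mid a b (Suc a) (Suc b)) Z. eq_mor n (comp_mor k (mid_in a b (Suc a) (Suc b))) h"
    unfolding eq_mor_def comp_mor_def ball_1n by (rule bexI[OF _ S], intro allI impI e)
qed

lemma AR_ivl:
  assumes "1 \<le> a" "a < b" "b \<le> n"
  shows "is_AR_translate n (ivl a b :: 'k::field qrep) (ivl (Suc a) (Suc b))"
  unfolding is_AR_translate_def
  using right_almost_split_ivl[OF assms, where 'k = 'k] left_almost_split_ivl[OF assms, where 'k = 'k]
    mid_exact[of a "Suc a" b "Suc b" n, where 'k = 'k] assms by fastforce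

lemma AR_iso:
  assumes r: "is_rep n X" "is_rep n X'" "is_rep n Y" "is_rep n Y'"
    and X: "rep_iso n X X'" and Y: "rep_iso n Y Y'" and AR: "is_AR_translate n X' Y'"
  shows "is_AR_translate n X Y"
proof -
  obtain u w where 1: "iso_pair n X X' u w" using X rep_iso_iff by blast
  obtain u' w' where 2: "iso_pair n Y Y' u' w'" using Y rep_iso_iff by blast
  note D = iso_pairD[OF 1] iso_pairD[OF 2]
  obtain E f g where se: "short_exact n Y' f E g X'" and la: "left_almost_split n Y' E f" and ra: "right_almost_split n E X' g"
    using AR unfolding is_AR_translate_def by blast
  note S = short_exactD[OF se]
  have "right_almost_split n E X (comp_mor w g)"
    unfolding right_almost_split_def
  proof (intro conjI allI impI ballI)
    show "\<not> split_epi n E X (comp_mor w g)"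
      using split_epi_iso[OF S(2) r(1,2) S(5) 1] ra unfolding right_almost_split_def by blast
    fix Z h assume Z: "is_rep n Z" and h: "h \<in> rep_hom n Z X" and ns: "\<not> split_epi n Z X h"
    have uh: "comp_mor u h \<in> rep_hom n Z X'" by (rule comp_hom[OF Z r(1,2) h D(1)])
    have "\<not> split_epi n Z X' (comp_mor u h)"
      using split_epi_iso[OF Z r(2,1) h iso_pair_sym[OF 1]] ns by blast
    then obtain k where k: "k \<in> rep_hom n Z E" "eq_mor n (comp_mor g k) (comp_mor u h)"
      using ra Z uh unfolding right_almost_split_def by blast
    have "comp_mor w g i * k i = h i" if i: "1 \<le> i" "i \<le> n" for i
    proof -
      note d = hom_dims[OF D(1) i] hom_dims[OF D(2) i] hom_dims[OF S(5) i] hom_dims[OF k(1) i] hom_dims[OF h i]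
      have "g i * k i = u i * h i" using k(2) i unfolding eq_mor_def comp_mor_def by simp
      then show ?thesis using d by (simp add: comp_mor_def mat_assoc mat_cancel[OF D(3)[OF i]])
    qed
    then have "eq_mor n (comp_mor (comp_mor w g) k) h"
      unfolding eq_mor_def comp_mor_def[of _ k] ball_1n by blast
    then show "\<exists>k\<in>rep_hom n Z E. eq_mor n (comp_mor (comp_mor w g) k) h" using k(1) by blast
  qed
  moreover have "left_almost_split n Y E (comp_mor f u')"
    unfolding left_almost_split_def
  proof (intro conjI allI impI ballI)
    show "\<not> split_mono n Y E (comp_mor f u')"
      using split_mono_iso[OF S(2) r(3,4) S(4) 2] la unfolding left_almost_split_def by blast
    fix Z h assume Z: "is_rep n Z" and h: "h \<in> rep_hom n Y Z" and ns: "\<not> split_mono n Y Z h"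
    have uh: "comp_mor h w' \<in> rep_hom n Y' Z" by (rule comp_hom[OF r(4,3) Z D(6) h])
    have "\<not> split_mono n Y' Z (comp_mor h w')"
      using split_mono_iso[OF Z r(4,3) h iso_pair_sym[OF 2]] ns by blast
    then obtain k where k: "k \<in> rep_hom n E Z" "eq_mor n (comp_mor k f) (comp_mor h w')"
      using la Z uh unfolding left_almost_split_def by blast
    have "k i * comp_mor f u' i = h i" if i: "1 \<le> i" "i \<le> n" for i
    proof -
      note d = hom_dims[OF D(5) i] hom_dims[OF D(6) i] hom_dims[OF S(4) i] hom_dims[OF k(1) i] hom_dims[OF h i]
      have "k i * f i = h i * w' i" using k(2) i unfolding eq_mor_def comp_mor_def by simp
      then have "k i * f i * u' i = h i" using d D(7)[OF i] by (simp add: mat_assoc right_mult_one_mat')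
      then show ?thesis using d by (simp add: comp_mor_def mat_assoc)
    qed
    then have "eq_mor n (comp_mor k (comp_mor f u')) h"
      unfolding eq_mor_def comp_mor_def[of k] ball_1n by blast
    then show "\<exists>k\<in>rep_hom n E Z. eq_mor n (comp_mor k (comp_mor f u')) h" using k(1) by blast
  qed
  ultimately show ?thesis
    using short_exact_iso[OF se r(3,1) 2 1] unfolding is_AR_translate_def by blast
qed

section \<open>Projective covers and injective envelopes of the simple modules\<close>

lemma projective_ivl:
  assumes a: "1 \<le> a" "a \<le> n"
  shows "projective_rep n (ivl a (Suc n) :: 'k::field qrep)"
  unfolding projective_rep_def
proof (intro conjI allI impI ivl_rep)
  fix A B :: "'k qrep" and g h
  assume A: "is_rep n A" and B: "is_rep n B" and g: "g \<in> rep_hom n A B" and epi: "epi_mor n A B g"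
    and h: "h \<in> rep_hom n (ivl a (Suc n)) B"
  have "h a \<in> cols B a" using hom_dims[OF h a] a by (auto simp: idim_in)
  then obtain x where x: "x \<in> cols A a" "g a * x = h a" by (rule epiE[OF epi g a])
  let ?k = "from_ivl A a (Suc n) x"
  have k: "?k \<in> rep_hom n (ivl a (Suc n)) A" by (rule from_ivl_hom[OF A a(1) _ _ x(1)]) (use a in auto)
  have "g i * ?k i = h i" if i: "1 \<le> i" "i \<le> n" for i
  proof (cases "a \<le> i")
    case False
    then show ?thesis using hom_dims[OF g i] hom_dims[OF h i] hom_dims[OF k i]
      by (intro zero_col_eq) (auto simp: idim_out)
  next
    case True
    have "g i * (pth A a (i - a) * x) = g i * pth A a (i - a) * x"
      using True i hom_dims[OF g i] pth_dims[OF A a(1), of "i - a"] x by (simp add: mat_assoc)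
    also have "\<dots> = pth B a (i - a) * g a * x"
      using pth_natural[OF A B g a(1), of "i - a"] True i by simp
    also have "\<dots> = pth B a (i - a) * h a"
      using True i hom_dims[OF g a] pth_dims[OF B a(1), of "i - a"] x by (simp add: mat_assoc)
    also have "\<dots> = h i" by (rule hom_from_ivl[OF B h, symmetric]) (use True i a in auto)
    finally show ?thesis using True i by (simp add: from_ivl_def)
  qed
  then show "\<exists>k\<in>rep_hom n (ivl a (Suc n)) A. eq_mor n (comp_mor g k) h"
    unfolding eq_mor_def comp_mor_def ball_1n by (intro bexI[OF _ k]) blast
qed

lemma injective_ivl:
  assumes a: "1 \<le> a" "a \<le> n"
  shows "injective_rep n (ivl 1 (Suc a) :: 'k::field qrep)"
  unfolding injective_rep_def
proof (intro conjI allI impI ivl_rep)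
  fix A B :: "'k qrep" and g h
  assume A: "is_rep n A" and B: "is_rep n B" and g: "g \<in> rep_hom n A B" and mono: "mono_mor n A g"
    and h: "h \<in> rep_hom n A (ivl 1 (Suc a))"
  note dg = hom_dims[OF g a] and dh = hom_dims[OF h a]
  \<comment> \<open>Extending the functional \<open>h a\<close> along the injective
    \<open>g a\<close> is possible because the alternative in \<open>row_factor\<close> would be a
    nonzero vector in the kernel.\<close>
  obtain u where u: "u \<in> carrier_mat 1 (dimv B a)" "h a = u * g a"
  proof (rule row_factor[of "h a" "g a"])
    fix v assume v: "v \<in> carrier_mat (dim_col (g a)) 1" "g a * v = 0\<^sub>m (dim_row (g a)) 1" "h a * v = 1\<^sub>m 1"
    then have "v = 0\<^sub>m (dimv A a) 1" using mono a dg unfolding mono_iff[OF g] by simp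
    then have "h a * v = 0\<^sub>m 1 1" using dh a by (simp add: mat_zero_mult idim_in)
    then show ?thesis using v(3) one_not_zero_mat[where 'k = 'k] by simp
  qed (use dg dh a in \<open>auto simp: idim_in\<close>)
  let ?k = "to_ivl B 1 (Suc a) u"
  have k: "?k \<in> rep_hom n B (ivl 1 (Suc a))" by (rule to_ivl_hom[OF B]) (use a u in auto)
  have "?k i * g i = h i" if i: "1 \<le> i" "i \<le> n" for i
  proof (cases "i \<le> a")
    case False
    then show ?thesis using hom_dims[OF g i] hom_dims[OF h i] hom_dims[OF k i]
      by (intro zero_row_eq) (auto simp: idim_out)
  next
    case True
    note d = hom_dims[OF g i] pth_dims[OF B i(1), of "a - i"] pth_dims[OF A i(1), of "a - i"]
    have "u * pth B i (a - i) * g i = u * (pth B i (a - i) * g i)"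
      using True d a u by (simp add: mat_assoc)
    also have "\<dots> = u * (g a * pth A i (a - i))"
      using pth_natural[OF A B g i(1), of "a - i"] True a by simp
    also have "\<dots> = h a * pth A i (a - i)"
      using True d a u dg by (simp add: mat_assoc)
    also have "\<dots> = h i" using hom_to_ivl[OF A h i(1), of] True i a by simp
    finally show ?thesis using True i by (simp add: to_ivl_def)
  qed
  then show "\<exists>k\<in>rep_hom n B (ivl 1 (Suc a)). eq_mor n (comp_mor k g) h"
    unfolding eq_mor_def comp_mor_def ball_1n by (intro bexI[OF _ k]) blast
qed

lemma projective_iso:
  fixes P P' :: "'k::field qrep"
  assumes r: "is_rep n P" "is_rep n P'" and 1: "iso_pair n P P' u w" and p: "projective_rep n P"
  shows "projective_rep n P'"
  unfolding projective_rep_def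
proof (intro conjI allI impI)
  note D = iso_pairD[OF 1]
  fix A B :: "'k qrep" and g h
  assume A: "is_rep n A" and B: "is_rep n B" and g: "g \<in> rep_hom n A B" and epi: "epi_mor n A B g"
    and h: "h \<in> rep_hom n P' B"
  have hu: "comp_mor h u \<in> rep_hom n P B" by (rule comp_hom[OF r B D(1) h])
  obtain k where k: "k \<in> rep_hom n P A" "eq_mor n (comp_mor g k) (comp_mor h u)"
    using p A B g epi hu unfolding projective_rep_def by blast
  have kw: "comp_mor k w \<in> rep_hom n P' A" by (rule comp_hom[OF r(2,1) A D(2) k(1)])
  have "g i * (k i * w i) = h i" if i: "1 \<le> i" "i \<le> n" for i
  proof -
    note d = hom_dims[OF D(1) i] hom_dims[OF D(2) i] hom_dims[OF g i] hom_dims[OF k(1) i] hom_dims[OF h i]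
    have "g i * k i = h i * u i" using k(2) i unfolding eq_mor_def comp_mor_def by simp
    then have "g i * k i * w i = h i" using d D(4)[OF i] by (simp add: mat_assoc right_mult_one_mat')
    then show ?thesis using d by (simp add: mat_assoc)
  qed
  then show "\<exists>k\<in>rep_hom n P' A. eq_mor n (comp_mor g k) h"
    by (intro bexI[OF _ kw]) (simp add: eq_mor_def comp_mor_def)
qed (rule r)

lemma injective_iso:
  fixes I I' :: "'k::field qrep"
  assumes r: "is_rep n I" "is_rep n I'" and 1: "iso_pair n I I' u w" and p: "injective_rep n I"
  shows "injective_rep n I'"
  unfolding injective_rep_def
proof (intro conjI allI impI)
  note D = iso_pairD[OF 1]
  fix A B :: "'k qrep" and g h
  assume A: "is_rep n A" and B: "is_rep n B" and g: "g \<in> rep_hom n A B" and mono: "mono_mor n A g"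
    and h: "h \<in> rep_hom n A I'"
  have hu: "comp_mor w h \<in> rep_hom n A I" by (rule comp_hom[OF A r(2,1) h D(2)])
  obtain k where k: "k \<in> rep_hom n B I" "eq_mor n (comp_mor k g) (comp_mor w h)"
    using p A B g mono hu unfolding injective_rep_def by blast
  have uk: "comp_mor u k \<in> rep_hom n B I'" by (rule comp_hom[OF B r(1,2) k(1) D(1)])
  have "u i * k i * g i = h i" if i: "1 \<le> i" "i \<le> n" for i
  proof -
    note d = hom_dims[OF D(1) i] hom_dims[OF D(2) i] hom_dims[OF g i] hom_dims[OF k(1) i] hom_dims[OF h i]
    have "k i * g i = w i * h i" using k(2) i unfolding eq_mor_def comp_mor_def by simp
    then show ?thesis using d by (simp add: mat_assoc mat_cancel[OF D(4)[OF i]])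
  qed
  then show "\<exists>k\<in>rep_hom n B I'. eq_mor n (comp_mor k g) h"
    by (intro bexI[OF _ uk]) (simp add: eq_mor_def comp_mor_def)
qed (rule r)

lemma projective_ext_zero:
  assumes "projective_rep n P"
  shows "ext_zero n P N"
  unfolding ext_zero_def
proof (intro allI impI)
  fix E f g assume se: "short_exact n N f E g P"
  note S = short_exactD[OF se]
  have "id_mor P \<in> rep_hom n P P"
    by (rule homI) (auto simp: id_mor_def rep_dims[OF S(3)] left_mult_one_mat' right_mult_one_mat')
  then obtain k where "k \<in> rep_hom n P E" "eq_mor n (comp_mor g k) (id_mor P)"
    using assms S(2,3,5,7) unfolding projective_rep_def by blast
  then show "split_epi n E P g" unfolding split_epi_def by blast
qed

lemma simple_dim: "dimv (simple_rep i) j = (if j = i then 1 else 0)"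
  by (simp add: simple_rep_def)

lemma simple_rep_rep: "is_rep n (simple_rep i)"
  unfolding is_rep_def simple_rep_def by simp

lemma simple_arr_dims: "dim_row (arr (simple_rep i) j) = (if Suc j = i then 1 else 0)"
  "dim_col (arr (simple_rep i) j) = (if j = i then 1 else 0)"
  by (simp_all add: simple_rep_def)

text \<open>A map that reaches the top at \<open>a\<close> reaches the generator, and the paths from
  \<open>a\<close> carry it to every vertex of the support.\<close>

lemma projective_cover_ivl:
  assumes a: "1 \<le> a" "a \<le> n"
  shows "projective_cover n (ivl a (Suc n)) (simple_rep a :: 'k::field qrep)"
  unfolding projective_cover_def
proof (rule conjI[OF projective_ivl[OF a]])
  let ?P = "ivl a (Suc n) :: 'k qrep"
  let ?p = "\<lambda>j. mat (if j = a then 1 else 0) (idim a (Suc n) j) (\<lambda>_. 1) :: 'k mat"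
  have p: "?p \<in> rep_hom n ?P (simple_rep a)"
  proof (rule homI)
    fix i
    show "?p (Suc i) * arr ?P i = arr (simple_rep a) i * ?p i"
    proof (cases "Suc i = a")
      case True
      then show ?thesis by (intro zero_col_eq) (auto simp: simple_arr_dims idim_def)
    next
      case False
      then show ?thesis by (intro zero_row_eq) (auto simp: simple_arr_dims idim_def)
    qed
  qed (auto simp: simple_dim)
  have pa: "?p a = 1\<^sub>m 1" using a by (auto simp: idim_def intro!: eq_matI)
  have "epi_mor n ?P (simple_rep a) ?p"
    unfolding epi_iff[OF p]
  proof (intro allI impI ballI)
    fix i and y :: "'k mat" assume i: "1 \<le> i" "i \<le> n" and y: "y \<in> carrier_mat (dimv (simple_rep a :: 'k qrep) i) 1"
    show "\<exists>x\<in>cols ?P i. ?p i * x = y"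
    proof (cases "i = a")
      case True
      then show ?thesis using y a pa by (intro bexI[of _ y]) (auto simp: simple_dim idim_in)
    next
      case False
      then show ?thesis using y by (intro bexI[of _ "0\<^sub>m (dimv ?P i) 1"] zero_row_eq) (auto simp: simple_dim)
    qed
  qed
  moreover have "epi_mor n Z ?P h" if Z: "is_rep n Z" and h: "h \<in> rep_hom n Z ?P"
    and e: "epi_mor n Z (simple_rep a) (comp_mor ?p h)" for Z h
    unfolding epi_iff[OF h]
  proof (intro allI impI ballI)
    fix i and y :: "'k mat" assume i: "1 \<le> i" "i \<le> n" and y: "y \<in> cols ?P i"
    show "\<exists>x\<in>cols Z i. h i * x = y"
    proof (cases "a \<le> i")
      case False
      then show ?thesis using y hom_dims[OF h i]
        by (intro bexI[of _ "0\<^sub>m (dimv Z i) 1"] zero_row_eq) (auto simp: idim_out)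
    next
      case True
      have ph: "comp_mor ?p h \<in> rep_hom n Z (simple_rep a)"
        by (rule comp_hom[OF Z ivl_rep simple_rep_rep h p])
      have "y \<in> carrier_mat (dimv (simple_rep a :: 'k qrep) a) 1" using y True i by (simp add: simple_dim idim_in)
      then obtain x where x: "x \<in> cols Z a" "comp_mor ?p h a * x = y"
        by (rule epiE[OF e ph a])
      then have hx: "h a * x = y" using pa hom_dims[OF h a] a by (simp add: comp_mor_def idim_in left_mult_one_mat')
      have "h i * (pth Z a (i - a) * x) = y"
      proof -
        have "h i * pth Z a (i - a) = h a"
          using pth_natural[OF Z ivl_rep h a(1), of "i - a"] True i hom_dims[OF h a] a
          by (simp add: pth_ivl idim_in left_mult_one_mat')
        then show ?thesis using hx hom_dims[OF h i] pth_dims[OF Z a(1), of "i - a"] True i x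
          by (simp add: mat_assoc[symmetric])
      qed
      moreover have "pth Z a (i - a) * x \<in> cols Z i"
        using pth_dims[OF Z a(1), of "i - a"] True i x by (intro carrier_matI) auto
      ultimately show ?thesis by blast
    qed
  qed
  ultimately show "\<exists>p\<in>rep_hom n ?P (simple_rep a). epi_mor n ?P (simple_rep a) p \<and>
        (\<forall>Z. is_rep n Z \<longrightarrow> (\<forall>h\<in>rep_hom n Z ?P. epi_mor n Z (simple_rep a) (comp_mor p h) \<longrightarrow> epi_mor n Z ?P h))"
    by (intro bexI[OF _ p]) blast
qed

text \<open>The paths carry every space of the module isomorphically to the socle at
  \<open>a\<close>, so injectivity can be tested there.\<close>

lemma injective_envelope_ivl:
  assumes a: "1 \<le> a" "a \<le> n"
  shows "injective_envelope n (ivl 1 (Suc a)) (simple_rep a :: 'k::field qrep)"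
  unfolding injective_envelope_def
proof (rule conjI[OF injective_ivl[OF a]])
  let ?I = "ivl 1 (Suc a) :: 'k qrep"
  let ?e = "\<lambda>j. mat (idim 1 (Suc a) j) (if j = a then 1 else 0) (\<lambda>_. 1) :: 'k mat"
  have e: "?e \<in> rep_hom n (simple_rep a) ?I"
  proof (rule homI)
    fix i
    show "?e (Suc i) * arr (simple_rep a) i = arr ?I i * ?e i"
    proof (cases "i = a")
      case True
      then show ?thesis by (intro zero_row_eq) (auto simp: simple_arr_dims idim_def)
    next
      case False
      then show ?thesis by (intro zero_col_eq) (auto simp: simple_arr_dims idim_def)
    qed
  qed (auto simp: simple_dim)
  have ea: "?e a = 1\<^sub>m 1" using a by (auto simp: idim_def intro!: eq_matI)
  have "mono_mor n (simple_rep a) ?e"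
    unfolding mono_iff[OF e]
  proof (intro allI impI ballI)
    fix i and x :: "'k mat" assume i: "1 \<le> i" "i \<le> n" and x: "x \<in> carrier_mat (dimv (simple_rep a :: 'k qrep) i) 1"
      and z: "?e i * x = 0\<^sub>m (dimv ?I i) 1"
    show "x = 0\<^sub>m (dimv (simple_rep a :: 'k qrep) i) 1"
    proof (cases "i = a")
      case True
      then show ?thesis using x z a ea by (simp add: simple_dim idim_in)
    next
      case False
      then show ?thesis using x by (intro zero_row_eq) (auto simp: simple_dim)
    qed
  qed
  moreover have "mono_mor n ?I h" if Z: "is_rep n Z" and h: "h \<in> rep_hom n ?I Z"
    and m: "mono_mor n (simple_rep a) (comp_mor h ?e)" for Z h
    unfolding mono_iff[OF h]
  proof (intro allI impI ballI)
    fix i and x :: "'k mat" assume i: "1 \<le> i" "i \<le> n" and x: "x \<in> cols ?I i"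
      and z: "h i * x = 0\<^sub>m (dimv Z i) 1"
    show "x = 0\<^sub>m (dimv ?I i) 1"
    proof (cases "i \<le> a")
      case False
      then show ?thesis using x by (intro zero_row_eq) (auto simp: idim_out)
    next
      case True
      have he: "comp_mor h ?e \<in> rep_hom n (simple_rep a) Z"
        by (rule comp_hom[OF simple_rep_rep ivl_rep Z e h])
      have "pth Z i (a - i) * h i = h a"
        using pth_natural[OF ivl_rep Z h i(1), of "a - i"] True i hom_dims[OF h a] a
        by (simp add: pth_ivl idim_in right_mult_one_mat')
      then have "h a * x = pth Z i (a - i) * (h i * x)"
        using hom_dims[OF h i] pth_dims[OF Z i(1), of "a - i"] True a x by (simp add: mat_assoc[symmetric] idim_in)
      also have "\<dots> = 0\<^sub>m (dimv Z a) 1" unfolding z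
        using pth_dims[OF Z i(1), of "a - i"] True a by (simp add: mat_zero_mult)
      finally have "comp_mor h ?e a * x = 0\<^sub>m (dimv Z a) 1"
        using ea hom_dims[OF h a] a by (simp add: comp_mor_def idim_in right_mult_one_mat')
      moreover have "x \<in> carrier_mat (dimv (simple_rep a :: 'k qrep) a) 1" using x True i by (simp add: simple_dim idim_in)
      ultimately have "x = 0\<^sub>m (dimv (simple_rep a :: 'k qrep) a) 1" using m a unfolding mono_iff[OF he] by blast
      then show ?thesis using True i by (simp add: simple_dim idim_in)
    qed
  qed
  ultimately show "\<exists>e\<in>rep_hom n (simple_rep a) ?I. mono_mor n (simple_rep a) e \<and>
        (\<forall>Z. is_rep n Z \<longrightarrow> (\<forall>h\<in>rep_hom n ?I Z. mono_mor n (simple_rep a) (comp_mor h e) \<longrightarrow> mono_mor n ?I h))"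
    by (intro bexI[OF _ e]) blast
qed

lemma projective_cover_iso:
  fixes M P P' :: "'k::field qrep"
  assumes r: "is_rep n P" "is_rep n P'" "is_rep n M" and 1: "iso_pair n P P' u w" and c: "projective_cover n P M"
  shows "projective_cover n P' M"
proof -
  note D = iso_pairD[OF 1]
  obtain p where p: "p \<in> rep_hom n P M" "epi_mor n P M p"
    "\<And>Z h. is_rep n Z \<Longrightarrow> h \<in> rep_hom n Z P \<Longrightarrow> epi_mor n Z M (comp_mor p h) \<Longrightarrow> epi_mor n Z P h"
    using c unfolding projective_cover_def by blast
  have pw: "comp_mor p w \<in> rep_hom n P' M" by (rule comp_hom[OF r(2,1,3) D(2) p(1)])
  have "epi_mor n P' M (comp_mor p w)"
    unfolding epi_iff[OF pw]
  proof (intro allI impI ballI)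
    fix i and y :: "'k mat" assume i: "1 \<le> i" "i \<le> n" and y: "y \<in> cols M i"
    note d = hom_dims[OF D(1) i] hom_dims[OF D(2) i] hom_dims[OF p(1) i]
    obtain x where x: "x \<in> cols P i" "p i * x = y" by (rule epiE[OF p(2,1) i y])
    have "comp_mor p w i * (u i * x) = y" using d x by (simp add: comp_mor_def mat_assoc mat_cancel[OF D(3)[OF i]])
    moreover have "u i * x \<in> cols P' i" using d x by (intro carrier_matI) auto
    ultimately show "\<exists>x\<in>cols P' i. comp_mor p w i * x = y" by blast
  qed
  moreover have "epi_mor n Z P' h" if Z: "is_rep n Z" and h: "h \<in> rep_hom n Z P'"
    and e: "epi_mor n Z M (comp_mor (comp_mor p w) h)" for Z h
  proof -
    have wh: "comp_mor w h \<in> rep_hom n Z P" by (rule comp_hom[OF Z r(2,1) h D(2)])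
    have "comp_mor p (comp_mor w h) i = comp_mor (comp_mor p w) h i" if i: "1 \<le> i" "i \<le> n" for i
      using hom_dims[OF D(2) i] hom_dims[OF p(1) i] hom_dims[OF h i] by (simp add: comp_mor_def mat_assoc)
    then have "epi_mor n Z M (comp_mor p (comp_mor w h))" using e unfolding epi_mor_def by simp
    then have ewh: "epi_mor n Z P (comp_mor w h)" by (rule p(3)[OF Z wh])
    show "epi_mor n Z P' h"
      unfolding epi_iff[OF h]
    proof (intro allI impI ballI)
      fix i and y :: "'k mat" assume i: "1 \<le> i" "i \<le> n" and y: "y \<in> cols P' i"
      note d = hom_dims[OF D(1) i] hom_dims[OF D(2) i] hom_dims[OF h i]
      have "w i * y \<in> cols P i" using d y by (intro carrier_matI) auto
      then obtain x where x: "x \<in> cols Z i" "comp_mor w h i * x = w i * y" by (rule epiE[OF ewh wh i])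
      then have "u i * (w i * (h i * x)) = u i * (w i * y)" using d by (simp add: comp_mor_def mat_assoc)
      then have "h i * x = y" using d x y by (simp add: mat_cancel[OF D(4)[OF i]])
      then show "\<exists>x\<in>cols Z i. h i * x = y" using x by blast
    qed
  qed
  moreover have "projective_rep n P'" using projective_iso[OF r(1,2) 1] c unfolding projective_cover_def by blast
  ultimately show ?thesis unfolding projective_cover_def using pw by blast
qed

lemma injective_envelope_iso:
  fixes M I I' :: "'k::field qrep"
  assumes r: "is_rep n I" "is_rep n I'" "is_rep n M" and 1: "iso_pair n I I' u w" and c: "injective_envelope n I M"
  shows "injective_envelope n I' M"
proof -
  note D = iso_pairD[OF 1]
  obtain e where e: "e \<in> rep_hom n M I" "mono_mor n M e"
    "\<And>Z h. is_rep n Z \<Longrightarrow> h \<in> rep_hom n I Z \<Longrightarrow> mono_mor n M (comp_mor h e) \<Longrightarrow> mono_mor n I h"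
    using c unfolding injective_envelope_def by blast
  have ue: "comp_mor u e \<in> rep_hom n M I'" by (rule comp_hom[OF r(3,1,2) e(1) D(1)])
  have "mono_mor n M (comp_mor u e)"
    unfolding mono_iff[OF ue]
  proof (intro allI impI ballI)
    fix i and x :: "'k mat" assume i: "1 \<le> i" "i \<le> n" and x: "x \<in> cols M i"
      and z: "comp_mor u e i * x = 0\<^sub>m (dimv I' i) 1"
    note d = hom_dims[OF D(1) i] hom_dims[OF D(2) i] hom_dims[OF e(1) i]
    have "w i * (u i * (e i * x)) = w i * 0\<^sub>m (dimv I' i) 1" using d x z by (simp add: comp_mor_def mat_assoc)
    then have "e i * x = 0\<^sub>m (dimv I i) 1" using d x by (simp add: mat_cancel[OF D(3)[OF i]] mat_zero_mult)
    then show "x = 0\<^sub>m (dimv M i) 1" using e(2) i x unfolding mono_iff[OF e(1)] by blast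
  qed
  moreover have "mono_mor n I' h" if Z: "is_rep n Z" and h: "h \<in> rep_hom n I' Z"
    and m: "mono_mor n M (comp_mor h (comp_mor u e))" for Z h
  proof -
    have hu: "comp_mor h u \<in> rep_hom n I Z" by (rule comp_hom[OF r(1,2) Z D(1) h])
    have "comp_mor (comp_mor h u) e i = comp_mor h (comp_mor u e) i" if i: "1 \<le> i" "i \<le> n" for i
      using hom_dims[OF D(1) i] hom_dims[OF e(1) i] hom_dims[OF h i] by (simp add: comp_mor_def mat_assoc)
    then have "mono_mor n M (comp_mor (comp_mor h u) e)" using m unfolding mono_mor_def by simp
    then have mhu: "mono_mor n I (comp_mor h u)" by (rule e(3)[OF Z hu])
    show "mono_mor n I' h"
      unfolding mono_iff[OF h]
    proof (intro allI impI ballI)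
      fix i and x :: "'k mat" assume i: "1 \<le> i" "i \<le> n" and x: "x \<in> cols I' i"
        and z: "h i * x = 0\<^sub>m (dimv Z i) 1"
      note d = hom_dims[OF D(1) i] hom_dims[OF D(2) i] hom_dims[OF h i]
      have "comp_mor h u i * (w i * x) = 0\<^sub>m (dimv Z i) 1"
        using d x z by (simp add: comp_mor_def mat_assoc mat_cancel[OF D(4)[OF i]])
      moreover have "w i * x \<in> cols I i" using d x by (intro carrier_matI) auto
      ultimately have "w i * x = 0\<^sub>m (dimv I i) 1" using mhu i unfolding mono_iff[OF hu] by blast
      then have "u i * (w i * x) = 0\<^sub>m (dimv I' i) 1" using d by (simp add: mat_zero_mult)
      then show "x = 0\<^sub>m (dimv I' i) 1" using d x by (simp add: mat_cancel[OF D(4)[OF i]])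
    qed
  qed
  moreover have "injective_rep n I'" using injective_iso[OF r(1,2) 1] c unfolding injective_envelope_def by blast
  ultimately show ?thesis unfolding injective_envelope_def using ue by blast
qed

section \<open>Classification of the indecomposables\<close>

lemma row_cong:
  assumes "r < dim_row A" "r' < dim_row A'" "s < dim_col B" "dim_col A = dim_row B" "dim_col A' = dim_row B"
    and "\<And>m. m < dim_row B \<Longrightarrow> A $$ (r, m) = A' $$ (r', m)"
  shows "(A * B) $$ (r, s) = (A' * B) $$ (r', s)"
  using assms by (simp add: scalar_prod_def)

lemma col_cong:
  assumes "r < dim_row A" "s < dim_col B" "s' < dim_col B'" "dim_col A = dim_row B" "dim_col A = dim_row B'"
    and "\<And>m. m < dim_col A \<Longrightarrow> B $$ (m, s) = B' $$ (m, s')"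
  shows "(A * B) $$ (r, s) = (A * B') $$ (r, s')"
  using assms by (simp add: scalar_prod_def)

lemma direct_sum_dim [simp]: "dimv (direct_sum A B) i = dimv A i + dimv B i"
  by (simp add: direct_sum_def)

lemma direct_sum_rep: "is_rep n A \<Longrightarrow> is_rep n B \<Longrightarrow> is_rep n (direct_sum A B)"
  unfolding is_rep_def direct_sum_def by simp

lemma direct_sum_arr:
  assumes "is_rep n A" "is_rep n B" "1 \<le> i" "i < n" "r < dimv A (Suc i) + dimv B (Suc i)" "s < dimv A i + dimv B i"
  shows "arr (direct_sum A B) i $$ (r, s) = (if r < dimv A (Suc i) then if s < dimv A i then arr A i $$ (r, s) else 0
     else if s < dimv A i then 0 else arr B i $$ (r - dimv A (Suc i), s - dimv A i))"
  using rep_dims[OF assms(1,3,4)] rep_dims[OF assms(2,3,4)] assms(5,6)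
  by (simp add: direct_sum_def)

definition trunc :: "nat \<Rightarrow> nat \<Rightarrow> 'k::field mat" where
  "trunc m t = mat m m (\<lambda>(r, s). if r = s \<and> r < t then 1 else 0)"

lemma trunc_dims [simp]: "dim_row (trunc m t) = m" "dim_col (trunc m t) = m"
  by (simp_all add: trunc_def)

lemma trunc_mult: "dim_row X = m \<Longrightarrow> trunc m t * X = mat m (dim_col X) (\<lambda>(r, s). if r < t then X $$ (r, s) else 0)"
  by (rule eq_matI) (auto simp: trunc_def scalar_prod_def if_distrib[of "\<lambda>x. x * _"] cong: if_cong)

lemma mult_trunc: "dim_col X = m \<Longrightarrow> X * trunc m t = mat (dim_row X) m (\<lambda>(r, s). if s < t then X $$ (r, s) else 0)"
proof (rule eq_matI)
  fix r s assume d: "dim_col X = m" and "r < dim_row (mat (dim_row X) m (\<lambda>(r, s). if s < t then X $$ (r, s) else 0))"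
    "s < dim_col (mat (dim_row X) m (\<lambda>(r, s). if s < t then X $$ (r, s) else 0))"
  then have rs: "r < dim_row X" "s < m" by auto
  have "(X * trunc m t) $$ (r, s) = (\<Sum>i = 0..<m. X $$ (r, i) * (if i = s \<and> i < t then 1 else 0))"
    using rs d by (simp add: trunc_def scalar_prod_def)
  also have "\<dots> = (\<Sum>i = 0..<m. if i = s then if s < t then X $$ (r, s) else 0 else 0)"
    by (rule sum.cong) auto
  also have "\<dots> = (if s < t then X $$ (r, s) else 0)" using rs by simp
  finally show "(X * trunc m t) $$ (r, s) = mat (dim_row X) m (\<lambda>(r, s). if s < t then X $$ (r, s) else 0) $$ (r, s)"
    using rs by simp
qed auto

lemma trunc_hom:
  fixes A B :: "'k::field qrep"
  assumes "is_rep n A" "is_rep n B"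
  shows "(\<lambda>i. trunc (dimv A i + dimv B i) (dimv A i)) \<in> rep_hom n (direct_sum A B) (direct_sum A B)"
proof (rule homI)
  fix i assume i: "1 \<le> i" "i < n"
  note d = rep_dims[OF direct_sum_rep[OF assms] i]
  show "trunc (dimv A (Suc i) + dimv B (Suc i)) (dimv A (Suc i)) * arr (direct_sum A B) i =
    arr (direct_sum A B) i * trunc (dimv A i + dimv B i) (dimv A i)"
    by (rule eq_matI) (use d in \<open>simp_all add: trunc_mult mult_trunc direct_sum_arr[OF assms i]\<close>)
qed simp_all

text \<open>The projection onto a summand is an idempotent endomorphism, hence the scalar 0 or 1.\<close>

lemma indecomposable_ivl:
  assumes ab: "1 \<le> a" "a < b" "b \<le> Suc n"
  shows "indecomposable n (ivl a b :: 'k::field qrep)"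
proof -
  let ?I = "ivl a b :: 'k qrep"
  have nz: "\<not> is_zero n ?I" using ab by (auto simp: is_zero_def idim_def)
  have "is_zero n A \<or> is_zero n B"
    if A: "is_rep n A" and B: "is_rep n B" and iso: "rep_iso n ?I (direct_sum A B)" for A B
  proof (rule ccontr)
    assume "\<not> (is_zero n A \<or> is_zero n B)"
    then obtain i k where i: "1 \<le> i" "i \<le> n" "dimv A i \<noteq> 0" and k: "1 \<le> k" "k \<le> n" "dimv B k \<noteq> 0"
      unfolding is_zero_def by auto
    let ?D = "direct_sum A B"
    let ?P = "\<lambda>i. trunc (dimv A i + dimv B i) (dimv A i) :: 'k mat"
    have DS: "is_rep n ?D" by (rule direct_sum_rep[OF A B])
    have "supp n ?D = {a..<b}" unfolding iso_supp[OF iso, symmetric] by (rule ivl_supp[OF ab(1,3)])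
    moreover have "i \<in> supp n ?D" "k \<in> supp n ?D" using i k by (auto simp: supp_def)
    ultimately have ik: "a \<le> i" "i < b" "a \<le> k" "k < b" by auto
    obtain u w where 1: "iso_pair n ?I ?D u w" using iso rep_iso_iff by blast
    note D = iso_pairD[OF 1]
    let ?e = "comp_mor w (comp_mor ?P u)"
    have e: "?e \<in> rep_hom n ?I ?I"
      by (rule comp_hom[OF ivl_rep DS ivl_rep comp_hom[OF ivl_rep DS DS D(1) trunc_hom[OF A B]] D(2)])
    \<comment> \<open>The paths of \<open>ivl a b\<close> inside its support are identities, so an
      endomorphism is the same scalar at each vertex.\<close>
    have const: "?e m = ?e a" if "a \<le> m" "m < b" for m
    proof -
      have "?e m = pth ?I a (m - a) * ?e a"
        by (rule hom_from_ivl[OF ivl_rep e]) (use that ab in auto)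
      then show ?thesis using that hom_dims[OF e, of a] ab by (simp add: pth_ivl idim_in left_mult_one_mat')
    qed
    have e_def: "?e m = w m * (?P m * u m)" for m by (simp add: comp_mor_def)
    define t where "t = ?e a $$ (0, 0)"
    have et: "?e m = t \<cdot>\<^sub>m 1\<^sub>m 1" if "a \<le> m" "m < b" for m
      unfolding const[OF that] t_def using hom_dims[OF e, of a] ab
      by (intro scalar_mat carrier_matI) (simp_all add: idim_in)
    have ueP: "u m * (?e m * w m) = ?P m" if "1 \<le> m" "m \<le> n" for m
      unfolding e_def using hom_dims[OF D(1) that] hom_dims[OF D(2) that]
      by (simp add: mat_assoc mat_cancel[OF D(4)[OF that]] D(4)[OF that] right_mult_one_mat')
    have PP: "?P m * ?P m = ?P m" for m
      by (subst trunc_mult) (auto simp: trunc_def intro!: eq_matI)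
    have "?e i * ?e i = ?e i"
    proof -
      note d = hom_dims[OF D(1) i(1,2)] hom_dims[OF D(2) i(1,2)]
      have "?e i * ?e i = w i * (?P i * ?P i * u i)" unfolding e_def
        using d by (simp add: mat_assoc mat_cancel[OF D(4)[OF i(1,2)]])
      then show ?thesis unfolding PP e_def .
    qed
    then have "(t \<cdot>\<^sub>m 1\<^sub>m 1 * (t \<cdot>\<^sub>m 1\<^sub>m 1)) $$ (0, 0) = (t \<cdot>\<^sub>m 1\<^sub>m 1) $$ (0, 0)" unfolding et[OF ik(1,2)] by simp
    then have "t * t = t" by (simp add: scalar_prod_def set_01)
    \<comment> \<open>The scalar 0 contradicts \<open>A\<close> being nonzero at \<open>i\<close>,
      the scalar 1 contradicts \<open>B\<close> being nonzero at \<open>k\<close>; the two vertices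
      may differ, which is why the scalar is compared along the support.\<close>
    then consider "t = 0" | "t = 1" by auto
    then show False
    proof cases
      case 1
      have "?e i = 0\<^sub>m 1 1" unfolding et[OF ik(1,2)] 1 by (intro eq_matI) auto
      then have "?P i = u i * (0\<^sub>m 1 1 * w i)" using ueP[OF i(1,2)] by simp
      also have "\<dots> = 0\<^sub>m (dimv A i + dimv B i) (dimv A i + dimv B i)"
        using hom_dims[OF D(1) i(1,2)] hom_dims[OF D(2) i(1,2)] ik by (simp add: mat_zero_mult idim_in)
      finally have "?P i $$ (0, 0) = 0\<^sub>m (dimv A i + dimv B i) (dimv A i + dimv B i) $$ (0, 0)" by simp
      then show False using i by (simp add: trunc_def)
    next
      case 2
      have "?e k = 1\<^sub>m 1" unfolding et[OF ik(3,4)] 2 by (intro eq_matI) auto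
      then have "?P k = u k * (1\<^sub>m 1 * w k)" using ueP[OF k(1,2)] by simp
      also have "\<dots> = 1\<^sub>m (dimv A k + dimv B k)"
        using hom_dims[OF D(2) k(1,2)] ik D(4)[OF k(1,2)] by (simp add: left_mult_one_mat' idim_in)
      finally have "?P k $$ (dimv A k, dimv A k) = 1\<^sub>m (dimv A k + dimv B k) $$ (dimv A k, dimv A k)" by simp
      then show False using k by (simp add: trunc_def)
    qed
  qed
  then show ?thesis using nz unfolding indecomposable_def by simp
qed

text \<open>Since \<open>R\<close> has value 1 on \<open>S\<close>, the vector \<open>S\<close>
  extends to a basis by vectors in the kernel of \<open>R\<close>; \<open>W\<close> has this basis
  as columns and \<open>U\<close> the dual basis as rows.\<close>

lemma adapted_basis:
  fixes R S :: "'k::field mat"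
  assumes R: "R \<in> carrier_mat 1 d" and S: "S \<in> carrier_mat d 1" and RS: "R * S = 1\<^sub>m 1"
  obtains U W where "U \<in> carrier_mat d d" "W \<in> carrier_mat d d" "U * W = 1\<^sub>m d" "W * U = 1\<^sub>m d" "d > 0"
    "\<And>c. c < d \<Longrightarrow> U $$ (0, c) = R $$ (0, c)" "\<And>r. r < d \<Longrightarrow> W $$ (r, 0) = S $$ (r, 0)"
proof -
  define x y where "x i = R $$ (0, i)" and "y i = S $$ (i, 0)" for i
  have "(R * S) $$ (0, 0) = 1" unfolding RS by simp
  then have xy: "(\<Sum>i<d. x i * y i) = 1" using R S by (simp add: scalar_prod_def lessThan_atLeast0 x_def y_def)
  have "\<exists>t<d. x t \<noteq> 0"
  proof (rule ccontr)
    assume "\<not> ?thesis"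
    then have "(\<Sum>i<d. x i * y i) = 0" by (intro sum.neutral) auto
    then show False using xy by simp
  qed
  then obtain t where t: "t < d" "x t \<noteq> 0" by blast
  \<comment> \<open>The numbers 1 to \<open>d - 1\<close> enumerate the indices other than
    \<open>t\<close>; 0 is kept for the distinguished vector.\<close>
  define sk where "sk j = (if j \<le> t then j - 1 else j)" for j
  have sk: "sk j < d" "sk j \<noteq> t" if "0 < j" "j < d" for j using that t(1) by (auto simp: sk_def)
  have sk_inj: "sk j = sk l \<longleftrightarrow> j = l" if "0 < j" "0 < l" for j l using that by (auto simp: sk_def)
  \<comment> \<open>Beyond index 0, the rows of \<open>U\<close> are coordinate functionals
    corrected to vanish on \<open>y\<close>, and the columns of \<open>W\<close> are unit vectors
    corrected along unit vector \<open>t\<close> to lie in the kernel of \<open>x\<close>.\<close>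
  define U where "U = mat d d (\<lambda>(j, i). if j = 0 then x i else (if i = sk j then 1 else 0) - y (sk j) * x i)"
  define W where "W = mat d d (\<lambda>(i, l). if l = 0 then y i else if i = t then - x (sk l) / x t else if i = sk l then 1 else 0)"
  have xW: "(\<Sum>i<d. x i * W $$ (i, l)) = (if l = 0 then 1 else 0)" if l: "l < d" for l
  proof (cases "l = 0")
    case True
    then show ?thesis using l xy by (simp add: W_def)
  next
    case False
    have "x i * W $$ (i, l) = (if i = t then - x (sk l) else 0) + (if i = sk l then x (sk l) else 0)" if "i < d" for i
      using that l False sk[of l] t by (simp add: W_def)
    then have "(\<Sum>i<d. x i * W $$ (i, l)) =
        (\<Sum>i<d. (if i = t then - x (sk l) else 0) + (if i = sk l then x (sk l) else 0))"
      by (intro sum.cong) auto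
    also have "\<dots> = 0" using t sk[of l] l False by (simp add: sum.distrib)
    finally show ?thesis using False by simp
  qed
  have dUW: "dim_row U = d" "dim_col U = d" "dim_row W = d" "dim_col W = d" by (simp_all add: U_def W_def)
  have UW: "U * W = 1\<^sub>m d"
  proof (rule eq_matI)
    fix j l assume "j < dim_row (1\<^sub>m d :: 'k mat)" "l < dim_col (1\<^sub>m d :: 'k mat)"
    then have jl: "j < d" "l < d" by auto
    have e: "(U * W) $$ (j, l) = (\<Sum>i<d. U $$ (j, i) * W $$ (i, l))"
      using jl dUW by (simp add: scalar_prod_def lessThan_atLeast0)
    show "(U * W) $$ (j, l) = 1\<^sub>m d $$ (j, l)"
    proof (cases "j = 0")
      case True
      then show ?thesis unfolding e using xW[OF jl(2)] jl by (simp add: U_def)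
    next
      case False
      have "(\<Sum>i<d. U $$ (j, i) * W $$ (i, l)) =
          (\<Sum>i<d. (if i = sk j then W $$ (sk j, l) else 0) - y (sk j) * (x i * W $$ (i, l)))"
        using jl False by (intro sum.cong) (auto simp: U_def algebra_simps)
      also have "\<dots> = W $$ (sk j, l) - y (sk j) * (\<Sum>i<d. x i * W $$ (i, l))"
        using sk[of j] False jl by (simp add: sum_subtractf sum_distrib_left)
      also have "\<dots> = (if j = l then 1 else 0)"
        unfolding xW[OF jl(2)] using sk[of j] sk_inj[of j l] False jl by (auto simp: W_def)
      finally show ?thesis unfolding e using jl by simp
    qed
  qed (auto simp: U_def W_def)
  have UWc: "U \<in> carrier_mat d d" "W \<in> carrier_mat d d" by (auto simp: U_def W_def)
  show thesis
    by (rule that[OF UWc UW mat_mult_left_right_inverse[OF UWc UW]])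
      (use t in \<open>auto simp: U_def W_def x_def y_def\<close>)
qed

text \<open>A longest nonzero path, from \<open>a\<close> to \<open>a + k\<close>, splits off the interval module \<open>ivl a (a + k + 1)\<close>.\<close>

lemma indecomposable_is_ivl:
  fixes M :: "'k::field qrep"
  assumes ind: "indecomposable n M"
  obtains a b where "1 \<le> a" "a < b" "b \<le> Suc n" "rep_iso n M (ivl a b)"
proof -
  have M: "is_rep n M" and nz: "\<not> is_zero n M" using ind by (auto simp: indecomposable_def)
  let ?z = "\<lambda>a k. 0\<^sub>m (dimv M (a + k)) (dimv M a) :: 'k mat"
  let ?T = "{(a, k). 1 \<le> a \<and> a + k \<le> n \<and> pth M a k \<noteq> ?z a k}"
  obtain i0 where i0: "1 \<le> i0" "i0 \<le> n" "dimv M i0 \<noteq> 0" using nz unfolding is_zero_def by auto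
  have "(1\<^sub>m (dimv M i0) :: 'k mat) \<noteq> 0\<^sub>m (dimv M i0) (dimv M i0)"
  proof
    assume "(1\<^sub>m (dimv M i0) :: 'k mat) = 0\<^sub>m (dimv M i0) (dimv M i0)"
    then have "(1\<^sub>m (dimv M i0) :: 'k mat) $$ (0, 0) = 0\<^sub>m (dimv M i0) (dimv M i0) $$ (0, 0)" by simp
    then show False using i0 by simp
  qed
  then have mem: "(i0, 0) \<in> ?T" using i0 by simp
  have "finite ?T" by (rule finite_subset[of _ "{0..n} \<times> {0..n}"]) auto
  then obtain ak where ak: "ak \<in> ?T" "\<And>bl. bl \<in> ?T \<Longrightarrow> snd bl \<le> snd ak"
    using finite_ex_greatest[of ?T "(i0, 0)" snd] mem by blast
  obtain a k where "ak = (a, k)" by (cases ak)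
  with ak have a: "1 \<le> a" "a + k \<le> n" "pth M a k \<noteq> ?z a k"
    and mx: "\<And>b l. (b, l) \<in> ?T \<Longrightarrow> l \<le> k" by auto
  \<comment> \<open>The length is maximal over all starting points, so the paths of length
    \<open>k + 1\<close> from \<open>a\<close> and from \<open>a - 1\<close> both vanish. These are
    the conditions for \<open>from_ivl_hom\<close> and \<open>to_ivl_hom\<close>.\<close>
  have long: "pth M b (Suc k) = ?z b (Suc k)" if "1 \<le> b" "b + Suc k \<le> n" for b
    using mx[of b "Suc k"] that by fastforce
  define b where "b = Suc (a + k)"
  have ab: "a < b" "b \<le> Suc n" "b - a = Suc k" "b - 1 = a + k" using a by (auto simp: b_def)
  note dp = pth_dims[OF M]
  obtain r0 c0 where rc: "r0 < dimv M (a + k)" "c0 < dimv M a" "pth M a k $$ (r0, c0) \<noteq> 0"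
    using a(3) dp[OF a(1,2)] by (metis eq_matI index_zero_mat)
  define x where "x = pth M a k $$ (r0, c0)"
  \<comment> \<open>The nonzero matrix entry \<open>x\<close> is picked out by a unit vector and a
    coordinate functional, scaled so that the composite is 1.\<close>
  define v :: "'k mat" where "v = mat (dimv M a) 1 (\<lambda>(i, _). if i = c0 then 1 else 0)"
  define l :: "'k mat" where "l = mat 1 (dimv M (a + k)) (\<lambda>(_, j). if j = r0 then inverse x else 0)"
  have v: "v \<in> cols M a" and l: "l \<in> carrier_mat 1 (dimv M (a + k))" by (auto simp: v_def l_def)
  have pv: "(pth M a k * v) $$ (r0, 0) = x"
    using rc dp[OF a(1,2)] by (simp add: v_def scalar_prod_def x_def if_distrib[of "\<lambda>y. _ * y"] cong: if_cong)
  have lpv: "l * (pth M a k * v) = 1\<^sub>m 1"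
  proof (rule eq_matI)
    fix i j assume "i < dim_row (1\<^sub>m 1 :: 'k mat)" "j < dim_col (1\<^sub>m 1 :: 'k mat)"
    then have ij: "i = 0" "j = 0" by auto
    have "(l * (pth M a k * v)) $$ (0, 0) = (\<Sum>m = 0..<dimv M (a + k). l $$ (0, m) * (pth M a k * v) $$ (m, 0))"
      using l v dp[OF a(1,2)] by (subst index_mult_mat(1)) (auto simp: scalar_prod_def simp del: index_mult_mat(1))
    also have "\<dots> = (\<Sum>m = 0..<dimv M (a + k). if m = r0 then inverse x * (pth M a k * v) $$ (r0, 0) else 0)"
      by (rule sum.cong) (auto simp: l_def simp del: index_mult_mat(1))
    also have "\<dots> = 1" using rc pv by (simp add: x_def del: index_mult_mat(1))
    finally show "(l * (pth M a k * v)) $$ (i, j) = 1\<^sub>m 1 $$ (i, j)" using ij by simp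
  qed (use l v in auto)
  define S where "S = from_ivl M a b v"
  define R where "R = to_ivl M a b l"
  have Sh: "S \<in> rep_hom n (ivl a b) M" unfolding S_def
  proof (rule from_ivl_hom[OF M a(1) ab(1,2) v])
    assume "b \<le> n"
    then have "pth M a (Suc k) = ?z a (Suc k)" by (intro long a) (use ab in auto)
    moreover have "a + Suc k = b" by (simp add: b_def)
    ultimately show "pth M a (b - a) * v = 0\<^sub>m (dimv M b) 1" using v unfolding ab(3) by (simp add: mat_zero_mult del: pth.simps)
  qed
  have Rh: "R \<in> rep_hom n M (ivl a b)" unfolding R_def
  proof (rule to_ivl_hom[OF M a(1) ab(1,2)])
    assume "1 < a"
    then have "pth M (a - 1) (Suc k) = ?z (a - 1) (Suc k)" "a - 1 + Suc k = a + k" using long[of "a - 1"] a by auto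
    then show "l * pth M (a - 1) (b - a) = 0\<^sub>m 1 (dimv M (a - 1))" using l unfolding ab(3) by (simp add: mat_zero_mult del: pth.simps)
  qed (use l ab in simp)
  note dR = hom_dims[OF Rh] and dS = hom_dims[OF Sh]
  have RS: "R i * S i = 1\<^sub>m 1" if i: "a \<le> i" "i < b" for i
  proof -
    have i1: "1 \<le> i" "b - 1 - i + i = a + k" "i + (b - 1 - i) = a + k" "i \<le> n" using i a by (auto simp: b_def)
    have "pth M a ((i - a) + (b - 1 - i)) = pth M (a + (i - a)) (b - 1 - i) * pth M a (i - a)"
      by (rule pth_add[OF M a(1)]) (use i a in \<open>auto simp: b_def\<close>)
    moreover have "(i - a) + (b - 1 - i) = k" "a + (i - a) = i" using i by (auto simp: b_def)
    ultimately have p: "pth M a k = pth M i (b - 1 - i) * pth M a (i - a)" by simp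
    have "R i * S i = l * pth M i (b - 1 - i) * (pth M a (i - a) * v)"
      using i by (simp add: R_def S_def from_ivl_def to_ivl_def)
    also have "\<dots> = l * (pth M a k * v)" unfolding p
      using l v dp[OF i1(1), of "b - 1 - i"] dp[OF a(1), of "i - a"] i1 a i(1) unfolding i1(3)
      by (simp add: mat_assoc del: diff_diff_left)
    finally show ?thesis unfolding lpv .
  qed
  let ?e = "idim a b"
  \<comment> \<open>Bases adapted to \<open>R\<close> and \<open>S\<close> on the interval,
    arbitrary ones elsewhere. Off \<open>{1..n}\<close> the predicate is vacuous, so that the choice
    can be made for all \<open>i\<close>.\<close>
  define P where "P i U W \<longleftrightarrow> (1 \<le> i \<longrightarrow> i \<le> n \<longrightarrow> U \<in> carrier_mat (dimv M i) (dimv M i) \<and> W \<in> carrier_mat (dimv M i) (dimv M i) \<and>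
      U * W = 1\<^sub>m (dimv M i) \<and> W * U = 1\<^sub>m (dimv M i) \<and> ?e i \<le> dimv M i \<and>
      (?e i = 1 \<longrightarrow> (\<forall>c<dimv M i. U $$ (0, c) = R i $$ (0, c)) \<and> (\<forall>r<dimv M i. W $$ (r, 0) = S i $$ (r, 0))))"
    for i and U W :: "'k mat"
  have ex: "\<exists>U W. P i U W" for i
  proof (cases "1 \<le> i \<and> i \<le> n \<and> a \<le> i \<and> i < b")
    case True
    then have i: "1 \<le> i" "i \<le> n" and e: "?e i = 1" by (auto simp: idim_in)
    have c: "R i \<in> carrier_mat 1 (dimv M i)" "S i \<in> cols M i"
      using dR[OF i] dS[OF i] e by (auto intro!: carrier_matI)
    obtain U W where "U \<in> carrier_mat (dimv M i) (dimv M i)" "W \<in> carrier_mat (dimv M i) (dimv M i)"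
      "U * W = 1\<^sub>m (dimv M i)" "W * U = 1\<^sub>m (dimv M i)" "dimv M i > 0"
      "\<And>c. c < dimv M i \<Longrightarrow> U $$ (0, c) = R i $$ (0, c)" "\<And>r. r < dimv M i \<Longrightarrow> W $$ (r, 0) = S i $$ (r, 0)"
      using adapted_basis[OF c RS] True by blast
    then have "P i U W" using e unfolding P_def by simp
    then show ?thesis by blast
  next
    case False
    then have "P i (1\<^sub>m (dimv M i)) (1\<^sub>m (dimv M i))" unfolding P_def by (auto simp: idim_def)
    then show ?thesis by blast
  qed
  obtain U where "\<forall>i. \<exists>W. P i (U i) W" using choice[of "\<lambda>i U. \<exists>W. P i U W"] ex by blast
  then obtain W where PW: "\<And>i. P i (U i) (W i)" using choice[of "\<lambda>i W. P i (U i) W"] by blast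
  have UW: "\<And>i. 1 \<le> i \<Longrightarrow> i \<le> n \<Longrightarrow> U i \<in> carrier_mat (dimv M i) (dimv M i)"
      "\<And>i. 1 \<le> i \<Longrightarrow> i \<le> n \<Longrightarrow> W i \<in> carrier_mat (dimv M i) (dimv M i)"
      "\<And>i. 1 \<le> i \<Longrightarrow> i \<le> n \<Longrightarrow> U i * W i = 1\<^sub>m (dimv M i)" "\<And>i. 1 \<le> i \<Longrightarrow> i \<le> n \<Longrightarrow> W i * U i = 1\<^sub>m (dimv M i)"
      "\<And>i. 1 \<le> i \<Longrightarrow> i \<le> n \<Longrightarrow> ?e i \<le> dimv M i"
    and UR: "\<And>i c. 1 \<le> i \<Longrightarrow> i \<le> n \<Longrightarrow> ?e i = 1 \<Longrightarrow> c < dimv M i \<Longrightarrow> U i $$ (0, c) = R i $$ (0, c)"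
    and WS: "\<And>i r. 1 \<le> i \<Longrightarrow> i \<le> n \<Longrightarrow> ?e i = 1 \<Longrightarrow> r < dimv M i \<Longrightarrow> W i $$ (r, 0) = S i $$ (r, 0)"
    using PW unfolding P_def by blast+
  note dU = carrier_matD[OF UW(1)] and dW = carrier_matD[OF UW(2)]
  \<comment> \<open>The arrows in the new bases. They turn out block diagonal, with coordinate 0 on
    the interval as one block and \<open>C\<close> as the other.\<close>
  define X where "X i = U (Suc i) * arr M i * W i" for i
  define C :: "'k qrep" where "C = \<lparr> dimv = (\<lambda>i. dimv M i - ?e i),
    arr = (\<lambda>i. mat (dimv M (Suc i) - ?e (Suc i)) (dimv M i - ?e i) (\<lambda>(r, s). X i $$ (r + ?e (Suc i), s + ?e i))) \<rparr>"
  have C: "is_rep n C" by (auto simp: is_rep_def C_def)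
  have dimC: "dimv C i = dimv M i - ?e i" for i by (simp add: C_def)
  let ?D = "direct_sum (ivl a b) C"
  have D: "is_rep n ?D" by (rule direct_sum_rep[OF ivl_rep C])
  have dimD: "dimv ?D i = dimv M i" if "1 \<le> i" "i \<le> n" for i using UW(5)[OF that] by (simp add: dimC)
  have X: "arr ?D i = X i" if i: "1 \<le> i" "i < n" for i
  proof -
    have j: "1 \<le> Suc i" "Suc i \<le> n" "i \<le> n" using i by auto
    note d = rep_dims[OF M i] dU[OF i(1) j(3)] dU[OF j(1,2)] dW[OF i(1) j(3)] dW[OF j(1,2)]
      dR[OF i(1) j(3)] dR[OF j(1,2)] dS[OF i(1) j(3)] dS[OF j(1,2)] UW(5)[OF i(1) j(3)] UW(5)[OF j(1,2)]
    have dX: "dim_row (X i) = dimv M (Suc i)" "dim_col (X i) = dimv M i" using d by (auto simp: X_def)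
    show ?thesis
    proof (rule eq_matI)
      fix r s assume "r < dim_row (X i)" "s < dim_col (X i)"
      then have rs: "r < dimv M (Suc i)" "s < dimv M i" using dX by auto
      have as: "arr ?D i $$ (r, s) = (if r < ?e (Suc i) then if s < ?e i then 1 else 0
         else if s < ?e i then 0 else X i $$ (r, s))"
      proof -
        have "arr ?D i $$ (r, s) = (if r < ?e (Suc i) then if s < ?e i then rect (?e (Suc i)) (?e i) $$ (r, s) else 0
         else if s < ?e i then 0 else arr C i $$ (r - ?e (Suc i), s - ?e i))"
          using direct_sum_arr[OF ivl_rep C i, where r = r and s = s] rs UW(5)[OF i(1) j(3)] UW(5)[OF j(1,2)]
          by (simp add: dimC)
        moreover have "rect (?e (Suc i)) (?e i) $$ (r, s) = (1 :: 'k)" if "r < ?e (Suc i)" "s < ?e i"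
          using that by (auto simp: rect_def idim_def split: if_splits)
        moreover have "arr C i $$ (r - ?e (Suc i), s - ?e i) = X i $$ (r, s)" if "\<not> r < ?e (Suc i)" "\<not> s < ?e i"
          using that rs by (simp add: C_def)
        ultimately show ?thesis by simp
      qed
      \<comment> \<open>Row 0 of \<open>U\<close> is \<open>R\<close>, which commutes with the
        arrows, so this row comes from row 0 of \<open>U i * W i\<close>, the identity.\<close>
      have row: "X i $$ (r, s) = (if s < ?e i then 1 else 0)" if "r < ?e (Suc i)"
      proof -
        have r0: "r = 0" "?e (Suc i) = 1" using that by (auto simp: idim_def split: if_splits)
        have "X i = U (Suc i) * (arr M i * W i)" using d by (simp add: X_def mat_assoc)
        also have "\<dots> $$ (r, s) = (R (Suc i) * (arr M i * W i)) $$ (0, s)"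
          by (rule row_cong) (use rs d r0 UR[OF j(1,2) r0(2)] in auto)
        also have "R (Suc i) * (arr M i * W i) = rect 1 (?e i) * (R i * W i)"
          using d r0 hom_comm[OF Rh i] by (simp add: mat_assoc[symmetric])
        also have "\<dots> $$ (0, s) = (if s < ?e i then 1 else 0)"
        proof (cases "?e i = 1")
          case True
          have "(R i * W i) $$ (0, s) = (U i * W i) $$ (0, s)"
            by (rule row_cong) (use rs d True UR[OF i(1) j(3) True] in auto)
          then show ?thesis using rs d True UW(3)[OF i(1) j(3)] by (simp add: rect_mult)
        next
          case False
          then have "?e i = 0" by (simp add: idim_def split: if_splits)
          then show ?thesis using rs d by (simp add: rect_mult)
        qed
        finally show ?thesis .
      qed
      \<comment> \<open>Column 0 of \<open>W\<close> is \<open>S\<close>, which commutes with the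
        arrows, so this column comes from column 0 of \<open>U (Suc i) * W (Suc i)\<close>.\<close>
      have col: "X i $$ (r, s) = 0" if "\<not> r < ?e (Suc i)" "s < ?e i"
      proof -
        have s0: "s = 0" "?e i = 1" using that by (auto simp: idim_def split: if_splits)
        have "X i $$ (r, s) = (U (Suc i) * arr M i * S i) $$ (r, 0)" unfolding X_def
          by (rule col_cong) (use rs d s0 WS[OF i(1) j(3) s0(2)] in auto)
        also have "U (Suc i) * arr M i * S i = U (Suc i) * S (Suc i) * rect (?e (Suc i)) 1"
          using d s0 hom_comm[OF Sh i] by (simp add: mat_assoc)
        also have "\<dots> $$ (r, 0) = 0"
        proof (cases "?e (Suc i) = 1")
          case True
          have "(U (Suc i) * S (Suc i)) $$ (r, 0) = (U (Suc i) * W (Suc i)) $$ (r, 0)"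
            by (rule col_cong) (use rs d True WS[OF j(1,2) True] in auto)
          also have "\<dots> = 0" using rs UW(3)[OF j(1,2)] that True by simp
          finally show ?thesis using rs d True by (simp add: mult_rect)
        next
          case False
          then have "?e (Suc i) = 0" by (simp add: idim_def split: if_splits)
          then show ?thesis using rs d by (simp add: mult_rect)
        qed
        finally show ?thesis .
      qed
      show "arr ?D i $$ (r, s) = X i $$ (r, s)" unfolding as using row col by simp
    next
      show "dim_row (arr ?D i) = dim_row (X i)" "dim_col (arr ?D i) = dim_col (X i)"
        using rep_dims[OF D i] dX dimD[OF i(1) j(3)] dimD[OF j(1,2)] by simp_all
    qed
  qed
  have "iso_pair n M ?D U W"
    unfolding iso_pair_def
  proof (intro conjI allI impI)
    show "U \<in> rep_hom n M ?D"
    proof (rule homI)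
      fix i assume i: "1 \<le> i" "i < n"
      then have j: "1 \<le> Suc i" "Suc i \<le> n" "i \<le> n" by auto
      show "U (Suc i) * arr M i = arr ?D i * U i"
        unfolding X[OF i] X_def using rep_dims[OF M i] dU[OF i(1) j(3)] dU[OF j(1,2)] dW[OF i(1) j(3)] UW(4)[OF i(1) j(3)]
        by (simp add: mat_assoc right_mult_one_mat')
    qed (use dU dimD in simp_all)
    show "W \<in> rep_hom n ?D M"
    proof (rule homI)
      fix i assume i: "1 \<le> i" "i < n"
      then have j: "1 \<le> Suc i" "Suc i \<le> n" "i \<le> n" by auto
      show "W (Suc i) * arr ?D i = arr M i * W i"
        unfolding X[OF i] X_def using rep_dims[OF M i] dW[OF i(1) j(3)] dW[OF j(1,2)] dU[OF j(1,2)]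
        by (simp add: mat_assoc mat_cancel[OF UW(4)[OF j(1,2)]])
    qed (use dW dimD in simp_all)
  qed (use UW(3,4) dimD in simp_all)
  then have "is_zero n (ivl a b :: 'k qrep) \<or> is_zero n C"
    using ind C ivl_rep rep_iso_iff unfolding indecomposable_def by blast
  moreover have "\<not> is_zero n (ivl a b :: 'k qrep)"
    using a ab by (auto simp: is_zero_def idim_def)
  ultimately have "is_zero n C" by blast
  then have small: "dimv M i = ?e i" if "1 \<le> i" "i \<le> n" for i
  proof -
    have "dimv C i = 0" using \<open>is_zero n C\<close> that unfolding is_zero_def ball_1n by blast
    then show ?thesis using UW(5)[OF that] by (simp add: dimC)
  qed
  have "iso_pair n M (ivl a b) R S"
    unfolding iso_pair_def
  proof (intro conjI allI impI Rh Sh)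
    fix i assume i: "1 \<le> i" "i \<le> n"
    note d = dR[OF i] dS[OF i] small[OF i]
    show "R i * S i = 1\<^sub>m (dimv (ivl a b :: 'k qrep) i)"
    proof (cases "a \<le> i \<and> i < b")
      case True then show ?thesis using RS by (simp add: idim_in)
    next
      case False then show ?thesis using d by (intro zero_row_eq) (auto simp: idim_out)
    qed
    show "S i * R i = 1\<^sub>m (dimv M i)"
    proof (cases "a \<le> i \<and> i < b")
      case True
      then have e: "?e i = 1" by (simp add: idim_in)
      have "U i = R i" "W i = S i"
        using UR[OF i e] WS[OF i e] d e dU[OF i] dW[OF i] by (auto intro!: eq_matI)
      then show ?thesis using UW(4)[OF i] by simp
    next
      case False then show ?thesis using d by (intro zero_row_eq) (auto simp: idim_out)
    qed
  qed
  then show thesis using that[OF a(1) ab(1,2)] rep_iso_iff by blast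
qed

section \<open>Exceptional sequences as sequences of chords\<close>

abbreviation iv :: "nat \<times> nat \<Rightarrow> 'k::field qrep" where
  "iv s \<equiv> ivl (fst s) (snd s)"

lemma vanishing_iff_exc:
  assumes "chord_of (Suc n) s" "chord_of (Suc n) t"
  shows "hom_zero n (iv t) (iv s :: 'k::field qrep) \<and> ext_zero n (iv t) (iv s :: 'k qrep) \<longleftrightarrow> exc s t"
proof -
  have h: "hom_zero n (iv t) (iv s :: 'k qrep) \<longleftrightarrow> \<not> (fst s \<le> fst t \<and> fst t < snd s \<and> snd s \<le> snd t)"
    by (rule hom_zero_ivl) (use assms in \<open>auto simp: chord_of_def\<close>)
  have e: "ext_zero n (iv t) (iv s :: 'k qrep) \<longleftrightarrow> \<not> (fst t < fst s \<and> fst s \<le> snd t \<and> snd t < snd s)"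
  proof
    assume "ext_zero n (iv t) (iv s :: 'k qrep)"
    then show "\<not> (fst t < fst s \<and> fst s \<le> snd t \<and> snd t < snd s)"
      using not_ext_zero_ivl[of "fst t" "fst s" "snd t" "snd s" n, where 'k = 'k] assms by (auto simp: chord_of_def)
  next
    assume "\<not> (fst t < fst s \<and> fst s \<le> snd t \<and> snd t < snd s)"
    then show "ext_zero n (iv t) (iv s :: 'k qrep)"
      by (intro ext_zero_ivl) (use assms in \<open>auto simp: chord_of_def\<close>)
  qed
  show ?thesis unfolding h e exc_def by blast
qed

definition represents :: "nat \<Rightarrow> (nat \<Rightarrow> 'k::field qrep) \<Rightarrow> (nat \<Rightarrow> nat \<times> nat) \<Rightarrow> bool" where
  "represents n E t \<longleftrightarrow> (\<forall>i\<in>{1..n}. chord_of (Suc n) (t i) \<and> is_rep n (E i) \<and> rep_iso n (E i) (iv (t i)))"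

lemma representsD:
  assumes "represents n E t" "i \<in> {1..n}"
  shows "chord_of (Suc n) (t i)" "is_rep n (E i)" "rep_iso n (E i) (iv (t i))"
  using assms unfolding represents_def by blast+

lemma represents_exc:
  assumes "represents n E t" "i \<in> {1..n}" "k \<in> {1..n}"
  shows "hom_zero n (E k) (E i) \<and> ext_zero n (E k) (E i) \<longleftrightarrow> exc (t i) (t k)"
proof -
  note i = representsD[OF assms(1,2)] and k = representsD[OF assms(1,3)]
  have "hom_zero n (E k) (E i) \<longleftrightarrow> hom_zero n (iv (t k)) (iv (t i) :: 'a qrep)"
    using hom_zero_iso[OF k(2) ivl_rep i(2) ivl_rep k(3) i(3)]
      hom_zero_iso[OF ivl_rep k(2) ivl_rep i(2) rep_iso_sym[OF k(3)] rep_iso_sym[OF i(3)]] by blast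
  moreover have "ext_zero n (E k) (E i) \<longleftrightarrow> ext_zero n (iv (t k)) (iv (t i) :: 'a qrep)"
    using ext_zero_iso[OF k(2) i(2) k(3) i(3)]
      ext_zero_iso[OF ivl_rep ivl_rep rep_iso_sym[OF k(3)] rep_iso_sym[OF i(3)]] by blast
  ultimately show ?thesis using vanishing_iff_exc[OF i(1) k(1), where 'k = 'a] by simp
qed

lemma represents_complete:
  assumes "represents n E t"
  shows "complete_exceptional n E \<longleftrightarrow> exc_seq n t"
proof -
  have "rigid n (E i) \<and> indecomposable n (E i)" if i: "i \<in> {1..n}" for i
  proof
    note D = representsD[OF assms i]
    have "ext_zero n (iv (t i)) (iv (t i) :: 'a qrep)"
      by (rule ext_zero_ivl) (use D in \<open>auto simp: chord_of_def\<close>)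
    then show "rigid n (E i)" unfolding rigid_def
      by (rule ext_zero_iso[OF ivl_rep ivl_rep rep_iso_sym[OF D(3)] rep_iso_sym[OF D(3)]])
    have "indecomposable n (iv (t i) :: 'a qrep)"
      by (rule indecomposable_ivl) (use D in \<open>auto simp: chord_of_def\<close>)
    then show "indecomposable n (E i)"
      by (rule indecomposable_iso[OF ivl_rep D(2) rep_iso_sym[OF D(3)]])
  qed
  then show ?thesis
    using represents_exc[OF assms] representsD(1,2)[OF assms]
    unfolding complete_exceptional_def exc_seq_def by blast
qed

lemma ex_represents:
  assumes "complete_exceptional n E"
  obtains t where "represents n E t"
proof -
  have "\<exists>s. chord_of (Suc n) s \<and> is_rep n (E i) \<and> rep_iso n (E i) (iv s)" if i: "i \<in> {1..n}" for i
  proof -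
    have ind: "indecomposable n (E i)" using assms i unfolding complete_exceptional_def by blast
    obtain a b where "1 \<le> a" "a < b" "b \<le> Suc n" "rep_iso n (E i) (ivl a b)"
      by (rule indecomposable_is_ivl[OF ind])
    then show ?thesis using ind by (intro exI[of _ "(a, b)"]) (simp add: chord_of_def indecomposable_def)
  qed
  then obtain t where "\<forall>i\<in>{1..n}. chord_of (Suc n) (t i) \<and> is_rep n (E i) \<and> rep_iso n (E i) (iv (t i))"
    using bchoice[of "{1..n}" "\<lambda>i s. chord_of (Suc n) s \<and> is_rep n (E i) \<and> rep_iso n (E i) (iv s)"] by blast
  then show thesis using that unfolding represents_def by blast
qed

lemma represents_supp:
  assumes "represents n E t" "i \<in> {1..n}"
  shows "supp n (E i) = {fst (t i)..<snd (t i)}"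
proof -
  note D = representsD[OF assms]
  show ?thesis unfolding iso_supp[OF D(3)] by (rule ivl_supp) (use D(1) in \<open>auto simp: chord_of_def\<close>)
qed

text \<open>The chord can be read off from the support.\<close>

lemma represents_unique:
  assumes "represents n E t" "represents n E' t'" "i \<in> {1..n}" "E i = E' i"
  shows "t i = t' i"
proof -
  have "{fst (t i)..<snd (t i)} = {fst (t' i)..<snd (t' i)}"
    using represents_supp[OF assms(1,3)] represents_supp[OF assms(2,3)] assms(4) by simp
  then show ?thesis using representsD(1)[OF assms(1,3)] representsD(1)[OF assms(2,3)]
    by (simp add: chord_of_def prod_eq_iff atLeastLessThan_eq_iff)
qed

lemma exc_seq_cong: "exc_seq n t \<Longrightarrow> (\<And>i. i \<in> {1..n} \<Longrightarrow> t i = t' i) \<Longrightarrow> exc_seq n t'"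
  unfolding exc_seq_def by simp

lemma completion_determined:
  assumes "exc_seq n t" "exc_seq n t'" "j \<in> {1..n}" "\<And>i. i \<in> {1..n} \<Longrightarrow> i \<noteq> j \<Longrightarrow> t i = t' i" "i \<in> {1..n}"
  shows "t i = t' i"
proof (cases "i = j")
  case True
  have "exc_seq n (t(j := t j))" "exc_seq n (t(j := t' j))"
    using exc_seq_cong[OF assms(1)] exc_seq_cong[OF assms(2)] assms(4) by simp_all
  then have "t j = t' j" using completion_unique assms(3) by blast
  then show ?thesis using True by simp
qed (use assms in blast)

definition mut_seq :: "nat \<Rightarrow> (nat \<Rightarrow> nat \<times> nat) \<Rightarrow> nat \<Rightarrow> nat \<times> nat" where
  "mut_seq i t = t(i := mut (t i) (t (Suc i)), Suc i := t i)"

text \<open>Mutation shows that \<open>SOME\<close> has a witness. Whatever module it picks has a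
  chord that completes the same \<open>n - 1\<close> others, so it is the chord of the
  mutation.\<close>

lemma braid_represents:
  assumes E: "represents n E t" and t: "exc_seq n t" and i: "i \<in> {1..<n}"
  shows "represents n (braid n i E) (mut_seq i t)"
proof -
  let ?t = "mut_seq i t"
  let ?E = "\<lambda>X. E(i := X, Suc i := E i)"
  have i': "i \<in> {1..n}" "Suc i \<in> {1..n}" using i by auto
  have t': "exc_seq n ?t" using exc_seq_mut[OF t i] by (simp add: mut_seq_def)
  have ch: "chord_of (Suc n) (?t k)" if "k \<in> {1..n}" for k using t' that by (simp add: exc_seq_def)
  have r: "represents n (?E (iv (?t i))) ?t"
    unfolding represents_def
  proof
    fix k assume k: "k \<in> {1..n}"
    consider "k = i" | "k = Suc i" | "k \<noteq> i" "k \<noteq> Suc i" by blast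
    then show "chord_of (Suc n) (?t k) \<and> is_rep n (?E (iv (?t i)) k) \<and> rep_iso n (?E (iv (?t i)) k) (iv (?t k))"
      by cases (use ch[OF k] representsD[OF E i'(1)] representsD[OF E k] in \<open>auto simp: mut_seq_def rep_iso_refl\<close>)
  qed
  let ?X = "SOME X. complete_exceptional n (?E X)"
  have c: "complete_exceptional n (?E ?X)"
    by (rule someI[of _ "iv (?t i)"]) (use represents_complete[OF r] t' in blast)
  then obtain u where u: "represents n (?E ?X) u" by (rule ex_represents)
  then have eu: "exc_seq n u" using represents_complete c by blast
  have "u k = ?t k" if "k \<in> {1..n}" "k \<noteq> i" for k
    by (rule represents_unique[OF u r that(1)]) (use that in simp)
  then have "u k = ?t k" if "k \<in> {1..n}" for k
    using completion_determined[OF eu t' i'(1)] that by blast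
  then have "represents n (?E ?X) ?t" using u unfolding represents_def by simp
  then show ?thesis by (simp add: braid_def)
qed

lemma delta_represents:
  assumes E: "represents n E t" and t: "exc_seq n t" and n: "n \<ge> 1"
  shows "represents n (delta n E) (rotate_seq n t)"
proof -
  \<comment> \<open>Nothing is said about entry \<open>m\<close>, the one that started at position
    \<open>n\<close> and has been mutated on its way to the left.\<close>
  have "\<exists>s. represents n (foldr (braid n) [m..<n] E) s \<and> exc_seq n s \<and>
      (\<forall>k. m < k \<longrightarrow> k \<le> n \<longrightarrow> s k = t (k - 1)) \<and> (\<forall>k. 1 \<le> k \<longrightarrow> k < m \<longrightarrow> s k = t k)"
    if "1 \<le> m" "m \<le> n" for m
    using that
  proof (induction "n - m" arbitrary: m)
    case 0
    then show ?case using E t by (intro exI[of _ t]) auto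
  next
    case (Suc d)
    then have m: "1 \<le> m" "m < n" by auto
    have "d = n - Suc m" "1 \<le> Suc m" "Suc m \<le> n" using Suc.hyps(2) m by auto
    from Suc.hyps(1)[OF this] obtain s where s: "represents n (foldr (braid n) [Suc m..<n] E) s" "exc_seq n s"
      "\<forall>k. Suc m < k \<longrightarrow> k \<le> n \<longrightarrow> s k = t (k - 1)" "\<forall>k. 1 \<le> k \<longrightarrow> k < Suc m \<longrightarrow> s k = t k"
      by blast
    have "represents n (foldr (braid n) [m..<n] E) (mut_seq m s)"
      using braid_represents[OF s(1,2), of m] m by (simp add: upt_conv_Cons)
    moreover have "exc_seq n (mut_seq m s)" using exc_seq_mut[OF s(2), of m] m by (simp add: mut_seq_def)
    moreover have "mut_seq m s k = t (k - 1)" if "m < k" "k \<le> n" for k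
      using that s(3,4) m by (cases "k = Suc m") (auto simp: mut_seq_def)
    moreover have "mut_seq m s k = t k" if "1 \<le> k" "k < m" for k
      using that s(4) by (auto simp: mut_seq_def)
    ultimately show ?case using m by (intro exI[of _ "mut_seq m s"]) auto
  qed
  from this[of 1] n obtain s where s: "represents n (delta n E) s" "exc_seq n s"
    "\<forall>k. 1 < k \<longrightarrow> k \<le> n \<longrightarrow> s k = t (k - 1)"
    unfolding delta_def by auto
  \<comment> \<open>Both sequences are complete and agree from position 2 on, which determines the
    first entry.\<close>
  have "s k = rotate_seq n t k" if "k \<in> {1..n}" for k
    by (rule completion_determined[OF s(2) rotate_seq[OF t], of 1])
      (use n s(3) that in \<open>auto simp: rotate_seq_def\<close>)
  then show ?thesis using s(1) unfolding represents_def by simp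
qed

lemma delta_pow_represents:
  assumes "represents n E t" "exc_seq n t" "n \<ge> 1"
  shows "represents n ((delta n ^^ k) E) ((rotate_seq n ^^ k) t) \<and> exc_seq n ((rotate_seq n ^^ k) t)"
  by (induction k) (use assms delta_represents rotate_seq in auto)

lemma tau_star_ivl:
  assumes X: "is_rep n X" "rep_iso n X (iv s)" and Y: "is_rep n Y" "rep_iso n Y (iv (rot (Suc n) s))"
    and s: "chord_of (Suc n) s"
  shows "is_tau_star n X (Y :: 'k::field qrep)"
proof -
  obtain a b where ab: "s = (a, b)" by (cases s)
  have c: "1 \<le> a" "a < b" "b \<le> Suc n" using s ab by (auto simp: chord_of_def)
  have "rep_iso n (ivl a b) X" using rep_iso_sym[OF X(2)] ab by simp
  then obtain u w where u: "iso_pair n (ivl a b) X u w" unfolding rep_iso_iff by blast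
  show ?thesis
  proof (cases "b = Suc n")
    case True
    then have an: "a \<le> n" using c by simp
    have "rep_iso n (ivl 1 (Suc a)) Y" using rep_iso_sym[OF Y(2)] ab True by (simp add: rot_def)
    then obtain u' w' where u': "iso_pair n (ivl 1 (Suc a)) Y u' w'" unfolding rep_iso_iff by blast
    have "projective_rep n X" using projective_iso[OF ivl_rep X(1) u] projective_ivl[OF c(1) an] True by simp
    moreover have "projective_cover n X (simple_rep a)"
      using projective_cover_iso[OF ivl_rep X(1) simple_rep_rep u] projective_cover_ivl[OF c(1) an] True by simp
    moreover have "injective_envelope n Y (simple_rep a)"
      by (rule injective_envelope_iso[OF ivl_rep Y(1) simple_rep_rep u' injective_envelope_ivl[OF c(1) an]])
    ultimately show ?thesis unfolding is_tau_star_def using c an by auto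
  next
    case False
    then have bn: "b \<le> n" using c by simp
    have Y': "rep_iso n Y (ivl (Suc a) (Suc b))" using Y(2) ab False by (simp add: rot_def)
    \<comment> \<open>A projective module would have no nonsplit extensions, but \<open>mid\<close>
      is one with submodule \<open>ivl (Suc a) (Suc b)\<close>.\<close>
    have "\<not> projective_rep n X"
    proof
      assume "projective_rep n X"
      then have e: "ext_zero n X (ivl (Suc a) (Suc b))" by (rule projective_ext_zero)
      have "ext_zero n (ivl a b) (ivl (Suc a) (Suc b) :: 'k qrep)"
        by (rule ext_zero_iso[OF X(1) ivl_rep _ rep_iso_refl[OF ivl_rep] e]) (use X(2) ab in simp)
      then show False using not_ext_zero_ivl[of a "Suc a" b "Suc b" n, where 'k = 'k] c bn by simp
    qed
    moreover have "is_AR_translate n X Y"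
      by (rule AR_iso[OF X(1) ivl_rep Y(1) ivl_rep _ Y' AR_ivl[OF c(1,2) bn]]) (use X(2) ab in simp)
    ultimately show ?thesis unfolding is_tau_star_def by simp
  qed
qed

lemma forest_of_represents:
  assumes E: "represents n E t" and t: "exc_seq n t"
  shows "forest_of n E = chord_forest n t"
proof -
  interpret complete_family "{1..n}" "Suc n" t using t exc_seq_family by blast
  have "supp n (E i) \<subset> supp n (E k) \<longleftrightarrow> ins i k" if "i \<in> {1..n}" "k \<in> {1..n}" for i k
    using representsD(1)[OF E that(1)] representsD(1)[OF E that(2)]
    unfolding represents_supp[OF E that(1)] represents_supp[OF E that(2)] ins_def chord_of_def prod_eq_iff psubset_eq
    by (simp add: ivl_subset atLeastLessThan_eq_iff)
  then have "forest_of n E = {(i, k). i \<in> {1..n} \<and> k \<in> {1..n} \<and> ins i k \<and> \<not> (\<exists>l\<in>{1..n}. ins i l \<and> ins l k)}"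
    unfolding forest_of_def by (intro Collect_cong) (simp split: prod.splits, metis atLeastAtMost_iff)
  then show ?thesis unfolding chord_forest_def child_def .
qed

theorem corollary4p6:
  fixes n :: nat and E E' :: "nat \<Rightarrow> 'k::field qrep" and F F' :: forest
    and p :: nat and j :: "nat \<Rightarrow> nat"
  assumes "n \<ge> 1"
    and "complete_exceptional n E"
    and "E' = (delta n ^^ n) E"
    and "F = forest_of n E"
    and "F' = forest_of n E'"
    and "projective_vertices n F p j"
  shows "(\<forall>i\<in>{1..n}. is_tau_star n (E i) (E' i)) \<and>
    (\<exists>\<phi>. graph_iso {0..n} (plus_edges n F') {0..n} (plus_edges n F) \<phi> \<and>
      \<phi> (j p) = 0 \<and>
      \<phi> 0 = j 1 \<and>
      (\<forall>i\<in>{1..<p}. \<phi> (j i) = j (Suc i)) \<and>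
      (\<forall>k\<in>{1..n} - j ` {1..p}. \<phi> k = k)) \<and>
    injective_vertices n F' p j \<and>
    forest_roots n F' = insert (j 1) (children F (j 1))"
proof -
  obtain t where E: "represents n E t" using assms(2) by (rule ex_represents)
  have t: "exc_seq n t" using represents_complete[OF E] assms(2) by blast
  let ?t = "\<lambda>i. rot (Suc n) (t i)"
  have r: "(rotate_seq n ^^ n) t i = ?t i" if "i \<in> {1..n}" for i
    using rotate_seq_pow[of n n i t] that by simp
  have E': "represents n E' ?t" and t': "exc_seq n ?t"
  proof -
    have *: "represents n E' ((rotate_seq n ^^ n) t)" "exc_seq n ((rotate_seq n ^^ n) t)"
      using delta_pow_represents[OF E t assms(1), of n] assms(3) by auto
    show "represents n E' ?t" using *(1) r unfolding represents_def by simp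
    show "exc_seq n ?t" by (rule exc_seq_cong[OF *(2) r])
  qed
  have F: "F = chord_forest n t" "F' = chord_forest n ?t"
    using forest_of_represents[OF E t] forest_of_represents[OF E' t'] assms(4,5) by auto
  interpret rotated_pair n t p j
    unfolding rotated_pair_def rotated_pair_axioms_def using t t' assms(1,6) F exc_seq_family by blast
  have "is_tau_star n (E i) (E' i)" if i: "i \<in> {1..n}" for i
    by (rule tau_star_ivl[OF representsD(2,3)[OF E i] representsD(2,3)[OF E' i] representsD(1)[OF E i]])
  moreover have "cyc k = k" if "k \<in> {1..n} - j ` {1..p}" for k
  proof (rule cyc_npv)
    show "\<not> pv k"
    proof
      assume "pv k"
      then obtain i where "1 \<le> i" "i \<le> p" "k = j i" by (rule pv_obtain)
      then show False using that by auto
    qed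
  qed (use that in blast)
  ultimately show ?thesis
    unfolding F using cyc_iso cyc_p cyc_0 cyc_j inj_vertices roots_eq
    by (intro conjI exI[of _ cyc]) auto
qed

end
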